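(* Let $F \in \mathcal M\Phi_+(H_{\mathcal A})$, $D \in \mathcal M\Phi_-(H_{\mathcal A})$ and suppose that there exist decompositions $$H_{\mathcal A} = M_1 \tilde\oplus N_1 \stackrel{F}{\longrightarrow} N_2^\perp \oplus N_2 = H_{\mathcal A}, \qquad H_{\mathcal A} = {N_1'}^\perp \oplus N_1' \stackrel{D}{\longrightarrow} M_2' \tilde\oplus N_2' = H_{\mathcal A}$$ with respect to which $F, D$ have the matrices $\begin{pmatrix} F_1 & 0\\ 0 & F_4\end{pmatrix}$, $\begin{pmatrix} D_1 & 0\\ 0 & D_4\end{pmatrix}$, respectively, where $F_1, D_1$ are isomorphisms and $N_1, N_2'$ are finitely generated. Assume also that one of the following statements holds: a) There exists some $J \in B^a(N_2, N_1')$ such that $N_2 \cong \operatorname{Im} J$ and $(\operatorname{Im} J)^\perp$ is finitely generated. b) There exists some $J' \in B^a(N_1', N_2)$ such that $N_1' \cong \operatorname{Im} J'$ and $(\operatorname{Im} J')^\perp$ is finitely generated. Here $(\operatorname{Im} J)^\perp$ denotes the orthogonal complement of $\operatorname{Im} J$ in $N_1'$ and $(\operatorname{Im} J')^\perp$ the orthogonal complement of $\operatorname{Im} J'$ in $N_2$. Then $\mathbf M_C^{\mathcal A} = \begin{pmatrix} F & C \\ 0 & D\end{pmatrix} \in \mathcal M\Phi(H_{\mathcal A}\oplus H_{\mathcal A})$ for some $C \in B^a(H_{\mathcal A})$.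
   Context: $\mathcal A$ is a unital $C^*$-algebra and $H_{\mathcal A} = \ell^2(\mathcal A)$ is the standard Hilbert $\mathcal A$-module. For Hilbert $\mathcal A$-modules $H,K$, $B^a(H,K)$ denotes the bounded adjointable $\mathcal A$-linear operators $H\to K$, and $B^a(H) = B^a(H,H)$. $\oplus$ is the orthogonal direct sum; $\tilde\oplus$ denotes a direct sum of closed submodules that need not be orthogonal. A Hilbert module is finitely generated if it equals the linear span (over $\mathbb C$ and $\mathcal A$) of a finite subset. An isomorphism is a bounded $\mathcal A$-linear bijection with bounded inverse, and $\cong$ means existence of an isomorphism. For a decomposition $H = M_1\tilde\oplus N_1 \stackrel{F}{\longrightarrow} M_2\tilde\oplus N_2 = H$ into closed submodules, saying $F$ has matrix $\begin{pmatrix} F_1 & 0\\ 0& F_4\end{pmatrix}$ means $F(M_1)\subseteq M_2$, $F(N_1)\subseteq N_2$, $F_1 = F|_{M_1}: M_1\to M_2$, $F_4 = F|_{N_1}: N_1\to N_2$. For $H = H_{\mathcal A}$ or $H_{\mathcal A}\oplus H_{\mathcal A}$: $F\in B^a(H)$ is upper semi-$\mathcal A$-Fredholm, $F\in\mathcal M\Phi_+(H)$, if there is such a decomposition with diagonal matrix, $F_1$ an isomorphism and $N_1$ finitely generated; lower semi-$\mathcal A$-Fredholm, $F\in\mathcal M\Phi_-(H)$, if the same holds with $N_2$ (instead of $N_1$) finitely generated; $\mathcal A$-Fredholm, $F\in\mathcal M\Phi(H)$, if the same holds with both $N_1$ and $N_2$ finitely generated. *)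

theory Defs
  imports
    Complex_Main
    "HOL-Library.Function_Algebras"
    "HOL-Library.Product_Plus"
begin

class unital_cstar_algebra = real_normed_algebra_1 + banach +
  fixes scaleC :: "complex \<Rightarrow> 'a \<Rightarrow> 'a"  (infixr "*\<^sub>C" 75)
    and star :: "'a \<Rightarrow> 'a"
  assumes scaleC_of_real: "complex_of_real r *\<^sub>C x = r *\<^sub>R x"
    and scaleC_add_right: "c *\<^sub>C (x + y) = c *\<^sub>C x + c *\<^sub>C y"
    and scaleC_add_left: "(c + d) *\<^sub>C x = c *\<^sub>C x + d *\<^sub>C x"
    and scaleC_scaleC: "c *\<^sub>C d *\<^sub>C x = (c * d) *\<^sub>C x"
    and mult_scaleC_left: "(c *\<^sub>C x) * y = c *\<^sub>C (x * y)"
    and mult_scaleC_right: "x * (c *\<^sub>C y) = c *\<^sub>C (x * y)"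
    and norm_scaleC: "norm (c *\<^sub>C x) = cmod c * norm x"
    and star_star: "star (star x) = x"
    and star_add: "star (x + y) = star x + star y"
    and star_mult: "star (x * y) = star y * star x"
    and star_scaleC: "star (c *\<^sub>C x) = cnj c *\<^sub>C star x"
    and cstar_identity: "norm (star x * x) = (norm x)\<^sup>2"

text \<open>
  Addition is the one of the ambient type. The inner product is conjugate linear in the
  first and linear in the second argument. The record only bundles the data; below it is
  instantiated by the standard module, by its orthogonal double, and by submodules of these.
\<close>

record ('h, 'a) hmodule =
  hcarrier :: "'h set"
  hscale :: "complex \<Rightarrow> 'h \<Rightarrow> 'h"
  hact :: "'h \<Rightarrow> 'a \<Rightarrow> 'h"
  hinner :: "'h \<Rightarrow> 'h \<Rightarrow> 'a"

definition hnorm :: "('h, 'a::unital_cstar_algebra) hmodule \<Rightarrow> 'h \<Rightarrow> real" where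
  "hnorm H x = sqrt (norm (hinner H x x))"

text \<open>The standard Hilbert module: \<open>\<Sum>n. star (x n) * x n\<close> has to converge in norm.\<close>

definition std_module :: "(nat \<Rightarrow> 'a, 'a::unital_cstar_algebra) hmodule" where
  "std_module = \<lparr>
     hcarrier = {x. summable (\<lambda>n. star (x n) * x n)},
     hscale = (\<lambda>c x n. c *\<^sub>C x n),
     hact = (\<lambda>x a n. x n * a),
     hinner = (\<lambda>x y. \<Sum>n. star (x n) * y n)\<rparr>"

definition orth_sum ::
  "('h, 'a::unital_cstar_algebra) hmodule \<Rightarrow> ('k, 'a) hmodule \<Rightarrow> ('h \<times> 'k, 'a) hmodule"
  (infixr "\<oplus>\<^sub>H" 65) where
  "H \<oplus>\<^sub>H K = \<lparr>
     hcarrier = hcarrier H \<times> hcarrier K,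
     hscale = (\<lambda>c (x, y). (hscale H c x, hscale K c y)),
     hact = (\<lambda>(x, y) a. (hact H x a, hact K y a)),
     hinner = (\<lambda>(x, y) (x', y'). hinner H x x' + hinner K y y')\<rparr>"

text \<open>A subset \<open>M\<close> regarded as a module with the operations of \<open>H\<close>.\<close>

definition restr :: "('h, 'a::unital_cstar_algebra) hmodule \<Rightarrow> 'h set \<Rightarrow> ('h, 'a) hmodule"
  (infixl "\<restriction>\<^sub>H" 70) where
  "H \<restriction>\<^sub>H M = H\<lparr>hcarrier := M\<rparr>"

definition submodule ::
  "('h::ab_group_add, 'a::unital_cstar_algebra) hmodule \<Rightarrow> 'h set \<Rightarrow> bool" where
  "submodule H M \<longleftrightarrow> M \<subseteq> hcarrier H \<and> 0 \<in> M \<and>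
     (\<forall>x\<in>M. \<forall>y\<in>M. x + y \<in> M) \<and>
     (\<forall>c. \<forall>x\<in>M. hscale H c x \<in> M) \<and>
     (\<forall>a. \<forall>x\<in>M. hact H x a \<in> M)"

definition closed_submodule ::
  "('h::ab_group_add, 'a::unital_cstar_algebra) hmodule \<Rightarrow> 'h set \<Rightarrow> bool" where
  "closed_submodule H M \<longleftrightarrow> submodule H M \<and>
     (\<forall>X. \<forall>l\<in>hcarrier H.
        (\<forall>n::nat. X n \<in> M) \<and> (\<lambda>n. hnorm H (X n - l)) \<longlonglongrightarrow> 0 \<longrightarrow> l \<in> M)"

text \<open>The direct sum need not be orthogonal.\<close>

definition direct_sum_decomp ::
  "('h::ab_group_add, 'a::unital_cstar_algebra) hmodule \<Rightarrow> 'h set \<Rightarrow> 'h set \<Rightarrow> bool" where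
  "direct_sum_decomp H M N \<longleftrightarrow> closed_submodule H M \<and> closed_submodule H N \<and>
     M \<inter> N = {0} \<and> (\<forall>x\<in>hcarrier H. \<exists>m\<in>M. \<exists>n\<in>N. x = m + n)"

definition orth_compl ::
  "('h, 'a::unital_cstar_algebra) hmodule \<Rightarrow> 'h set \<Rightarrow> 'h set" where
  "orth_compl H M = {y \<in> hcarrier H. \<forall>x\<in>M. hinner H x y = 0}"

inductive_set hspan ::
  "('h::ab_group_add, 'a::unital_cstar_algebra) hmodule \<Rightarrow> 'h set \<Rightarrow> 'h set"
  for H :: "('h::ab_group_add, 'a::unital_cstar_algebra) hmodule" and S :: "'h set" where
  zero: "0 \<in> hspan H S"
| base: "x \<in> S \<Longrightarrow> x \<in> hspan H S"
| add: "x \<in> hspan H S \<Longrightarrow> y \<in> hspan H S \<Longrightarrow> x + y \<in> hspan H S"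
| scale: "x \<in> hspan H S \<Longrightarrow> hscale H c x \<in> hspan H S"
| act: "x \<in> hspan H S \<Longrightarrow> hact H x a \<in> hspan H S"

definition finitely_generated ::
  "('h::ab_group_add, 'a::unital_cstar_algebra) hmodule \<Rightarrow> bool" where
  "finitely_generated H \<longleftrightarrow> (\<exists>S. finite S \<and> S \<subseteq> hcarrier H \<and> hcarrier H = hspan H S)"

text \<open>
  Operators are functions on the whole ambient type of which only the values on the carrier
  of the domain matter.
\<close>

definition bounded_module_map ::
  "('h::ab_group_add, 'a::unital_cstar_algebra) hmodule \<Rightarrow> ('k::ab_group_add, 'a) hmodule
     \<Rightarrow> ('h \<Rightarrow> 'k) \<Rightarrow> bool" where
  "bounded_module_map H K T \<longleftrightarrow>
     (\<forall>x\<in>hcarrier H. T x \<in> hcarrier K) \<and>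
     (\<forall>x\<in>hcarrier H. \<forall>y\<in>hcarrier H. T (x + y) = T x + T y) \<and>
     (\<forall>c. \<forall>x\<in>hcarrier H. T (hscale H c x) = hscale K c (T x)) \<and>
     (\<forall>a. \<forall>x\<in>hcarrier H. T (hact H x a) = hact K (T x) a) \<and>
     (\<exists>B. \<forall>x\<in>hcarrier H. hnorm K (T x) \<le> B * hnorm H x)"

definition adjointable_maps ::
  "('h::ab_group_add, 'a::unital_cstar_algebra) hmodule \<Rightarrow> ('k::ab_group_add, 'a) hmodule
     \<Rightarrow> ('h \<Rightarrow> 'k) set"  ("B\<^sup>a") where
  "B\<^sup>a H K = {T. bounded_module_map H K T \<and>
     (\<exists>S. bounded_module_map K H S \<and>
        (\<forall>x\<in>hcarrier H. \<forall>y\<in>hcarrier K. hinner K (T x) y = hinner H x (S y)))}"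

definition module_iso ::
  "('h::ab_group_add, 'a::unital_cstar_algebra) hmodule \<Rightarrow> ('k::ab_group_add, 'a) hmodule
     \<Rightarrow> ('h \<Rightarrow> 'k) \<Rightarrow> bool" where
  "module_iso H K T \<longleftrightarrow> bounded_module_map H K T \<and>
     bij_betw T (hcarrier H) (hcarrier K) \<and>
     bounded_module_map K H (inv_into (hcarrier H) T)"

definition isomorphic ::
  "('h::ab_group_add, 'a::unital_cstar_algebra) hmodule \<Rightarrow> ('k::ab_group_add, 'a) hmodule \<Rightarrow> bool"
  (infix "\<cong>\<^sub>H" 50) where
  "H \<cong>\<^sub>H K \<longleftrightarrow> (\<exists>T. module_iso H K T)"

text \<open>
  With respect to \<open>H = M\<^sub>1 + N\<^sub>1\<close> in the domain and \<open>H = M\<^sub>2 + N\<^sub>2\<close> in the codomain, \<open>F\<close> has a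
  diagonal matrix whose upper left entry is an isomorphism.
\<close>

definition diag_decomp ::
  "('h::ab_group_add, 'a::unital_cstar_algebra) hmodule \<Rightarrow> ('h \<Rightarrow> 'h)
     \<Rightarrow> 'h set \<Rightarrow> 'h set \<Rightarrow> 'h set \<Rightarrow> 'h set \<Rightarrow> bool" where
  "diag_decomp H F M\<^sub>1 N\<^sub>1 M\<^sub>2 N\<^sub>2 \<longleftrightarrow>
     direct_sum_decomp H M\<^sub>1 N\<^sub>1 \<and> direct_sum_decomp H M\<^sub>2 N\<^sub>2 \<and>
     F ` M\<^sub>1 \<subseteq> M\<^sub>2 \<and> F ` N\<^sub>1 \<subseteq> N\<^sub>2 \<and>
     module_iso (H \<restriction>\<^sub>H M\<^sub>1) (H \<restriction>\<^sub>H M\<^sub>2) F"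

definition upper_semi_Fredholm ::
  "('h::ab_group_add, 'a::unital_cstar_algebra) hmodule \<Rightarrow> ('h \<Rightarrow> 'h) set"  ("M\<Phi>\<^sub>+") where
  "M\<Phi>\<^sub>+ H = {F \<in> B\<^sup>a H H. \<exists>M\<^sub>1 N\<^sub>1 M\<^sub>2 N\<^sub>2. diag_decomp H F M\<^sub>1 N\<^sub>1 M\<^sub>2 N\<^sub>2 \<and>
     finitely_generated (H \<restriction>\<^sub>H N\<^sub>1)}"

definition lower_semi_Fredholm ::
  "('h::ab_group_add, 'a::unital_cstar_algebra) hmodule \<Rightarrow> ('h \<Rightarrow> 'h) set"  ("M\<Phi>\<^sub>-") where
  "M\<Phi>\<^sub>- H = {F \<in> B\<^sup>a H H. \<exists>M\<^sub>1 N\<^sub>1 M\<^sub>2 N\<^sub>2. diag_decomp H F M\<^sub>1 N\<^sub>1 M\<^sub>2 N\<^sub>2 \<and>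
     finitely_generated (H \<restriction>\<^sub>H N\<^sub>2)}"

definition Fredholm ::
  "('h::ab_group_add, 'a::unital_cstar_algebra) hmodule \<Rightarrow> ('h \<Rightarrow> 'h) set"  ("M\<Phi>") where
  "M\<Phi> H = {F \<in> B\<^sup>a H H. \<exists>M\<^sub>1 N\<^sub>1 M\<^sub>2 N\<^sub>2. diag_decomp H F M\<^sub>1 N\<^sub>1 M\<^sub>2 N\<^sub>2 \<and>
     finitely_generated (H \<restriction>\<^sub>H N\<^sub>1) \<and> finitely_generated (H \<restriction>\<^sub>H N\<^sub>2)}"

definition upper_triangular :: "('h \<Rightarrow> 'h) \<Rightarrow> ('k \<Rightarrow> 'h::plus) \<Rightarrow> ('k \<Rightarrow> 'k) \<Rightarrow> 'h \<times> 'k \<Rightarrow> 'h \<times> 'k" where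
  "upper_triangular F C D = (\<lambda>(x, y). (F x + C y, D y))"

end

theory Submission imports Defs "HOL-Analysis.Analysis" begin

text \<open>
  The adjointable operators on the standard module form a unital C*-algebra, so positivity, square
  roots and inverses of \<open>a + e\<close> are available for them. Let \<open>p\<close> and \<open>r\<close> be the orthogonal projections
  onto \<open>N\<^sub>2\<close> and \<open>N\<^sub>1'\<close>. Since \<open>(1 - p) F\<close> maps onto the range of \<open>1 - p\<close> and \<open>D (1 - r)\<close> is bounded
  below on the range of \<open>1 - r\<close>, they have adjointable one-sided inverses \<open>R\<close> and \<open>L\<close>. If a partial
  isometry \<open>C\<close> has initial projection \<open>s \<le> r\<close> and final projection \<open>t \<le> p\<close> such that \<open>r - s\<close> and
  \<open>p - t\<close> have finitely generated range, then the operator matrix is invertible modulo finitely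
  generated complements; the inverse is the matrix with rows \<open>R, 0\<close> and
  \<open>(1 - L D) C\<^sup>* (1 - F R), L\<close>.

  In case a) \<open>C\<^sup>*\<close> has to map \<open>N\<^sub>2\<close> unitarily onto \<open>Im J\<close>. The isomorphism \<open>N\<^sub>2 \<cong> Im J\<close> is not assumed
  to be \<open>J\<close>, nor to be adjointable. It becomes adjointable after composition with a strictly positive
  compact operator, and the polar decomposition of the composition is the required unitary.
\<close>

section \<open>Positivity in unital C*-algebras\<close>

text \<open>Two facts about Hilbert spaces fail for Hilbert modules: a closed submodule need not
  have an orthogonal complement, and a bounded module map need not have an adjoint. Projections are
  therefore taken only from the given orthogonal decompositions and from closed ranges of
  adjointable operators. The given isomorphisms serve for norm estimates and for their images only,
  and adjointable inverses are built anew from those estimates. This explains the two ingredients of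
  a) and b): the isomorphism makes \<open>Im J\<close> closed, and the adjointability of
  \<open>J\<close> then makes it complemented in \<open>N\<^sub>1'\<close>. The polar decomposition
  meets the same obstacle: it exists only if the closures of the relevant ranges are complemented.
  Here both closures are ranges of projections known beforehand, which is what the density arguments
  establish.\<close>

lemma star_zero [simp]: "star 0 = 0"
  by (metis add_cancel_right_left star_add)

lemma star_uminus: "star (- x) = - star x"
  by (metis add.right_inverse add_eq_0_iff star_add star_zero)

lemma star_diff: "star (x - y) = star x - star y"
  using star_add[of x "- y"] by (simp add: star_uminus)

lemma star_one [simp]: "star 1 = 1"
  by (metis mult.right_neutral star_mult star_star)

lemma star_scaleR: "star (r *\<^sub>R x) = r *\<^sub>R star x"
  by (metis complex_cnj_complex_of_real scaleC_of_real star_scaleC)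

lemma star_of_real [simp]: "star (of_real r) = of_real r"
  by (simp add: of_real_def star_scaleR)

lemma norm_star [simp]: "norm (star x) = norm x"
proof -
  have le: "norm y \<le> norm (star y)" for y :: 'a
  proof (cases "y = 0")
    case False
    have "norm y * norm y \<le> norm (star y) * norm y"
      using cstar_identity[of y] norm_mult_ineq[of "star y" y] by (simp add: power2_eq_square)
    then show ?thesis using False by simp
  qed simp
  show ?thesis using le[of x] le[of "star x"] by (simp add: star_star)
qed

lemma bounded_linear_star: "bounded_linear (star :: 'a::unital_cstar_algebra \<Rightarrow> 'a)"
  by (rule bounded_linear_intro[where K=1]) (auto simp: star_add star_scaleR)

lemmas tendsto_star [tendsto_intros] = bounded_linear.tendsto[OF bounded_linear_star]

lemma star_sum: "star (sum f I) = (\<Sum>i\<in>I. star (f i :: 'a::unital_cstar_algebra))"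
  using bounded_linear.linear[OF bounded_linear_star] by (rule linear_sum)

lemma star_power: "star (x ^ n) = star x ^ n"
  by (induction n) (auto simp: star_mult power_commutes)

lemma star_mult_self_eq_0_iff: "star x * x = 0 \<longleftrightarrow> x = 0"
  by (metis cstar_identity mult_zero_right norm_eq_zero power_eq_0_iff)

lemma scaleC_minus_one: "(-1) *\<^sub>C x = - x"
  using scaleC_of_real[of "-1" x] by simp

lemma scaleC_minus_minus: "(- c) *\<^sub>C (- x) = c *\<^sub>C x"
proof -
  have "(- c) *\<^sub>C (- x) = (- c) *\<^sub>C (- 1) *\<^sub>C x" by (simp only: scaleC_minus_one)
  then show ?thesis by (simp add: scaleC_scaleC)
qed

lemma scaleC_diff_right: "c *\<^sub>C (x - y) = c *\<^sub>C x - c *\<^sub>C y"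
  using scaleC_add_right[of c "x - y" y] by simp

lemma bounded_linear_scaleC: "bounded_linear (\<lambda>x::'a::unital_cstar_algebra. c *\<^sub>C x)"
proof (rule bounded_linear_intro[where K="cmod c"])
  show "c *\<^sub>C (r *\<^sub>R x) = r *\<^sub>R (c *\<^sub>C x)" for r and x :: 'a
    by (metis mult.commute scaleC_of_real scaleC_scaleC)
qed (auto simp: scaleC_add_right norm_scaleC mult.commute)

text \<open>For self-adjoint \<open>a\<close>, \<open>norm (r - a) \<le> r\<close> says that the spectrum of \<open>a\<close> lies in \<open>[0, 2 r]\<close>.\<close>

definition cpos :: "'a::unital_cstar_algebra \<Rightarrow> bool" where
  "cpos a \<longleftrightarrow> star a = a \<and> (\<exists>r. norm (of_real r - a) \<le> r)"

text \<open>The estimate persists when \<open>r\<close> grows, so a radius that may be divided by is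
  always available.\<close>

lemma cposE:
  assumes "cpos a"
  obtains r where "r \<ge> b" "norm (of_real r - a) \<le> r"
proof -
  from assms obtain r where r: "norm (of_real r - a) \<le> r" by (auto simp: cpos_def)
  define s where "s = max b r"
  have "norm (of_real s - a) \<le> norm (of_real (s - r) :: 'a) + norm (of_real r - a)"
    using norm_triangle_ineq[of "of_real (s - r)" "of_real r - a"] by simp
  also have "\<dots> \<le> (s - r) + r" using r by (auto simp: s_def norm_of_real simp del: of_real_diff)
  finally show ?thesis using that[of s] by (simp add: s_def)
qed

lemma cpos_star: "cpos a \<Longrightarrow> star a = a" by (simp add: cpos_def)

lemma cpos_0 [simp]: "cpos 0" unfolding cpos_def by (auto intro!: exI[of _ 0])

lemma cpos_add:
  assumes "cpos a" "cpos b" shows "cpos (a + b)"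
proof -
  obtain r s where r: "norm (of_real r - a) \<le> r" and s: "norm (of_real s - b) \<le> s"
    using assms by (auto simp: cpos_def)
  have "norm (of_real (r + s) - (a + b)) \<le> norm (of_real r - a) + norm (of_real s - b)"
    using norm_triangle_ineq[of "of_real r - a" "of_real s - b"] by (simp add: algebra_simps)
  then show ?thesis using r s assms unfolding cpos_def
    by (auto simp: star_add intro!: exI[of _ "r + s"])
qed

lemma cpos_sum: "(\<And>i. i \<in> I \<Longrightarrow> cpos (f i)) \<Longrightarrow> cpos (sum f I)"
  by (induction I rule: infinite_finite_induct) (auto intro: cpos_add)

lemma cpos_scaleR:
  assumes "cpos a" "0 \<le> t" shows "cpos (t *\<^sub>R a)"
proof -
  obtain r where r: "norm (of_real r - a) \<le> r" using assms by (auto simp: cpos_def)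
  have "of_real (t * r) - t *\<^sub>R a = t *\<^sub>R (of_real r - a)"
    by (simp add: of_real_def scaleR_diff_right)
  then have "norm (of_real (t * r) - t *\<^sub>R a) \<le> t * r"
    using r assms(2) by (simp add: mult_left_mono del: of_real_mult)
  then show ?thesis using assms(1) unfolding cpos_def
    by (auto simp: star_scaleR simp del: of_real_mult)
qed

lemma cpos_norm_diff: "star a = a \<Longrightarrow> norm a \<le> r \<Longrightarrow> cpos (of_real r - a)"
  by (auto simp: cpos_def star_diff intro!: exI[of _ r])

text \<open>\<open>y\<close> is the limit of the iteration \<open>y \<mapsto> (t + y\<^sup>2) / 2\<close> from \<open>0\<close>; its increments are bounded by
  those of the convergent scalar iteration with \<open>t = 1\<close>.\<close>

lemma sqrt_one_minus:
  fixes t :: "'a::unital_cstar_algebra"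
  assumes "norm t \<le> 1"
  obtains y where "(1 - y) * (1 - y) = 1 - t" "norm y \<le> 1" "star t = t \<Longrightarrow> star y = y"
    "\<And>z. z * t = t * z \<Longrightarrow> z * y = y * z"
proof -
  define Y :: "nat \<Rightarrow> 'a" where "Y = rec_nat 0 (\<lambda>_ y. (1/2) *\<^sub>R (t + y * y))"
  define e :: "nat \<Rightarrow> real" where "e = rec_nat 0 (\<lambda>_ y. (1 + y * y) / 2)"
  have Y0: "Y 0 = 0" and YS: "Y (Suc n) = (1/2) *\<^sub>R (t + Y n * Y n)" for n
    by (auto simp: Y_def)
  have e0: "e 0 = 0" and eS: "e (Suc n) = (1 + e n * e n) / 2" for n by (auto simp: e_def)
  have e01: "0 \<le> e n \<and> e n \<le> 1" for n
  proof (induction n)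
    case (Suc n)
    then have "e n * e n \<le> 1" by (simp add: mult_le_one)
    then show ?case by (simp add: eS)
  qed (simp add: e0)
  have emono: "e n \<le> e (Suc n)" for n
    using zero_le_square[of "1 - e n"] by (simp add: eS field_simps)
  have comm: "z * Y n = Y n * z" if "z * t = t * z" for z n
  proof (induction n)
    case (Suc n)
    have "z * (Y n * Y n) = (Y n * Y n) * z" by (metis Suc mult.assoc)
    then show ?case using that by (simp add: YS algebra_simps)
  qed (simp add: Y0)
  have commt: "t * Y n = Y n * t" for n by (rule comm) simp
  have commY: "Y m * Y n = Y n * Y m" for m n by (rule comm) (simp add: commt)
  have nY: "norm (Y n) \<le> e n" for n
  proof (induction n)
    case (Suc n)
    have "norm (Y n * Y n) \<le> e n * e n"
      by (rule order_trans[OF norm_mult_ineq]) (simp add: Suc mult_mono e01)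
    then have "norm (t + Y n * Y n) \<le> 1 + e n * e n"
      using norm_triangle_ineq[of t "Y n * Y n"] assms by linarith
    then show ?case by (simp add: YS eS)
  qed (simp add: Y0 e0)
  have nD: "norm (Y (Suc n) - Y n) \<le> e (Suc n) - e n" for n
  proof (induction n)
    case 0 then show ?case using nY[of 1] by (simp add: Y0 e0)
  next
    case (Suc n)
    have "Y (Suc (Suc n)) - Y (Suc n) = (1/2) *\<^sub>R (Y (Suc n) * Y (Suc n) - Y n * Y n)"
      unfolding YS[of "Suc n"] YS[of n] by (simp add: algebra_simps)
    also have "Y (Suc n) * Y (Suc n) - Y n * Y n = (Y (Suc n) - Y n) * (Y (Suc n) + Y n)"
      using commY[of "Suc n" n] by (simp add: algebra_simps)
    finally have "norm (Y (Suc (Suc n)) - Y (Suc n)) \<le> (1/2) * (norm (Y (Suc n) - Y n) * norm (Y (Suc n) + Y n))"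
      by (simp add: norm_mult_ineq)
    also have "\<dots> \<le> (1/2) * ((e (Suc n) - e n) * (e (Suc n) + e n))"
      using Suc emono[of n] norm_triangle_le[of "Y (Suc n)" "Y n" "e (Suc n) + e n"] nY[of "Suc n"] nY[of n]
      by (intro mult_left_mono mult_mono) auto
    also have "\<dots> = e (Suc (Suc n)) - e (Suc n)"
      unfolding eS[of "Suc n"] eS[of n] by (simp add: field_simps)
    finally show ?case .
  qed
  have "summable (\<lambda>n. e (Suc n) - e n)"
  proof (rule telescope_summable)
    have "incseq e" using emono by (rule incseq_SucI)
    then show "e \<longlonglongrightarrow> (SUP n. e n)"
      by (intro LIMSEQ_incseq_SUP) (auto intro!: bdd_aboveI[of _ 1] simp: e01)
  qed
  then have "summable (\<lambda>n. Y (Suc n) - Y n)"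
    by (rule summable_comparison_test') (use nD in auto)
  then have "(\<lambda>n. \<Sum>i<n. Y (Suc i) - Y i) \<longlonglongrightarrow> (\<Sum>n. Y (Suc n) - Y n)"
    by (rule summable_LIMSEQ)
  then obtain y where y: "Y \<longlonglongrightarrow> y" by (auto simp: sum_lessThan_telescope Y0)
  have "(\<lambda>n. Y (Suc n)) \<longlonglongrightarrow> (1/2) *\<^sub>R (t + y * y)"
    unfolding YS by (intro tendsto_intros y)
  with LIMSEQ_Suc[OF y] have yy: "y = (1/2) *\<^sub>R (t + y * y)" by (rule LIMSEQ_unique)
  have "2 *\<^sub>R y = t + y * y" by (subst yy) simp
  then have 1: "(1 - y) * (1 - y) = 1 - t" by (simp add: algebra_simps scaleR_2)
  have 2: "norm y \<le> 1"
    by (rule LIMSEQ_le_const2[OF tendsto_norm[OF y]]) (meson nY e01 order_trans)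
  have 3: "star y = y" if "star t = t"
  proof -
    have "star (Y n) = Y n" for n
      by (induction n) (auto simp: Y0 YS star_scaleR star_add star_mult that)
    with tendsto_star[OF y] have "Y \<longlonglongrightarrow> star y" by simp
    then show ?thesis using y by (rule LIMSEQ_unique)
  qed
  have 4: "z * y = y * z" if "z * t = t * z" for z
    using tendsto_mult_left[OF y, of z] tendsto_mult_right[OF y, of z]
    unfolding comm[OF that] by (rule LIMSEQ_unique)
  show ?thesis using that 1 2 3 4 by blast
qed

text \<open>After division by \<open>r\<close> the element has the form \<open>1 - t\<close> with
  \<open>norm t \<le> 1\<close>. The bound \<open>norm y \<le> 1\<close> then says that the root is
  positive with radius \<open>sqrt r\<close>. The commutation clause stands in for the fact that the
  root is a limit of polynomials in \<open>a\<close>.\<close>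

lemma cpos_sqrt:
  assumes "cpos a"
  obtains h where "cpos h" "h * h = a" "\<And>z. z * a = a * z \<Longrightarrow> z * h = h * z"
proof -
  obtain r where r: "r \<ge> 1" "norm (of_real r - a) \<le> r" using cposE[OF assms] by blast
  define t where "t = (1/r) *\<^sub>R (of_real r - a)"
  have t: "t = 1 - (1/r) *\<^sub>R a" using r by (simp add: t_def scaleR_diff_right of_real_def)
  have "norm t \<le> 1" using r by (simp add: t_def)
  then obtain y where y: "(1 - y) * (1 - y) = 1 - t" "norm y \<le> 1" "star t = t \<Longrightarrow> star y = y"
    "\<And>z. z * t = t * z \<Longrightarrow> z * y = y * z" using sqrt_one_minus by blast
  have sa: "star y = y" using cpos_star[OF assms] by (intro y(3)) (simp add: t star_diff star_scaleR)
  define h where "h = sqrt r *\<^sub>R (1 - y)"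
  have "cpos h" unfolding cpos_def
  proof (intro conjI exI[of _ "sqrt r"])
    have "of_real (sqrt r) - h = sqrt r *\<^sub>R y" by (simp add: h_def of_real_def algebra_simps)
    then show "norm (of_real (sqrt r) - h) \<le> sqrt r" using y(2) r by (simp add: mult_left_le)
  qed (simp add: h_def star_scaleR star_diff sa)
  moreover have "h * h = a" using y(1) r by (simp add: h_def t)
  moreover have "z * h = h * z" if "z * a = a * z" for z
    using y(4)[of z] that by (simp add: h_def t algebra_simps)
  ultimately show ?thesis using that by blast
qed

text \<open>If \<open>h\<^sup>2 + k\<^sup>2 = 1\<close> then \<open>h + i k\<close> is unitary and \<open>h\<close> is its real part.\<close>

lemma norm_le_one_if_squares_sum_one:
  fixes h k :: "'a::unital_cstar_algebra"
  assumes "star h = h" "star k = k" and hk: "h * k = k * h" and sum: "h * h + k * k = 1"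
  shows "norm h \<le> 1"
proof -
  define u where "u = h + \<i> *\<^sub>C k"
  have "(- \<i>) *\<^sub>C k = - (\<i> *\<^sub>C k)"
    by (metis mult_minus1 scaleC_minus_one scaleC_scaleC)
  then have su: "star u = h - \<i> *\<^sub>C k" by (simp add: u_def star_add star_scaleC assms)
  have "\<i> *\<^sub>C \<i> *\<^sub>C (k * k) = - (k * k)" by (simp add: scaleC_scaleC scaleC_minus_one)
  then have "star u * u = h * h + k * k"
    unfolding su unfolding u_def by (simp add: algebra_simps mult_scaleC_left mult_scaleC_right scaleC_diff_right hk)
  then have "norm u = 1"
    using cstar_identity[of u] by (simp add: sum power2_eq_1_iff)
      (metis norm_ge_zero not_one_le_zero neg_0_le_iff_le)
  have "2 * norm h = norm (u + star u)" unfolding su by (simp add: u_def flip: scaleR_2)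
  also have "\<dots> \<le> 2" using norm_triangle_ineq[of u "star u"] \<open>norm u = 1\<close> by simp
  finally show ?thesis by simp
qed

text \<open>For \<open>norm g \<le> 1\<close> a root \<open>s\<close> of \<open>1 - g * g\<close>
  commutes with \<open>g\<close>, and the squares of \<open>s\<close> and \<open>g\<close> add up to
  1. Hence \<open>norm s \<le> 1\<close>, and \<open>1 - g * g = s * s\<close> has norm at most 1,
  which is positivity of \<open>g * g\<close> with radius 1. The general case is scaled by
  \<open>norm h + 1\<close>, which is never 0.\<close>

lemma cpos_square:
  fixes h :: "'a::unital_cstar_algebra"
  assumes sa: "star h = h"
  shows "cpos (h * h)"
proof -
  have unit: "cpos (g * g)" if g: "star g = g" "norm g \<le> 1" for g :: 'a
  proof -
    have "norm (g * g) \<le> 1" using norm_mult_ineq[of g g] mult_le_one[of "norm g" "norm g"] g by simp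
    then obtain y where y: "(1 - y) * (1 - y) = 1 - g * g" "star (g * g) = g * g \<Longrightarrow> star y = y"
      "\<And>z. z * (g * g) = (g * g) * z \<Longrightarrow> z * y = y * z" using sqrt_one_minus by blast
    define s where "s = 1 - y"
    have ss: "star s = s" using y(2) g by (simp add: s_def star_diff star_mult)
    have gs: "g * s = s * g" using y(3)[of g] by (simp add: s_def algebra_simps)
    have "norm s \<le> 1"
      by (rule norm_le_one_if_squares_sum_one[of s g]) (use g ss gs y(1) in \<open>simp_all add: s_def\<close>)
    then have "norm (1 - g * g) \<le> 1"
      using y(1) cstar_identity[of s] by (simp add: ss power_le_one s_def[symmetric])
    then show ?thesis unfolding cpos_def using g by (auto simp: star_mult intro!: exI[of _ 1])
  qed
  define c where "c = norm h + 1"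
  have c: "c > 0" by (simp add: c_def add_nonneg_pos)
  have "norm ((1/c) *\<^sub>R h) \<le> 1" using c by (simp add: c_def field_simps)
  then have "cpos (((1/c) *\<^sub>R h) * ((1/c) *\<^sub>R h))" by (intro unit) (simp_all add: star_scaleR sa)
  then have "cpos ((c * c) *\<^sub>R (((1/c) *\<^sub>R h) * ((1/c) *\<^sub>R h)))" by (rule cpos_scaleR) (use c in simp)
  then show ?thesis using c by simp
qed

text \<open>The roots of \<open>a\<close> and \<open>1 - a\<close> commute and their squares add up
  to 1, so \<open>norm_le_one_if_squares_sum_one\<close> bounds the root of
  \<open>a\<close>.\<close>

lemma cpos_le_one:
  assumes "cpos a" "cpos (1 - a)"
  shows "norm a \<le> 1"
proof -
  obtain h where h: "cpos h" "h * h = a" "\<And>z. z * a = a * z \<Longrightarrow> z * h = h * z"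
    using cpos_sqrt[OF assms(1)] by blast
  obtain k where k: "cpos k" "k * k = 1 - a" "\<And>z. z * (1 - a) = (1 - a) * z \<Longrightarrow> z * k = k * z"
    using cpos_sqrt[OF assms(2)] by blast
  have hk: "h * k = k * h" by (rule k(3)) (simp add: algebra_simps flip: h(2))
  have "norm h \<le> 1"
    by (rule norm_le_one_if_squares_sum_one[of h k]) (use h(2) k(2) hk in \<open>simp_all add: cpos_star h(1) k(1)\<close>)
  then show ?thesis using h(2) cstar_identity[of h] by (simp add: cpos_star[OF h(1)] power_le_one)
qed

lemma norm_mono_cpos:
  assumes "cpos a" "cpos (b - a)"
  shows "norm a \<le> norm b"
proof -
  have "cpos b" using cpos_add[OF assms] by simp
  then have "cpos (of_real (norm b) - b)" by (intro cpos_norm_diff) (auto simp: cpos_star)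
  from cpos_add[OF this assms(2)] have p: "cpos (of_real (norm b) - a)" by simp
  \<comment> \<open>The argument divides by \<open>c\<close>, and \<open>b\<close> may be 0; so the
    bound is shown for every positive \<open>c\<close> above \<open>norm b\<close> and the infimum
    is taken afterwards.\<close>
  have le: "norm a \<le> c" if "c > 0" "c \<ge> norm b" for c
  proof -
    have "cpos (of_real (c - norm b) :: 'a)"
      using that unfolding cpos_def by (auto simp del: of_real_diff intro!: exI[of _ "c - norm b"])
    from cpos_add[OF this p] have "cpos (of_real c - a)" by simp
    then have "cpos ((1/c) *\<^sub>R (of_real c - a))" by (rule cpos_scaleR) (use that in simp)
    also have "(1/c) *\<^sub>R (of_real c - a) = 1 - (1/c) *\<^sub>R a"
      using that by (simp add: scaleR_diff_right of_real_def)
    finally have "norm ((1/c) *\<^sub>R a) \<le> 1"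
      by (intro cpos_le_one cpos_scaleR assms) (use that in auto)
    then show ?thesis using that by (simp add: field_simps)
  qed
  show ?thesis
  proof (rule field_le_epsilon)
    fix e :: real assume "e > 0"
    then show "norm a \<le> norm b + e" by (intro le) (auto intro: add_nonneg_pos)
  qed
qed

lemma cpos_antisym:
  assumes "cpos a" "cpos (- a)" shows "a = 0"
  using norm_mono_cpos[of a 0] assms by simp

text \<open>For self-adjoint elements the C*-identity doubles the exponent. Powers of two suffice to
  compare growth rates in \<open>cpos_uminus_swap\<close>.\<close>

lemma norm_power2_power_selfadjoint:
  assumes "star y = (y::'a::unital_cstar_algebra)"
  shows "norm (y ^ (2 ^ k)) = norm y ^ (2 ^ k)"
proof (induction k)
  case (Suc k)
  have "y ^ (2 ^ Suc k) = star (y ^ (2 ^ k)) * y ^ (2 ^ k)"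
    by (simp add: star_power assms mult_2 power_add)
  then have "norm (y ^ (2 ^ Suc k)) = (norm (y ^ (2 ^ k)))\<^sup>2" by (simp only: cstar_identity)
  also have "\<dots> = norm y ^ (2 ^ Suc k)" by (simp only: Suc power_mult[symmetric] power_Suc mult.commute)
  finally show ?case .
qed simp

text \<open>\<open>b\<^sup>* b\<close> and \<open>b b\<^sup>*\<close> have the same spectral radius estimates, because the powers of
  \<open>r + b b\<^sup>*\<close> are \<open>r\<^sup>n + b Q b\<^sup>*\<close> with \<open>Q\<close> a polynomial in \<open>b\<^sup>* b\<close> whose norm is of order \<open>n r\<^sup>n\<close>.\<close>

lemma cpos_uminus_swap:
  fixes b :: "'a::unital_cstar_algebra"
  assumes "cpos (- (star b * b))"
  shows "cpos (- (b * star b))"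
proof -
  obtain r where r: "r \<ge> 1" "norm (of_real r + star b * b) \<le> r"
    using cposE[OF assms, of 1] by auto
  define y where "y = of_real r + b * star b"
  have sy: "star y = y" by (simp add: y_def star_add star_mult star_star)
  have pow: "\<exists>Q. y ^ n = of_real (r ^ n) + b * Q * star b \<and> norm Q \<le> real n * r ^ n" for n
  proof (induction n)
    case 0 show ?case by (intro exI[of _ 0]) simp
  next
    case (Suc n)
    then obtain Q where Q: "y ^ n = of_real (r ^ n) + b * Q * star b" "norm Q \<le> real n * r ^ n" by blast
    \<comment> \<open>Multiplying \<open>r ^ n + b * Q * star b\<close> by
      \<open>r + b * star b\<close> and collecting what stands between \<open>b\<close> and
      \<open>star b\<close> gives \<open>Q'\<close>.\<close>
    define Q' where "Q' = of_real (r ^ n) + Q * (of_real r + star b * b)"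
    have cr: "of_real s * z = z * of_real s" for s and z :: 'a by (simp add: of_real_def)
    have "y ^ Suc n = y ^ n * y" by (rule power_Suc2)
    also have "\<dots> = of_real (r ^ n) * of_real r + (of_real (r ^ n) * b) * star b
        + (b * Q * (star b * of_real r) + b * Q * star b * b * star b)"
      unfolding Q(1) by (simp add: y_def algebra_simps del: of_real_power)
    also have "\<dots> = of_real (r ^ Suc n) + b * Q' * star b"
      unfolding cr[of "r ^ n" b] cr[of r "star b", symmetric] Q'_def
      by (simp add: algebra_simps del: of_real_power) (simp add: power_commutes)
    finally have e: "y ^ Suc n = of_real (r ^ Suc n) + b * Q' * star b" .
    have "norm Q' \<le> r ^ n + norm Q * r"
      unfolding Q'_def using r norm_triangle_ineq norm_mult_ineq
      by (smt (verit) mult_left_mono norm_ge_zero norm_of_real zero_le_power)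
    also have "\<dots> \<le> r ^ n * r + (real n * r ^ n) * r"
      using r Q(2) by (intro add_mono mult_right_mono) (auto simp: mult_le_cancel_left1)
    also have "\<dots> = real (Suc n) * r ^ Suc n" by (simp add: algebra_simps)
    finally show ?case using e by blast
  qed
  define K where "K = (norm b)\<^sup>2"
  have K: "K \<ge> 0" by (simp add: K_def)
  define q where "q = norm y / r"
  have qn: "q ^ (2 ^ k) \<le> 1 + 2 ^ k * K" for k
  proof -
    let ?n = "2 ^ k :: nat"
    obtain Q where Q: "y ^ ?n = of_real (r ^ ?n) + b * Q * star b" "norm Q \<le> real ?n * r ^ ?n"
      using pow by blast
    have "norm y ^ ?n = norm (y ^ ?n)" by (simp add: norm_power2_power_selfadjoint sy)
    also have "\<dots> \<le> norm (of_real (r ^ ?n) :: 'a) + norm (b * Q * star b)"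
      unfolding Q(1) by (rule norm_triangle_ineq)
    also have "norm (b * Q * star b) \<le> norm b * norm Q * norm b"
      by (metis norm_mult_ineq norm_star order_trans mult_right_mono norm_ge_zero)
    also have "norm (of_real (r ^ ?n) :: 'a) = r ^ ?n"
      unfolding norm_of_real using r by simp
    also have "norm b * norm Q * norm b \<le> norm b * (real ?n * r ^ ?n) * norm b"
      by (intro mult_right_mono mult_left_mono Q) auto
    finally have "norm y ^ ?n \<le> r ^ ?n * (1 + 2 ^ k * K)"
      by (simp add: K_def power2_eq_square algebra_simps)
    then show ?thesis using r by (simp add: q_def power_divide field_simps)
  qed
  have "q \<le> 1"
  proof (rule ccontr)
    assume "\<not> q \<le> 1"
    then have d: "q - 1 > 0" (is "?d > 0") by simp
    \<comment> \<open>If \<open>q > 1\<close>, Bernoulli bounds \<open>q ^ (2 ^ k)\<close> below by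
      \<open>2 ^ k * (q - 1)\<close>. Its square grows quadratically in \<open>2 ^ k\<close>, while
      \<open>qn\<close> at \<open>Suc k\<close> allows linear growth only. This \<open>k\<close> is
      large enough for the contradiction.\<close>
    obtain k where k: "(1 + 2 * K) / ?d\<^sup>2 < 2 ^ k" using real_arch_pow[of 2] by auto
    let ?m = "2 ^ k :: real"
    have "1 + ?m * ?d \<le> (1 + ?d) ^ (2 ^ k)"
      using Bernoulli_inequality[of ?d "2 ^ k"] d by (simp add: mult.commute)
    then have "(?m * ?d)\<^sup>2 \<le> (q ^ (2 ^ k))\<^sup>2" using d by (intro power_mono) auto
    also have "\<dots> = q ^ (2 ^ Suc k)" by (simp only: power_mult[symmetric] power_Suc mult.commute)
    also have "\<dots> \<le> 1 + 2 * ?m * K" using qn[of "Suc k"] by simp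
    also have "\<dots> \<le> ?m * (1 + 2 * K)" using K by (simp add: algebra_simps)
    finally have "?m * ?d\<^sup>2 \<le> 1 + 2 * K" by (simp add: power2_eq_square mult.left_commute)
    then show False using k d by (simp add: field_simps)
  qed
  then have "norm y \<le> r" using r by (simp add: q_def)
  then show ?thesis unfolding cpos_def
    by (intro conjI exI[of _ r]) (simp_all add: y_def star_mult star_star star_uminus)
qed

text \<open>With \<open>a = x\<^sup>* x\<close> and \<open>n = |a| - a\<close>, which is twice the negative part of \<open>a\<close>, the element
  \<open>b = x n\<close> satisfies \<open>- b\<^sup>* b = |a| n\<^sup>2 \<ge> 0\<close>, which forces \<open>b = 0\<close>.\<close>

theorem cpos_star_mult_self:
  fixes x :: "'a::unital_cstar_algebra"
  shows "cpos (star x * x)"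
proof -
  define a where "a = star x * x"
  have sa: "star a = a" by (simp add: a_def star_mult star_star)
  obtain m where m: "cpos m" "m * m = a * a" "\<And>z. z * (a * a) = (a * a) * z \<Longrightarrow> z * m = m * z"
    using cpos_sqrt[OF cpos_square[OF sa]] by blast
  have am: "a * m = m * a" by (rule m(3)) (simp add: mult.assoc)
  obtain r where r: "cpos r" "r * r = m" "\<And>z. z * m = m * z \<Longrightarrow> z * r = r * z"
    using cpos_sqrt[OF m(1)] by blast
  define n where "n = m - a"
  have sn: "star n = n" by (simp add: n_def star_diff sa cpos_star m)
  have nm: "n * m = m * n" by (simp add: n_def algebra_simps am)
  have rn: "n * r = r * n" by (rule r(3)) (rule nm)
  have nn: "n * n = 2 *\<^sub>R (m * n)" by (simp add: n_def algebra_simps am m(2) scaleR_2)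
  have na: "n * a = - (m * n)" by (simp add: n_def algebra_simps am m(2))
  define b where "b = x * n"
  have "star b * b = n * a * n" by (simp add: b_def a_def star_mult sn mult.assoc)
  also have "\<dots> = - (m * n * n)" by (simp add: na)
  also have "m * n * n = (r * n) * (r * n)" by (metis mult.assoc r(2) rn)
  finally have "star b * b = - ((r * n) * (r * n))" .
  then have bb: "- (star b * b) = (r * n) * (r * n)" "star b * b = - (m * n * n)"
    unfolding \<open>m * n * n = (r * n) * (r * n)\<close> by simp_all
  have "cpos (- (star b * b))"
    unfolding bb(1) by (rule cpos_square) (simp add: star_mult sn cpos_star r(1) rn)
  note neg = this cpos_uminus_swap[OF this]
  \<comment> \<open>Up to real factors these are the real and imaginary parts of \<open>b\<close>.
    The sum of their squares is twice \<open>star b * b + b * star b\<close>, which is therefore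
    positive; as \<open>- (b * star b)\<close> is positive too, so is
    \<open>star b * b\<close>.\<close>
  define P where "P = b + star b"
  define K where "K = \<i> *\<^sub>C (b - star b)"
  have "K * K = - ((b - star b) * (b - star b))"
    by (simp add: K_def mult_scaleC_left mult_scaleC_right scaleC_scaleC scaleC_minus_one)
  then have PK: "P * P + K * K = 2 *\<^sub>R (star b * b + b * star b)"
    by (simp add: P_def algebra_simps scaleR_2)
  have "star K = (- \<i>) *\<^sub>C (- (b - star b))"
    by (simp add: K_def star_scaleC star_diff star_star)
  also have "\<dots> = K" unfolding K_def by (rule scaleC_minus_minus)
  finally have "cpos (P * P + K * K)"
    by (intro cpos_add cpos_square) (simp_all add: P_def star_add star_star add.commute)
  from cpos_scaleR[OF this, of "1/2"] have "cpos (star b * b + b * star b)" unfolding PK by simp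
  from cpos_add[OF this neg(2)] have "cpos (star b * b)" by simp
  with neg(1) have "star b * b = 0" by (rule cpos_antisym[rotated])
  then have "m * n * n = 0" using bb(2) by simp
  then have "n * n * n = 0" unfolding nn by simp
  then have "star (n * n) * (n * n) = 0" by (simp add: star_mult sn mult.assoc)
  then have "n * n = 0" by (simp only: star_mult_self_eq_0_iff)
  then have "n = 0" using star_mult_self_eq_0_iff[of n] by (simp add: sn)
  then show ?thesis using m(1) by (simp add: n_def a_def)
qed

lemma cpos_conj:
  assumes "cpos a" shows "cpos (star x * a * x)"
proof -
  obtain h where h: "cpos h" "h * h = a" using cpos_sqrt[OF assms] by blast
  have "star x * a * x = star (h * x) * (h * x)"
    by (simp add: star_mult cpos_star h(1) h(2)[symmetric] mult.assoc)
  then show ?thesis by (simp only: cpos_star_mult_self)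
qed

lemma cpos_of_real: "r \<ge> 0 \<Longrightarrow> cpos (of_real r)"
  unfolding cpos_def by (auto intro!: exI[of _ r])

section \<open>Inverses from the Neumann series\<close>

lemma neumann_inverse:
  fixes t :: "'a::{real_normed_algebra_1,banach}"
  assumes "norm t < 1"
  obtains b where "b * (1 - t) = 1" "(1 - t) * b = 1" "norm b \<le> 1 / (1 - norm t)"
proof -
  have sn: "summable (\<lambda>n. norm t ^ n)" using assms by (simp add: summable_geometric)
  have s': "summable (\<lambda>n. norm (t ^ n))"
    by (rule summable_comparison_test'[OF sn]) (simp add: norm_power_ineq)
  then have s: "summable (\<lambda>n. t ^ n)" by (rule summable_norm_cancel)
  define b where "b = (\<Sum>n. t ^ n)"
  have "b = 1 + (\<Sum>n. t ^ Suc n)" using suminf_split_head[OF s] by (simp add: b_def)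
  moreover have "(\<Sum>n. t ^ Suc n) = t * b" unfolding b_def by (simp add: suminf_mult[OF s])
  moreover have "(\<Sum>n. t ^ Suc n) = b * t"
    unfolding b_def by (simp add: suminf_mult2[OF s] flip: power_Suc2 del: power_Suc)
  moreover have "norm b \<le> 1 / (1 - norm t)"
  proof -
    have "norm b \<le> (\<Sum>n. norm (t ^ n))" unfolding b_def by (rule summable_norm[OF s'])
    also have "\<dots> \<le> (\<Sum>n. norm t ^ n)" by (intro suminf_le s' sn norm_power_ineq)
    finally show ?thesis using assms by (simp add: suminf_geometric)
  qed
  ultimately show ?thesis by (intro that[of b]) (auto simp: algebra_simps)
qed

text \<open>With \<open>s = r + e\<close> the element is \<open>s\<close> times
  \<open>1 - t\<close>, where \<open>norm t \<le> r / s < 1\<close>. The Neumann estimate for the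
  inverse then collapses to \<open>1 / e\<close>, whatever the radius \<open>r\<close> was.\<close>

lemma cpos_shift_inverse:
  assumes "cpos a" "e > 0"
  obtains b where "b * (a + of_real e) = 1" "(a + of_real e) * b = 1" "norm b \<le> 1 / e" "star b = b"
proof -
  obtain r where r: "r \<ge> 0" "norm (of_real r - a) \<le> r" using cposE[OF assms(1)] by blast
  define s where "s = r + e"
  have s: "s > 0" using r assms by (simp add: s_def)
  define t where "t = (1 / s) *\<^sub>R (of_real r - a)"
  have nt: "norm t \<le> r / s" using r s by (simp add: t_def divide_right_mono)
  have "r / s < 1" using s assms by (simp add: s_def)
  with nt have "norm t < 1" by simp
  then obtain c where c: "c * (1 - t) = 1" "(1 - t) * c = 1" "norm c \<le> 1 / (1 - norm t)"
    using neumann_inverse by blast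
  have ae: "a + of_real e = s *\<^sub>R (1 - t)"
    using s by (simp add: t_def scaleR_diff_right) (simp add: s_def of_real_def algebra_simps)
  define b where "b = (1 / s) *\<^sub>R c"
  have b: "b * (a + of_real e) = 1" "(a + of_real e) * b = 1" using c s by (simp_all add: b_def ae)
  have "norm c \<le> 1 / (1 - r / s)"
    using c(3) nt \<open>r / s < 1\<close> by (elim order_trans) (simp add: frac_le)
  also have "\<dots> = s / e" using s assms(2) by (simp add: s_def field_simps)
  finally have nb: "norm b \<le> 1 / e" using s by (simp add: b_def field_simps)
  have "star b = star b * ((a + of_real e) * b)" by (simp add: b)
  also have "\<dots> = star ((a + of_real e) * b) * b"
    by (simp add: star_mult star_add cpos_star assms mult.assoc)
  finally have "star b = b" by (simp add: b)
  with b nb that show ?thesis by blast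
qed

text \<open>Let \<open>b\<close> be the inverse of \<open>a + e\<close>. The lower bound at
  \<open>b\<close> gives \<open>c\<^sup>2 * (norm b)\<^sup>2 \<le> norm (b * a * b) \<le> norm
  b\<close>, so \<open>norm b\<close> is at most \<open>1 / c\<^sup>2\<close>. The choice
  \<open>e = c\<^sup>2 / 2\<close> makes \<open>e * norm b\<close> smaller than 1, and
  \<open>a = (a + e) * (1 - e * b)\<close> is a product of invertible elements.\<close>

lemma star_mult_self_invertible:
  fixes x :: "'a::unital_cstar_algebra"
  assumes "c > 0" and lower: "\<And>y. c * norm y \<le> norm (x * y)"
  obtains b where "b * (star x * x) = 1" "(star x * x) * b = 1"
proof -
  define a where "a = star x * x"
  have pa: "cpos a" by (simp add: a_def cpos_star_mult_self)
  define e where "e = c\<^sup>2 / 2"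
  have e: "e > 0" using assms by (simp add: e_def)
  obtain b where b: "b * (a + of_real e) = 1" "(a + of_real e) * b = 1" "star b = b"
    using cpos_shift_inverse[OF pa e] by metis
  have "(c * norm b)\<^sup>2 \<le> (norm (x * b))\<^sup>2"
    using lower[of b] assms(1) by (intro power_mono) auto
  also have "\<dots> = norm (star b * a * b)" by (simp add: a_def star_mult mult.assoc flip: cstar_identity)
  also have "\<dots> \<le> norm (star b * (a + of_real e) * b)"
  proof (rule norm_mono_cpos)
    have "star b * (a + of_real e) * b - star b * a * b = star b * of_real e * b"
      by (simp add: algebra_simps)
    then show "cpos (star b * (a + of_real e) * b - star b * a * b)"
      using cpos_conj[OF cpos_of_real[of e], of b] e by simp
  qed (rule cpos_conj[OF pa])
  also have "\<dots> = norm b" by (simp add: b mult.assoc)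
  finally have "c\<^sup>2 * norm b * norm b \<le> 1 * norm b" by (simp add: power2_eq_square algebra_simps)
  then have "c\<^sup>2 * norm b \<le> 1" by (cases "norm b = 0") (auto dest: mult_right_le_imp_le)
  then have "norm (e *\<^sub>R b) < 1" using e by (simp add: e_def)
  then obtain d where d: "(1 - e *\<^sub>R b) * d = 1" using neumann_inverse by blast
  have "a = (a + of_real e) * (1 - e *\<^sub>R b)" using b(2) by (simp add: algebra_simps of_real_def)
  then have ad: "a * (d * b) = 1" by (metis b(2) d mult.assoc mult.left_neutral)
  then have "star (a * (d * b)) = 1" by simp
  then have da: "star (d * b) * a = 1" by (simp add: star_mult cpos_star pa mult.assoc)
  then have "d * b = star (d * b)" using ad by (metis mult.assoc mult.left_neutral mult.right_neutral)
  then show ?thesis using that[of "d * b"] ad da by (simp add: a_def)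
qed

section \<open>The standard module as a Banach space\<close>

text \<open>The existential radius in \<open>cpos\<close> can be replaced by \<open>norm a\<close>.
  This radius depends continuously on \<open>a\<close>, which makes the positive cone closed in
  \<open>cpos_LIMSEQ\<close>.\<close>

lemma norm_of_real_minus_cpos:
  assumes "cpos a" "norm a \<le> r" shows "norm (of_real r - a) \<le> r"
proof -
  have "norm (of_real r - a) \<le> norm (of_real r :: 'a)"
    by (rule norm_mono_cpos) (use assms in \<open>simp_all add: cpos_norm_diff cpos_star\<close>)
  moreover have "0 \<le> r" using assms(2) norm_ge_zero order_trans by blast
  ultimately show ?thesis by (simp add: norm_of_real)
qed

lemma cpos_LIMSEQ:
  assumes "X \<longlonglongrightarrow> a" "\<And>n. cpos (X n)" shows "cpos a"
  unfolding cpos_def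
proof (intro conjI exI)
  have "(\<lambda>n. star (X n)) \<longlonglongrightarrow> star a" by (intro tendsto_intros assms)
  then show "star a = a" using assms(1) by (simp add: cpos_star assms(2) LIMSEQ_unique)
  have "(\<lambda>n. norm (of_real (norm (X n)) - X n)) \<longlonglongrightarrow> norm (of_real (norm a) - a)"
    by (intro tendsto_intros assms)
  then show "norm (of_real (norm a) - a) \<le> norm a"
    by (rule LIMSEQ_le[OF _ tendsto_norm[OF assms(1)]]) (auto intro!: norm_of_real_minus_cpos assms)
qed

text \<open>Expand the positive sum of \<open>star z * z\<close> over
  \<open>z = x i * B - s *\<^sub>R y i\<close> and replace \<open>A\<close> by the larger scalar
  \<open>s\<close>; what remains is \<open>s * star B * B \<le> s\<^sup>2 * C\<close> in the order
  of the algebra. Taking norms and letting \<open>s\<close> decrease to \<open>norm A\<close> gives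
  the claim. The strict inequality \<open>s > norm A\<close> permits division by
  \<open>s\<close>.\<close>

lemma cauchy_schwarz_sum:
  fixes x y :: "nat \<Rightarrow> 'a::unital_cstar_algebra"
  shows "(norm (\<Sum>i\<in>I. star (x i) * y i))\<^sup>2
    \<le> norm (\<Sum>i\<in>I. star (x i) * x i) * norm (\<Sum>i\<in>I. star (y i) * y i)"
proof -
  define A where "A = (\<Sum>i\<in>I. star (x i) * x i)"
  define B where "B = (\<Sum>i\<in>I. star (x i) * y i)"
  define C where "C = (\<Sum>i\<in>I. star (y i) * y i)"
  have sB: "star B = (\<Sum>i\<in>I. star (y i) * x i)" by (simp add: B_def star_sum star_mult star_star)
  have sA: "star A = A" by (simp add: A_def star_sum star_mult star_star)
  have le: "(norm B)\<^sup>2 \<le> s * norm C" if s: "s > norm A" for s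
  proof -
    have s0: "s > 0" using s by (meson norm_ge_zero le_less_trans)
    have "cpos (\<Sum>i\<in>I. star (x i * B - s *\<^sub>R y i) * (x i * B - s *\<^sub>R y i))"
      by (intro cpos_sum cpos_star_mult_self)
    also have "(\<Sum>i\<in>I. star (x i * B - s *\<^sub>R y i) * (x i * B - s *\<^sub>R y i))
        = (\<Sum>i\<in>I. star B * (star (x i) * x i) * B - s *\<^sub>R (star B * (star (x i) * y i))
            - s *\<^sub>R ((star (y i) * x i) * B) + (s * s) *\<^sub>R (star (y i) * y i))"
      by (intro sum.cong) (simp_all add: star_diff star_mult star_scaleR algebra_simps)
    also have "\<dots> = star B * A * B - s *\<^sub>R (star B * B) - s *\<^sub>R (star B * B) + (s * s) *\<^sub>R C"
      unfolding sB by (simp add: sum.distrib sum_subtractf scaleR_sum_right[symmetric]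
          sum_distrib_left[symmetric] sum_distrib_right[symmetric])
        (simp add: A_def B_def C_def sum_distrib_left[symmetric])
    finally have 1: "cpos \<dots>" .
    have "cpos (star B * (of_real s - A) * B)"
      using s sA by (intro cpos_conj cpos_norm_diff) auto
    also have "star B * (of_real s - A) * B = s *\<^sub>R (star B * B) - star B * A * B"
      by (simp add: algebra_simps of_real_def)
    finally have "cpos (s *\<^sub>R (star B * B) - star B * A * B)" .
    from cpos_add[OF 1 this] have "cpos ((s * s) *\<^sub>R C - s *\<^sub>R (star B * B))" by simp
    then have "norm (s *\<^sub>R (star B * B)) \<le> norm ((s * s) *\<^sub>R C)"
      using s0 by (intro norm_mono_cpos cpos_scaleR cpos_star_mult_self) auto
    then show ?thesis using s0 by (simp add: cstar_identity)
  qed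
  have "(norm B)\<^sup>2 \<le> norm A * norm C"
  proof (rule LIMSEQ_le_const)
    have "(\<lambda>n. (norm A + inverse (real (Suc n))) * norm C) \<longlonglongrightarrow> (norm A + 0) * norm C"
      by (intro tendsto_intros LIMSEQ_inverse_real_of_nat)
    then show "(\<lambda>n. (norm A + inverse (real (Suc n))) * norm C) \<longlonglongrightarrow> norm A * norm C" by simp
  qed (auto intro!: le)
  then show ?thesis by (simp add: A_def B_def C_def)
qed

text \<open>The module norm of a finite section. The Cauchy criterion is phrased with such sections,
  so the inequalities of Cauchy-Schwarz and Minkowski can be used before any series is known to
  converge.\<close>

definition seg_norm :: "'i set \<Rightarrow> ('i \<Rightarrow> 'a::unital_cstar_algebra) \<Rightarrow> real" where
  "seg_norm I x = sqrt (norm (\<Sum>i\<in>I. star (x i) * x i))"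

lemma seg_norm_cauchy_schwarz:
  fixes x y :: "nat \<Rightarrow> 'a::unital_cstar_algebra"
  shows "norm (\<Sum>i\<in>I. star (x i) * y i) \<le> seg_norm I x * seg_norm I y"
  using real_sqrt_le_mono[OF cauchy_schwarz_sum[where I=I and x=x and y=y]]
  by (simp add: seg_norm_def real_sqrt_mult)

lemma seg_norm_triangle:
  fixes x y :: "nat \<Rightarrow> 'a::unital_cstar_algebra"
  shows "seg_norm I (\<lambda>i. x i + y i) \<le> seg_norm I x + seg_norm I y"
proof -
  have "(\<Sum>i\<in>I. star (x i + y i) * (x i + y i)) = (\<Sum>i\<in>I. star (x i) * x i) + (\<Sum>i\<in>I. star (x i) * y i)
     + ((\<Sum>i\<in>I. star (y i) * x i) + (\<Sum>i\<in>I. star (y i) * y i))"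
    by (simp add: star_add algebra_simps sum.distrib)
  then have "norm (\<Sum>i\<in>I. star (x i + y i) * (x i + y i)) = norm \<dots>" by (rule arg_cong)
  also have "\<dots> \<le> seg_norm I x * seg_norm I x + seg_norm I x * seg_norm I y
     + (seg_norm I y * seg_norm I x + seg_norm I y * seg_norm I y)"
    by (intro norm_triangle_mono seg_norm_cauchy_schwarz)
  also have "\<dots> = (seg_norm I x + seg_norm I y)\<^sup>2" by (simp add: power2_eq_square algebra_simps)
  finally show ?thesis unfolding seg_norm_def[of I "\<lambda>i. x i + y i"]
    by (rule real_le_lsqrt[rotated]) (simp add: seg_norm_def)
qed

lemma seg_norm_mono:
  fixes x :: "nat \<Rightarrow> 'a::unital_cstar_algebra"
  assumes "finite J" "I \<subseteq> J" shows "seg_norm I x \<le> seg_norm J x"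
proof -
  have "(\<Sum>i\<in>J. star (x i) * x i) - (\<Sum>i\<in>I. star (x i) * x i) = (\<Sum>i\<in>J-I. star (x i) * x i)"
    using assms by (simp add: sum_diff)
  then have "norm (\<Sum>i\<in>I. star (x i) * x i) \<le> norm (\<Sum>i\<in>J. star (x i) * x i)"
    by (intro norm_mono_cpos) (auto intro!: cpos_sum cpos_star_mult_self)
  then show ?thesis by (simp add: seg_norm_def)
qed

lemma summable_iff_seg_norm:
  fixes x :: "nat \<Rightarrow> 'a::unital_cstar_algebra"
  shows "summable (\<lambda>n. star (x n) * x n) \<longleftrightarrow> (\<forall>e>0. \<exists>N. \<forall>m\<ge>N. \<forall>n. seg_norm {m..<n} x < e)"
proof
  assume L: "summable (\<lambda>n. star (x n) * x n)"
  show "\<forall>e>0. \<exists>N. \<forall>m\<ge>N. \<forall>n. seg_norm {m..<n} x < e"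
  proof (intro allI impI)
    fix e :: real assume "e > 0"
    then have "e\<^sup>2 > 0" by simp
    with L obtain N where "\<forall>m\<ge>N. \<forall>n. norm (\<Sum>i\<in>{m..<n}. star (x i) * x i) < e\<^sup>2"
      unfolding summable_Cauchy by blast
    then have "\<forall>m\<ge>N. \<forall>n. seg_norm {m..<n} x < e"
      using \<open>e > 0\<close> by (auto simp: seg_norm_def intro!: real_less_lsqrt)
    then show "\<exists>N. \<forall>m\<ge>N. \<forall>n. seg_norm {m..<n} x < e" by blast
  qed
next
  assume R: "\<forall>e>0. \<exists>N. \<forall>m\<ge>N. \<forall>n. seg_norm {m..<n} x < e"
  show "summable (\<lambda>n. star (x n) * x n)" unfolding summable_Cauchy
  proof (intro allI impI)
    fix e :: real assume "e > 0"
    then have "sqrt e > 0" by simp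
    with R obtain N where "\<forall>m\<ge>N. \<forall>n. seg_norm {m..<n} x < sqrt e" by blast
    then show "\<exists>N. \<forall>m\<ge>N. \<forall>n. norm (\<Sum>i\<in>{m..<n}. star (x i) * x i) < e"
      by (auto simp: seg_norm_def)
  qed
qed

lemma summable_star_mult:
  fixes x y :: "nat \<Rightarrow> 'a::unital_cstar_algebra"
  assumes "summable (\<lambda>n. star (x n) * x n)" "summable (\<lambda>n. star (y n) * y n)"
  shows "summable (\<lambda>n. star (x n) * y n)"
  unfolding summable_Cauchy
proof (intro allI impI)
  fix e :: real assume e: "e > 0"
  obtain N where N: "\<And>m n. m \<ge> N \<Longrightarrow> seg_norm {m..<n} x < e"
    using assms(1) e unfolding summable_iff_seg_norm by blast
  obtain M where M: "\<And>m n. m \<ge> M \<Longrightarrow> seg_norm {m..<n} y < 1"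
    using assms(2) unfolding summable_iff_seg_norm by (metis zero_less_one)
  have "norm (\<Sum>i\<in>{m..<n}. star (x i) * y i) < e" if "m \<ge> max N M" for m n
  proof -
    have "seg_norm {m..<n} x * seg_norm {m..<n} y \<le> seg_norm {m..<n} x * 1"
      using M[of m n] that by (intro mult_left_mono) (auto simp: seg_norm_def)
    then show ?thesis using seg_norm_cauchy_schwarz[where x=x and y=y and I="{m..<n}"] N[of m n] that by simp
  qed
  then show "\<exists>N. \<forall>m\<ge>N. \<forall>n. norm (\<Sum>i\<in>{m..<n}. star (x i) * y i) < e" by blast
qed

lemma summable_star_mult_add:
  fixes x y :: "nat \<Rightarrow> 'a::unital_cstar_algebra"
  assumes "summable (\<lambda>n. star (x n) * x n)" "summable (\<lambda>n. star (y n) * y n)"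
  shows "summable (\<lambda>n. star (x n + y n) * (x n + y n))"
proof -
  have "(\<lambda>n. star (x n + y n) * (x n + y n)) = (\<lambda>n. (star (x n) * x n + star (x n) * y n) + (star (y n) * x n + star (y n) * y n))"
    by (simp add: star_add algebra_simps)
  then show ?thesis by (simp add: summable_add summable_star_mult assms)
qed

lemma summable_star_mult_act:
  fixes x :: "nat \<Rightarrow> 'a::unital_cstar_algebra"
  assumes "summable (\<lambda>n. star (x n) * x n)"
  shows "summable (\<lambda>n. star (x n * a) * (x n * a))"
proof -
  have "(\<lambda>n. star (x n * a) * (x n * a)) = (\<lambda>n. star a * ((star (x n) * x n) * a))"
    by (simp add: star_mult mult.assoc)
  then show ?thesis by (simp add: summable_mult summable_mult2 assms)
qed

text \<open>The carrier of the standard module as a type, so that it can be an instance of the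
  Banach space classes. \<open>coord\<close> translates back to the record
  \<open>std_module\<close>.\<close>

typedef (overloaded) 'a l2 = "{x :: nat \<Rightarrow> 'a::unital_cstar_algebra. summable (\<lambda>n. star (x n) * x n)}"
  morphisms coord Abs_l2
  by (rule exI[of _ "\<lambda>_. 0"]) simp

setup_lifting type_definition_l2

lemma l2_summable: "summable (\<lambda>n. star (coord x n) * coord y n)"
  using coord[of x] coord[of y] by (auto intro: summable_star_mult)

lift_definition act :: "'a::unital_cstar_algebra l2 \<Rightarrow> 'a \<Rightarrow> 'a l2" is "\<lambda>x a n. x n * a"
  by (rule summable_star_mult_act)

definition cinner :: "'a::unital_cstar_algebra l2 \<Rightarrow> 'a l2 \<Rightarrow> 'a" where
  "cinner x y = (\<Sum>n. star (coord x n) * coord y n)"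

lemma cinner_sums: "(\<lambda>N. \<Sum>n<N. star (coord x n) * coord y n) \<longlonglongrightarrow> cinner x y"
  unfolding cinner_def by (rule summable_LIMSEQ[OF l2_summable])

lemma star_cinner: "star (cinner x y) = cinner y x"
proof -
  have "(\<lambda>N. star (\<Sum>n<N. star (coord x n) * coord y n)) \<longlonglongrightarrow> star (cinner x y)"
    by (intro tendsto_intros cinner_sums)
  then show ?thesis
    using cinner_sums[of y x] by (simp add: star_sum star_mult star_star LIMSEQ_unique)
qed

lemma cpos_cinner: "cpos (cinner x x)"
  by (rule cpos_LIMSEQ[OF cinner_sums]) (intro cpos_sum cpos_star_mult_self)

instantiation l2 :: (unital_cstar_algebra) real_normed_vector
begin

lift_definition zero_l2 :: "'a l2" is "\<lambda>_. 0" by simp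
lift_definition plus_l2 :: "'a l2 \<Rightarrow> 'a l2 \<Rightarrow> 'a l2" is "\<lambda>x y n. x n + y n"
  by (rule summable_star_mult_add)
lift_definition uminus_l2 :: "'a l2 \<Rightarrow> 'a l2" is "\<lambda>x n. - x n"
  by (simp add: star_uminus)
lift_definition minus_l2 :: "'a l2 \<Rightarrow> 'a l2 \<Rightarrow> 'a l2" is "\<lambda>x y n. x n - y n"
  using summable_star_mult_add[of _ "\<lambda>n. - _ n"] by (simp add: star_uminus)
lift_definition scaleR_l2 :: "real \<Rightarrow> 'a l2 \<Rightarrow> 'a l2" is "\<lambda>r x n. r *\<^sub>R x n"
  by (simp add: star_scaleR summable_scaleR_right)

definition norm_l2 :: "'a l2 \<Rightarrow> real" where "norm_l2 x = sqrt (norm (cinner x x))"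
definition dist_l2 :: "'a l2 \<Rightarrow> 'a l2 \<Rightarrow> real" where "dist_l2 x y = norm (x - y)"
definition sgn_l2 :: "'a l2 \<Rightarrow> 'a l2" where "sgn_l2 x = inverse (norm x) *\<^sub>R x"
definition uniformity_l2 :: "('a l2 \<times> 'a l2) filter" where
  "uniformity_l2 = (INF e\<in>{0 <..}. principal {(x, y). dist x y < e})"
definition open_l2 :: "'a l2 set \<Rightarrow> bool" where
  "open_l2 S = (\<forall>x\<in>S. \<forall>\<^sub>F (x', y) in uniformity. x' = x \<longrightarrow> y \<in> S)"

lemma seg_norm_LIMSEQ: "(\<lambda>N. seg_norm {..<N} (coord x)) \<longlonglongrightarrow> norm x"
  unfolding seg_norm_def norm_l2_def by (intro tendsto_intros cinner_sums)

lemma seg_norm_le_norm: "finite I \<Longrightarrow> seg_norm I (coord x) \<le> norm x"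
proof (rule LIMSEQ_le_const[OF seg_norm_LIMSEQ])
  assume "finite I"
  then obtain N where "I \<subseteq> {..<N}" by (meson finite_nat_iff_bounded)
  then show "\<exists>N. \<forall>n\<ge>N. seg_norm I (coord x) \<le> seg_norm {..<n} (coord x)"
    by (intro exI[of _ N] allI impI seg_norm_mono) auto
qed

lemma norm_coord_le: "norm (coord x n) \<le> norm x"
  using seg_norm_le_norm[of "{n}" x] by (simp add: seg_norm_def cstar_identity)

instance
proof
  fix x y z :: "'a l2" and r s :: real
  show "(x + y) + z = x + (y + z)" "x + y = y + x" "0 + x = x" "- x + x = 0" "x - y = x + - y"
    "r *\<^sub>R (x + y) = r *\<^sub>R x + r *\<^sub>R y" "(r + s) *\<^sub>R x = r *\<^sub>R x + s *\<^sub>R x"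
    "r *\<^sub>R s *\<^sub>R x = (r * s) *\<^sub>R x" "1 *\<^sub>R x = x"
    by (transfer; simp add: fun_eq_iff algebra_simps)+
  show "dist x y = norm (x - y)" "sgn x = inverse (norm x) *\<^sub>R x"
    "uniformity = (INF e\<in>{0 <..}. principal {(x :: 'a l2, y). dist x y < e})"
    by (rule dist_l2_def sgn_l2_def uniformity_l2_def)+
  show "open U = (\<forall>x\<in>U. \<forall>\<^sub>F (x', y) in uniformity. x' = x \<longrightarrow> y \<in> U)" for U :: "'a l2 set"
    by (rule open_l2_def)
  show "norm x = 0 \<longleftrightarrow> x = 0"
  proof
    assume "norm x = 0"
    then have "coord x n = 0" for n using norm_coord_le[of x n] by simp
    then show "x = 0" by (simp add: coord_inject[symmetric] fun_eq_iff zero_l2.rep_eq)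
  qed (simp add: norm_l2_def cinner_def zero_l2.rep_eq)
  show "norm (x + y) \<le> norm x + norm y"
  proof (rule LIMSEQ_le[OF seg_norm_LIMSEQ tendsto_add[OF seg_norm_LIMSEQ seg_norm_LIMSEQ]])
    show "\<exists>N. \<forall>n\<ge>N. seg_norm {..<n} (coord (x + y)) \<le> seg_norm {..<n} (coord x) + seg_norm {..<n} (coord y)"
      using seg_norm_triangle[of _ "coord x" "coord y"] by (simp add: plus_l2.rep_eq)
  qed
  show "norm (r *\<^sub>R x) = \<bar>r\<bar> * norm x"
  proof -
    have "cinner (r *\<^sub>R x) (r *\<^sub>R x) = (\<Sum>n. (r * r) *\<^sub>R (star (coord x n) * coord x n))"
      by (simp add: cinner_def scaleR_l2.rep_eq star_scaleR)
    also have "\<dots> = (r * r) *\<^sub>R cinner x x"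
      by (simp add: cinner_def suminf_scaleR_right[OF l2_summable])
    finally show ?thesis by (simp add: norm_l2_def real_sqrt_mult)
  qed
qed

end

lemma norm_l2_square: "(norm x)\<^sup>2 = norm (cinner x (x::'a::unital_cstar_algebra l2))"
  by (simp add: norm_l2_def)

lemma l2_eqI: "(\<And>n. coord x n = coord y n) \<Longrightarrow> x = y"
  by (simp add: coord_inject[symmetric] fun_eq_iff)

lemma norm_cinner_le: "norm (cinner x y) \<le> norm x * norm y"
  by (rule LIMSEQ_le[OF tendsto_norm[OF cinner_sums] tendsto_mult[OF seg_norm_LIMSEQ seg_norm_LIMSEQ]])
    (use seg_norm_cauchy_schwarz in blast)

lemma cinner_add_right: "cinner x (y + z) = cinner x y + cinner x z"
  by (simp add: cinner_def plus_l2.rep_eq distrib_left suminf_add[OF l2_summable l2_summable])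

lemma cinner_add_left: "cinner (x + y) z = cinner x z + cinner y z"
  by (simp add: cinner_def plus_l2.rep_eq distrib_right star_add suminf_add[OF l2_summable l2_summable])

lemma cinner_act_right: "cinner x (act y a) = cinner x y * a"
  by (simp add: cinner_def act.rep_eq suminf_mult2[OF l2_summable] mult.assoc)

lemma cinner_act_left: "cinner (act x a) y = star a * cinner x y"
  by (metis star_cinner cinner_act_right star_mult)

lemma act_scaleR: "act x (of_real r) = r *\<^sub>R x"
  by (rule l2_eqI) (simp add: act.rep_eq scaleR_l2.rep_eq of_real_def)

interpretation cinner: bounded_bilinear "cinner :: 'a::unital_cstar_algebra l2 \<Rightarrow> _"
proof
  fix x y :: "'a l2" and r
  show "cinner x (r *\<^sub>R y) = r *\<^sub>R cinner x y"
    using cinner_act_right[of x y "of_real r"] unfolding act_scaleR by (simp add: of_real_def)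
  show "cinner (r *\<^sub>R x) y = r *\<^sub>R cinner x y"
    using cinner_act_left[of x "of_real r" y] unfolding act_scaleR by (simp add: of_real_def star_scaleR)
qed (auto simp: cinner_add_left cinner_add_right intro!: exI[of _ 1] norm_cinner_le)

declare cinner.zero_left [simp] cinner.zero_right [simp]

lemma norm_act_le: "norm (act x a) \<le> norm x * norm a"
proof -
  have "(norm (act x a))\<^sup>2 = norm (star a * (cinner x x * a))"
    by (simp add: norm_l2_square cinner_act_left cinner_act_right mult.assoc)
  also have "\<dots> \<le> norm a * (norm (cinner x x) * norm a)"
    by (rule order_trans[OF norm_mult_ineq]) (simp add: mult_left_mono norm_mult_ineq)
  also have "\<dots> = (norm x * norm a)\<^sup>2" by (simp add: norm_l2_square[symmetric] power2_eq_square)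
  finally show ?thesis by (rule power2_le_imp_le) simp
qed

interpretation act: bounded_bilinear "act :: 'a::unital_cstar_algebra l2 \<Rightarrow> _"
proof
  show "\<exists>K. \<forall>(x::'a l2) a. norm (act x a) \<le> norm x * norm a * K"
    by (intro exI[of _ 1]) (simp add: norm_act_le)
qed (auto simp: act.rep_eq plus_l2.rep_eq scaleR_l2.rep_eq algebra_simps intro!: l2_eqI)

declare act.zero_left [simp] act.zero_right [simp]

lemma act_act: "act (act x a) b = act x (a * b)"
  by (rule l2_eqI) (simp add: act.rep_eq mult.assoc)

lemma act_one [simp]: "act x 1 = x"
  by (rule l2_eqI) (simp add: act.rep_eq)

lemma cinner_eq_0_iff [simp]: "cinner x x = 0 \<longleftrightarrow> x = 0"
  using norm_l2_square[of x] by auto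

lemma l2_ext: "(\<And>y. cinner y x = cinner y z) \<Longrightarrow> x = z"
  using cinner_eq_0_iff[of "x - z"] by (simp add: cinner.diff_right)

text \<open>The coordinatewise limit is the limit in norm: the Cauchy estimate on a finite section
  survives the limit in each coordinate, and it is uniform over all sections.\<close>

instance l2 :: (unital_cstar_algebra) banach
proof
  fix X :: "nat \<Rightarrow> 'a l2" assume C: "Cauchy X"
  have "Cauchy (\<lambda>k. coord (X k) n)" for n
  proof (rule CauchyI)
    fix e :: real assume "e > 0"
    with C obtain M where "\<forall>m\<ge>M. \<forall>k\<ge>M. norm (X m - X k) < e" unfolding Cauchy_iff by blast
    then show "\<exists>M. \<forall>m\<ge>M. \<forall>k\<ge>M. norm (coord (X m) n - coord (X k) n) < e"
      by (metis minus_l2.rep_eq norm_coord_le le_less_trans)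
  qed
  then have "\<exists>l. (\<lambda>k. coord (X k) n) \<longlonglongrightarrow> l" for n
    using Cauchy_convergent convergent_def by blast
  then obtain x where x: "\<And>n. (\<lambda>k. coord (X k) n) \<longlonglongrightarrow> x n" by metis
  have ev: "\<exists>M. \<forall>m\<ge>M. \<forall>I. finite I \<longrightarrow> seg_norm I (\<lambda>n. coord (X m) n - x n) \<le> e" if "e > 0" for e
  proof -
    obtain M where M: "\<And>m k. m \<ge> M \<Longrightarrow> k \<ge> M \<Longrightarrow> norm (X m - X k) < e"
      using C \<open>e > 0\<close> unfolding Cauchy_iff by blast
    have "seg_norm I (\<lambda>n. coord (X m) n - x n) \<le> e" if "m \<ge> M" "finite I" for m I
    proof (rule LIMSEQ_le_const2)
      show "(\<lambda>k. seg_norm I (\<lambda>n. coord (X m) n - coord (X k) n)) \<longlonglongrightarrow> seg_norm I (\<lambda>n. coord (X m) n - x n)"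
        unfolding seg_norm_def by (intro tendsto_intros x)
      have "seg_norm I (\<lambda>n. coord (X m) n - coord (X k) n) \<le> e" if "k \<ge> M" for k
        using seg_norm_le_norm[of I "X m - X k"] M[of m k] that \<open>m \<ge> M\<close> \<open>finite I\<close>
        by (simp add: minus_l2.rep_eq)
      then show "\<exists>N. \<forall>n\<ge>N. seg_norm I (\<lambda>na. coord (X m) na - coord (X n) na) \<le> e" by blast
    qed
    then show ?thesis by blast
  qed
  have "summable (\<lambda>n. star (x n) * x n)" unfolding summable_iff_seg_norm
  proof (intro allI impI)
    fix e :: real assume "e > 0"
    then have e2: "e / 2 > 0" by simp
    from ev[OF e2] obtain k where k: "\<And>I. finite I \<Longrightarrow> seg_norm I (\<lambda>n. coord (X k) n - x n) \<le> e / 2"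
      by blast
    have "summable (\<lambda>n. star (coord (X k) n) * coord (X k) n)" by (rule l2_summable)
    then obtain N where N: "\<And>m n. m \<ge> N \<Longrightarrow> seg_norm {m..<n} (coord (X k)) < e / 2"
      unfolding summable_iff_seg_norm using e2 by blast
    have "seg_norm {m..<n} x < e" if "m \<ge> N" for m n
    proof -
      have "seg_norm {m..<n} (\<lambda>n. (x n - coord (X k) n) + coord (X k) n)
          \<le> seg_norm {m..<n} (\<lambda>n. x n - coord (X k) n) + seg_norm {m..<n} (coord (X k))"
        by (rule seg_norm_triangle)
      moreover have "seg_norm {m..<n} (\<lambda>n. x n - coord (X k) n) = seg_norm {m..<n} (\<lambda>n. coord (X k) n - x n)"
        unfolding seg_norm_def by (simp add: star_diff algebra_simps)
      ultimately show ?thesis using k[of "{m..<n}"] N[OF that, of n] by simp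
    qed
    then show "\<exists>N. \<forall>m\<ge>N. \<forall>n. seg_norm {m..<n} x < e" by blast
  qed
  then have cx: "coord (Abs_l2 x) = x" by (simp add: Abs_l2_inverse)
  have "X \<longlonglongrightarrow> Abs_l2 x"
  proof (rule LIMSEQ_I)
    fix e :: real assume "e > 0"
    then have e2: "e / 2 > 0" by simp
    from ev[OF e2] obtain M where M: "\<And>m I. m \<ge> M \<Longrightarrow> finite I \<Longrightarrow> seg_norm I (\<lambda>n. coord (X m) n - x n) \<le> e / 2"
      by blast
    have "norm (X m - Abs_l2 x) \<le> e / 2" if "m \<ge> M" for m
      by (rule LIMSEQ_le_const2[OF seg_norm_LIMSEQ])
        (use M[OF that] in \<open>auto simp: minus_l2.rep_eq cx\<close>)
    then show "\<exists>M. \<forall>m\<ge>M. norm (X m - Abs_l2 x) < e" using \<open>e > 0\<close>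
      by (intro exI[of _ M] allI impI) (smt (verit) field_sum_of_halves)
  qed
  then show "convergent X" by (auto simp: convergent_def)
qed

section \<open>The standard orthonormal sequence\<close>

lift_definition unit_vec :: "nat \<Rightarrow> 'a::unital_cstar_algebra l2" is "\<lambda>n m. if m = n then 1 else 0"
proof -
  fix n
  show "summable (\<lambda>m. star (if m = n then 1 else 0) * (if m = n then 1 else 0 :: 'a))"
    by (rule summable_finite[of "{n}"]) auto
qed

lemma cinner_unit_vec: "cinner (unit_vec n) x = coord x n"
proof -
  have "cinner (unit_vec n) x = (\<Sum>m\<in>{n}. star (coord (unit_vec n) m) * coord x m)"
    unfolding cinner_def by (rule suminf_finite) (auto simp: unit_vec.rep_eq)
  then show ?thesis by (simp add: unit_vec.rep_eq)
qed

lemma norm_unit_vec [simp]: "norm (unit_vec n) = 1"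
  by (simp add: norm_l2_def cinner_unit_vec unit_vec.rep_eq)

lemma coord_sum: "coord (sum f I) n = (\<Sum>i\<in>I. coord (f i) n)"
  by (induction I rule: infinite_finite_induct) (auto simp: zero_l2.rep_eq plus_l2.rep_eq)

text \<open>The inner product of the remainder with itself is a tail of the series for
  \<open>cinner x x\<close>.\<close>

lemma unit_vec_expansion: "(\<lambda>N. \<Sum>n<N. act (unit_vec n) (coord x n)) \<longlonglongrightarrow> x"
proof -
  define S where "S N = (\<Sum>n<N. act (unit_vec n) (coord x n))" for N
  have S: "coord (x - S N) n = (if n < N then 0 else coord x n)" for N n
  proof -
    have "coord (S N) n = (\<Sum>m<N. if m = n then coord x n else 0)"
      unfolding S_def coord_sum by (intro sum.cong) (auto simp: act.rep_eq unit_vec.rep_eq)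
    then show ?thesis by (simp add: minus_l2.rep_eq)
  qed
  have "cinner (x - S N) (x - S N) = cinner x x - (\<Sum>n<N. star (coord x n) * coord x n)" for N
  proof -
    have "cinner (x - S N) (x - S N) = (\<Sum>n. star (coord (x - S N) (n + N)) * coord (x - S N) (n + N))
        + (\<Sum>n<N. star (coord (x - S N) n) * coord (x - S N) n)"
      unfolding cinner_def by (rule suminf_split_initial_segment[OF l2_summable])
    also have "\<dots> = (\<Sum>n. star (coord x (n + N)) * coord x (n + N))" by (simp add: S)
    also have "\<dots> = cinner x x - (\<Sum>n<N. star (coord x n) * coord x n)"
      unfolding cinner_def by (rule suminf_minus_initial_segment[OF l2_summable])
    finally show ?thesis .
  qed
  then have "(\<lambda>N. cinner (x - S N) (x - S N)) \<longlonglongrightarrow> cinner x x - cinner x x"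
    by (simp only:) (intro tendsto_intros cinner_sums)
  then have "(\<lambda>N. norm (x - S N)) \<longlonglongrightarrow> sqrt (norm (0::'a))"
    unfolding norm_l2_def by (intro tendsto_intros) simp
  then have "(\<lambda>N. norm (S N - x)) \<longlonglongrightarrow> 0" by (simp add: norm_minus_commute)
  then have "(\<lambda>N. S N - x) \<longlonglongrightarrow> 0" by (rule tendsto_norm_zero_cancel)
  then have "S \<longlonglongrightarrow> x" by (rule LIM_zero_cancel)
  then show ?thesis by (simp add: S_def[abs_def])
qed

section \<open>The C*-algebra of adjointable operators\<close>

text \<open>It is enough to start from real-linear bounded maps, since the existence of an adjoint
  forces linearity over \<open>'a\<close>, see \<open>app_act\<close>.\<close>

typedef (overloaded) 'a adj =
  "{f :: 'a::unital_cstar_algebra l2 \<Rightarrow>\<^sub>L 'a l2. \<exists>g :: 'a l2 \<Rightarrow>\<^sub>L 'a l2. \<forall>x y. cinner (f x) y = cinner x (g y)}"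
  morphisms fun_of Abs_adj
  by (rule exI[of _ id_blinfun]) (auto intro!: exI[of _ id_blinfun])

setup_lifting type_definition_adj

definition app :: "'a::unital_cstar_algebra adj \<Rightarrow> 'a l2 \<Rightarrow> 'a l2"  (infixr "$$" 80) where
  "T $$ x = blinfun_apply (fun_of T) x"

lemma adj_ext: "(\<And>x. S $$ x = T $$ x) \<Longrightarrow> S = T"
  by (simp add: app_def fun_of_inject[symmetric] blinfun_eqI)

lemma ex_adj:
  assumes "bounded_linear f" "bounded_linear g" "\<And>x y. cinner (f x) y = cinner x (g y)"
  shows "\<exists>T. \<forall>x. T $$ x = f x"
proof (intro exI allI)
  show "Abs_adj (Blinfun f) $$ x = f x" for x
    using assms unfolding app_def
    by (subst Abs_adj_inverse) (auto simp: bounded_linear_Blinfun_apply intro!: exI[of _ "Blinfun g"])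
qed

instantiation adj :: (unital_cstar_algebra) real_normed_vector
begin

lift_definition zero_adj :: "'a adj" is 0 by (auto intro!: exI[of _ 0])
lift_definition plus_adj :: "'a adj \<Rightarrow> 'a adj \<Rightarrow> 'a adj" is "(+)"
proof -
  fix f f' :: "'a l2 \<Rightarrow>\<^sub>L 'a l2"
  assume "\<exists>g. \<forall>x y. cinner (f x) y = cinner x (blinfun_apply g y)"
    "\<exists>g. \<forall>x y. cinner (f' x) y = cinner x (blinfun_apply g y)"
  then obtain g g' :: "'a l2 \<Rightarrow>\<^sub>L 'a l2" where "\<forall>x y. cinner (f x) y = cinner x (g y)"
    "\<forall>x y. cinner (f' x) y = cinner x (g' y)" by blast
  then show "\<exists>g. \<forall>x y. cinner ((f + f') x) y = cinner x (blinfun_apply g y)"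
    by (intro exI[of _ "g + g'"]) (simp add: blinfun.bilinear_simps cinner_add_left cinner_add_right)
qed
lift_definition scaleR_adj :: "real \<Rightarrow> 'a adj \<Rightarrow> 'a adj" is "(*\<^sub>R)"
proof -
  fix r and f :: "'a l2 \<Rightarrow>\<^sub>L 'a l2"
  assume "\<exists>g. \<forall>x y. cinner (f x) y = cinner x (blinfun_apply g y)"
  then obtain g :: "'a l2 \<Rightarrow>\<^sub>L 'a l2" where "\<forall>x y. cinner (f x) y = cinner x (g y)" by blast
  then show "\<exists>g. \<forall>x y. cinner ((r *\<^sub>R f) x) y = cinner x (blinfun_apply g y)"
    by (intro exI[of _ "r *\<^sub>R g"]) (simp add: blinfun.bilinear_simps cinner.scaleR_left cinner.scaleR_right)
qed
definition uminus_adj :: "'a adj \<Rightarrow> 'a adj" where "- T = (-1) *\<^sub>R (T :: 'a adj)"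
definition minus_adj :: "'a adj \<Rightarrow> 'a adj \<Rightarrow> 'a adj" where "S - T = S + - (T :: 'a adj)"
definition norm_adj :: "'a adj \<Rightarrow> real" where "norm_adj T = norm (fun_of T)"
definition dist_adj :: "'a adj \<Rightarrow> 'a adj \<Rightarrow> real" where "dist_adj x y = norm (x - y)"
definition sgn_adj :: "'a adj \<Rightarrow> 'a adj" where "sgn_adj x = inverse (norm x) *\<^sub>R x"
definition uniformity_adj :: "('a adj \<times> 'a adj) filter" where
  "uniformity_adj = (INF e\<in>{0 <..}. principal {(x, y). dist x y < e})"
definition open_adj :: "'a adj set \<Rightarrow> bool" where
  "open_adj S = (\<forall>x\<in>S. \<forall>\<^sub>F (x', y) in uniformity. x' = x \<longrightarrow> y \<in> S)"

instance
proof
  fix x y z :: "'a adj" and r s :: real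
  show "(x + y) + z = x + (y + z)" "x + y = y + x" "0 + x = x"
    "r *\<^sub>R (x + y) = r *\<^sub>R x + r *\<^sub>R y" "(r + s) *\<^sub>R x = r *\<^sub>R x + s *\<^sub>R x"
    "r *\<^sub>R s *\<^sub>R x = (r * s) *\<^sub>R x" "1 *\<^sub>R x = x"
    by (transfer; simp add: algebra_simps)+
  show "- x + x = 0" unfolding uminus_adj_def by transfer simp
  show "x - y = x + - y" by (rule minus_adj_def)
  show "dist x y = norm (x - y)" "sgn x = inverse (norm x) *\<^sub>R x"
    "uniformity = (INF e\<in>{0 <..}. principal {(x :: 'a adj, y). dist x y < e})"
    by (rule dist_adj_def sgn_adj_def uniformity_adj_def)+
  show "open U = (\<forall>x\<in>U. \<forall>\<^sub>F (x', y) in uniformity. x' = x \<longrightarrow> y \<in> U)" for U :: "'a adj set"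
    by (rule open_adj_def)
  show "norm x = 0 \<longleftrightarrow> x = 0" by (simp add: norm_adj_def fun_of_inject[symmetric] zero_adj.rep_eq)
  show "norm (x + y) \<le> norm x + norm y" by (simp add: norm_adj_def plus_adj.rep_eq norm_triangle_ineq)
  show "norm (r *\<^sub>R x) = \<bar>r\<bar> * norm x" by (simp add: norm_adj_def scaleR_adj.rep_eq)
qed

end

lemma norm_adj_diff: "norm (S - T) = norm (fun_of S - fun_of T)"
  unfolding minus_adj_def uminus_adj_def norm_adj_def plus_adj.rep_eq scaleR_adj.rep_eq by simp

lemma app_add: "(S + T) $$ x = S $$ x + T $$ x"
  and app_scaleR: "(r *\<^sub>R T) $$ x = r *\<^sub>R (T $$ x)"
  and app_zero [simp]: "0 $$ x = 0"
  by (simp_all add: app_def plus_adj.rep_eq scaleR_adj.rep_eq zero_adj.rep_eq blinfun.bilinear_simps)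

lemma app_add_right: "T $$ (x + y) = T $$ x + T $$ y"
  and app_scaleR_right: "T $$ (r *\<^sub>R x) = r *\<^sub>R (T $$ x)"
  by (simp_all add: app_def blinfun.bilinear_simps)

lemma norm_app_le: "norm (T $$ x) \<le> norm T * norm x"
  by (simp add: app_def norm_adj_def norm_blinfun)

lemma norm_adj_bound: "0 \<le> b \<Longrightarrow> (\<And>x. norm (T $$ x) \<le> b * norm x) \<Longrightarrow> norm T \<le> b"
  by (simp add: app_def norm_adj_def norm_blinfun_bound)

interpretation app: bounded_bilinear "app :: 'a::unital_cstar_algebra adj \<Rightarrow> _"
proof
  show "\<exists>K. \<forall>(T::'a adj) x. norm (T $$ x) \<le> norm T * norm x * K"
    by (intro exI[of _ 1]) (simp add: norm_app_le)
qed (rule app_add app_add_right app_scaleR app_scaleR_right)+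

declare app.zero_right [simp]

lemma bounded_linear_app: "bounded_linear (app T)" by (rule app.bounded_linear_right)

lemma norm_l2_le_if_cinner:
  assumes "\<And>y. norm (cinner y x) \<le> b * norm y" shows "norm x \<le> b"
proof (cases "x = 0")
  case True then show ?thesis using assms[of "unit_vec 0"] by simp
next
  case False
  have "norm x * norm x \<le> b * norm x" using assms[of x] norm_l2_square[of x] by (simp add: power2_eq_square)
  then show ?thesis using False by simp
qed

lemma ex_adjoint:
  "\<exists>S. \<forall>x y. cinner (T $$ x) y = cinner x (S $$ y)"
proof -
  obtain g :: "'a l2 \<Rightarrow>\<^sub>L 'a l2" where g: "\<And>x y. cinner (T $$ x) y = cinner x (g y)"
    using fun_of[of T] by (auto simp: app_def)
  have "cinner (g x) y = cinner x (T $$ y)" for x y by (metis g star_cinner)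
  then obtain S where "\<And>x. S $$ x = g x"
    using ex_adj[OF blinfun.bounded_linear_right bounded_linear_app] by blast
  then have "\<forall>x y. cinner (T $$ x) y = cinner x (S $$ y)" using g by simp
  then show ?thesis by blast
qed

instantiation adj :: (unital_cstar_algebra) real_normed_algebra_1
begin

definition one_adj :: "'a adj" where "one_adj = (SOME T. \<forall>x. T $$ x = x)"
definition times_adj :: "'a adj \<Rightarrow> 'a adj \<Rightarrow> 'a adj" where
  "times_adj S T = (SOME R. \<forall>x. R $$ x = S $$ T $$ x)"

lemma app_one: "(1 :: 'a adj) $$ x = x"
proof -
  have "\<exists>T :: 'a adj. \<forall>x. T $$ x = x"
    by (rule ex_adj[of "\<lambda>x. x" "\<lambda>x. x"]) (auto intro: bounded_linear_ident)
  from someI_ex[OF this] show ?thesis unfolding one_adj_def by blast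
qed

lemma app_mult: "((S :: 'a adj) * T) $$ x = S $$ T $$ x"
proof -
  obtain S' T' where "\<forall>x y. cinner (S $$ x) y = cinner x (S' $$ y)"
    "\<forall>x y. cinner (T $$ x) y = cinner x (T' $$ y)" using ex_adjoint by blast
  then have "\<exists>R. \<forall>x. R $$ x = S $$ T $$ x"
    by (intro ex_adj[OF bounded_linear_compose[OF bounded_linear_app[of S] bounded_linear_app[of T]]
        bounded_linear_compose[OF bounded_linear_app[of T'] bounded_linear_app[of S']]]) simp
  from someI_ex[OF this] show ?thesis unfolding times_adj_def by blast
qed

instance
proof
  fix a b c :: "'a adj" and r :: real
  show "a * b * c = a * (b * c)" "(a + b) * c = a * c + b * c" "a * (b + c) = a * b + a * c"
    "1 * a = a" "a * 1 = a" "r *\<^sub>R a * b = r *\<^sub>R (a * b)" "a * r *\<^sub>R b = r *\<^sub>R (a * b)"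
    by (auto intro!: adj_ext simp: app_mult app_one app_add app_add_right app_scaleR app_scaleR_right)
  show "norm (a * b) \<le> norm a * norm b"
  proof (rule norm_adj_bound)
    show "norm ((a * b) $$ x) \<le> norm a * norm b * norm x" for x
      unfolding app_mult
      using order_trans[OF norm_app_le mult_left_mono[OF norm_app_le norm_ge_zero]] by (simp add: mult.assoc)
  qed simp
  show "norm (1 :: 'a adj) = 1"
  proof (rule antisym)
    show "norm (1 :: 'a adj) \<le> 1" by (rule norm_adj_bound) (simp_all add: app_one)
    show "1 \<le> norm (1 :: 'a adj)" using norm_app_le[of "1::'a adj" "unit_vec 0"] by (simp add: app_one)
  qed
  then show "(0 :: 'a adj) \<noteq> 1" by (metis norm_zero zero_neq_one)
qed

end

text \<open>The adjoints of a Cauchy sequence form a Cauchy sequence too, and their limit is an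
  adjoint of the limit in operator norm.\<close>

instance adj :: (unital_cstar_algebra) banach
proof
  fix X :: "nat \<Rightarrow> 'a adj" assume C: "Cauchy X"
  define Y where "Y n = (SOME S. \<forall>x y. cinner (X n $$ x) y = cinner x (S $$ y))" for n
  have Y: "cinner (X n $$ x) y = cinner x (Y n $$ y)" for n x y
    using someI_ex[OF ex_adjoint[of "X n"], folded Y_def] by blast
  have CX: "Cauchy (\<lambda>n. fun_of (X n))"
    using C by (simp add: Cauchy_iff norm_adj_diff)
  have "norm (Y m - Y n) \<le> norm (X m - X n)" for m n
  proof (intro norm_adj_bound norm_l2_le_if_cinner)
    fix x y
    have "cinner x ((Y m - Y n) $$ y) = cinner ((X m - X n) $$ x) y"
      by (simp add: app.diff_left cinner.diff_left cinner.diff_right Y)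
    then show "norm (cinner x ((Y m - Y n) $$ y)) \<le> norm (X m - X n) * norm y * norm x"
      using order_trans[OF norm_cinner_le mult_right_mono[OF norm_app_le norm_ge_zero]]
      by (metis mult.assoc mult.commute)
  qed simp
  then have "Cauchy Y" using C unfolding Cauchy_iff by (meson le_less_trans)
  then have CY: "Cauchy (\<lambda>n. fun_of (Y n))"
    by (simp add: Cauchy_iff norm_adj_diff)
  obtain f g where f: "(\<lambda>n. fun_of (X n)) \<longlonglongrightarrow> f" and g: "(\<lambda>n. fun_of (Y n)) \<longlonglongrightarrow> g"
    using Cauchy_convergent[OF CX] Cauchy_convergent[OF CY] by (auto simp: convergent_def)
  have "cinner (f x) y = cinner x (g y)" for x y
  proof (rule LIMSEQ_unique)
    show "(\<lambda>n. cinner (X n $$ x) y) \<longlonglongrightarrow> cinner (f x) y"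
      unfolding app_def by (intro cinner.tendsto blinfun.tendsto f tendsto_const)
    show "(\<lambda>n. cinner (X n $$ x) y) \<longlonglongrightarrow> cinner x (g y)"
      unfolding Y unfolding app_def by (intro cinner.tendsto blinfun.tendsto g tendsto_const)
  qed
  then have F: "fun_of (Abs_adj f) = f" by (subst Abs_adj_inverse) auto
  have "X \<longlonglongrightarrow> Abs_adj f"
    using f by (simp add: LIMSEQ_iff norm_adj_diff F)
  then show "convergent X" by (auto simp: convergent_def)
qed

lemma act_scaleC: "act (act x a) (c *\<^sub>C 1) = act x (c *\<^sub>C a)"
  by (simp add: act_act mult_scaleC_right)

lemma norm_adjoint_le:
  assumes "\<And>x y. cinner (T $$ x) y = cinner x (S $$ y)" shows "norm S \<le> norm T"
proof (intro norm_adj_bound norm_l2_le_if_cinner)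
  show "norm (cinner x (S $$ y)) \<le> norm T * norm y * norm x" for x y
    unfolding assms[symmetric]
    using order_trans[OF norm_cinner_le mult_right_mono[OF norm_app_le norm_ge_zero]]
    by (metis mult.assoc mult.commute)
qed simp

instantiation adj :: (unital_cstar_algebra) unital_cstar_algebra
begin

text \<open>The type \<open>'a l2\<close> carries real scalars only; complex ones act through the
  central elements \<open>c *\<^sub>C 1\<close> of \<open>'a\<close>.\<close>

definition scaleC_adj :: "complex \<Rightarrow> 'a adj \<Rightarrow> 'a adj" where
  "scaleC_adj c T = (SOME S. \<forall>x. S $$ x = act (T $$ x) (c *\<^sub>C 1))"
definition star_adj :: "'a adj \<Rightarrow> 'a adj" where
  "star_adj T = (SOME S. \<forall>x y. cinner (T $$ x) y = cinner x (S $$ y))"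

lemma cinner_app_left: "cinner ((T::'a adj) $$ x) y = cinner x (star T $$ y)"
  using someI_ex[OF ex_adjoint[of T], folded star_adj_def] by blast

lemma cinner_app_right: "cinner x ((T::'a adj) $$ y) = cinner (star T $$ x) y"
  by (metis cinner_app_left star_cinner)

lemma app_scaleC: "(c *\<^sub>C (T :: 'a adj)) $$ x = act (T $$ x) (c *\<^sub>C 1)"
proof -
  have "cinner (act (T $$ x) (c *\<^sub>C 1)) y = cinner x (act (star T $$ y) (cnj c *\<^sub>C 1))" for x y
    by (simp add: cinner_act_left cinner_act_right cinner_app_left star_scaleC mult_scaleC_left mult_scaleC_right)
  then have "\<exists>S. \<forall>x. S $$ x = act (T $$ x) (c *\<^sub>C 1)"
    by (intro ex_adj[OF bounded_linear_compose[OF act.bounded_linear_left bounded_linear_app]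
        bounded_linear_compose[OF act.bounded_linear_left[of "cnj c *\<^sub>C 1"] bounded_linear_app[of "star T"]]])
  from someI_ex[OF this] show ?thesis unfolding scaleC_adj_def by blast
qed

lemma star_adj_eqI: "(\<And>x y. cinner ((T::'a adj) $$ x) y = cinner x (S $$ y)) \<Longrightarrow> star T = S"
  by (intro adj_ext l2_ext) (simp flip: cinner_app_left)

instance
proof
  fix x y :: "'a adj" and r :: real and c d :: complex
  show "of_real r *\<^sub>C x = r *\<^sub>R x" by (rule adj_ext) (simp add: app_scaleC app_scaleR scaleC_of_real act.scaleR_right)
  show "c *\<^sub>C (x + y) = c *\<^sub>C x + c *\<^sub>C y" "(c + d) *\<^sub>C x = c *\<^sub>C x + d *\<^sub>C x"
    by (auto intro!: adj_ext simp: app_scaleC app_add act.add_left act.add_right scaleC_add_left)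
  show "c *\<^sub>C d *\<^sub>C x = (c * d) *\<^sub>C x" "(c *\<^sub>C x) * y = c *\<^sub>C (x * y)"
    by (auto intro!: adj_ext simp: app_scaleC app_mult act_scaleC scaleC_scaleC)
  have lin: "x $$ act z (c *\<^sub>C 1) = act (x $$ z) (c *\<^sub>C 1)" for z
    by (rule l2_ext) (simp add: cinner_app_right cinner_act_right)
  show "x * (c *\<^sub>C y) = c *\<^sub>C (x * y)" by (auto intro!: adj_ext simp: app_scaleC app_mult lin)
  have le: "norm (c *\<^sub>C x) \<le> cmod c * norm x" for c and x :: "'a adj"
  proof (rule norm_adj_bound)
    fix z
    have "norm ((c *\<^sub>C x) $$ z) \<le> norm (x $$ z) * cmod c"
      unfolding app_scaleC by (rule order_trans[OF norm_act_le]) (simp add: norm_scaleC)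
    also have "\<dots> \<le> (norm x * norm z) * cmod c" by (intro mult_right_mono norm_app_le) simp
    finally show "norm ((c *\<^sub>C x) $$ z) \<le> cmod c * norm x * norm z" by (simp add: ac_simps)
  qed simp
  show "norm (c *\<^sub>C x) = cmod c * norm x"
  proof (cases "c = 0")
    case False
    have "inverse c *\<^sub>C c *\<^sub>C x = x"
    proof (rule adj_ext)
      have "(1::complex) *\<^sub>C (1::'a) = 1" using scaleC_of_real[of 1 "1::'a"] by simp
      then show "(inverse c *\<^sub>C c *\<^sub>C x) $$ z = x $$ z" for z
        using False by (simp add: app_scaleC act_scaleC scaleC_scaleC)
    qed
    with le[of "inverse c" "c *\<^sub>C x"] have "norm x \<le> norm (c *\<^sub>C x) / cmod c"
      by (simp add: norm_inverse divide_inverse mult.commute)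
    then show ?thesis using False le[of c x] by (simp add: field_simps)
  qed (use le[of 0 x] in simp)
  show "star (star x) = x" by (rule star_adj_eqI) (metis cinner_app_left star_cinner)
  show "star (x + y) = star x + star y"
    by (rule star_adj_eqI) (simp add: app_add cinner_add_left cinner_add_right cinner_app_left)
  show "star (x * y) = star y * star x"
    by (rule star_adj_eqI) (simp add: app_mult cinner_app_left)
  show "star (c *\<^sub>C x) = cnj c *\<^sub>C star x"
    by (rule star_adj_eqI) (simp add: app_scaleC cinner_act_left cinner_act_right cinner_app_left
        star_scaleC mult_scaleC_left mult_scaleC_right)
  show "norm (star x * x) = (norm x)\<^sup>2"
  proof (rule antisym)
    have "norm (star x) \<le> norm x" by (rule norm_adjoint_le[OF cinner_app_left])
    then show "norm (star x * x) \<le> (norm x)\<^sup>2"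
      unfolding power2_eq_square by (intro order_trans[OF norm_mult_ineq] mult_right_mono) auto
    have "norm x \<le> sqrt (norm (star x * x))"
    proof (rule norm_adj_bound)
      fix z
      have "(norm (x $$ z))\<^sup>2 = norm (cinner z ((star x * x) $$ z))"
        by (simp add: norm_l2_square cinner_app_left app_mult)
      also have "\<dots> \<le> norm z * (norm (star x * x) * norm z)"
        by (rule order_trans[OF norm_cinner_le]) (intro mult_left_mono norm_app_le norm_ge_zero)
      also have "\<dots> = (sqrt (norm (star x * x)) * norm z)\<^sup>2" by (simp add: power2_eq_square)
      finally show "norm (x $$ z) \<le> sqrt (norm (star x * x)) * norm z" by (rule power2_le_imp_le) simp
    qed simp
    from power_mono[OF this norm_ge_zero, of 2] show "(norm x)\<^sup>2 \<le> norm (star x * x)" by simp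
  qed
qed

end

lemma app_act: "T $$ act x a = act (T $$ x) a"
  by (rule l2_ext) (simp add: cinner_app_right cinner_act_right)

section \<open>Closed ranges, polar decomposition and isomorphic ranges\<close>

text \<open>The open mapping theorem in quantitative form. A closed range is a complete metric
  space, so by Baire the closure of the image of some ball has interior in it. This yields preimages
  of controlled norm up to half the norm of the target; iterating on the remainders and summing
  gives exact preimages.\<close>

lemma open_mapping_closed_range:
  fixes f :: "'a::banach \<Rightarrow> 'b::banach"
  assumes f: "bounded_linear f" and clo: "closed (range f)"
  obtains C where "C > 0" "\<And>y. y \<in> range f \<Longrightarrow> \<exists>x. f x = y \<and> norm x \<le> C * norm y"
proof -
  interpret f: bounded_linear f by fact
  define Y where "Y = range f"
  define A where "A n = closure (f ` cball 0 (real n))" for n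
  have AY: "A n \<subseteq> Y" for n
    unfolding A_def Y_def by (rule closure_minimal) (use clo in auto)
  have cov: "Y \<subseteq> (\<Union>n. A n)"
  proof
    fix y assume "y \<in> Y"
    then obtain x where x: "y = f x" by (auto simp: Y_def)
    obtain n where "norm x \<le> real n" using real_arch_simple by blast
    then have "y \<in> f ` cball 0 (real n)" unfolding x by (intro imageI) simp
    then show "y \<in> (\<Union>n. A n)" unfolding A_def by (intro UN_I[of n] subsetD[OF closure_subset]) simp_all
  qed
  have "\<exists>n. top_of_set Y interior_of A n \<noteq> {}"
  proof (rule ccontr)
    assume "\<not> ?thesis"
    have "closedin (top_of_set Y) (A n)" for n
      using AY by (intro closed_subset) (auto simp: A_def)
    with \<open>\<not> ?thesis\<close> have "top_of_set Y interior_of \<Union>(range A) = {}"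
      using clo by (intro Baire_category_alt disjI1 completely_metrizable_space_closedin
          completely_metrizable_space_euclidean) (auto simp: Y_def)
    moreover have "\<Union>(range A) = Y" using cov AY by blast
    ultimately show False
      using interior_of_topspace[of "top_of_set Y"] by (simp add: Y_def)
  qed
  then obtain n T y0 where T: "openin (top_of_set Y) T" "y0 \<in> T" "T \<subseteq> A n"
    unfolding interior_of_def by blast
  then obtain r where r: "r > 0" "ball y0 r \<inter> Y \<subseteq> A n"
    unfolding openin_contains_ball by (meson order_trans)
  have y0: "y0 \<in> Y" using T openin_subset by fastforce
  \<comment> \<open>The scale \<open>t = r / (2 * norm y)\<close> below keeps
    \<open>y0 + t *\<^sub>R y\<close> inside the ball, and two points of the ball of radius
    \<open>n\<close> differ by at most \<open>2 * n\<close>. Division by \<open>t\<close> yields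
    \<open>4 * n * norm y / r\<close>; the added 1 keeps \<open>K\<close> positive when
    \<open>n = 0\<close>.\<close>
  define K where "K = 4 * (real n + 1) / r"
  have K: "K > 0" using r by (simp add: K_def add_nonneg_pos)
  have appr: "\<exists>x. norm x \<le> K * norm y \<and> norm (y - f x) \<le> norm y / 2" if y: "y \<in> Y" for y
  proof (cases "y = 0")
    case False
    define t where "t = r / (2 * norm y)"
    have t: "t > 0" using r False by (simp add: t_def)
    obtain x0 z0 where x0: "y0 = f x0" "y = f z0" using y y0 by (auto simp: Y_def)
    have "y0 + t *\<^sub>R y = f (x0 + t *\<^sub>R z0)" by (simp add: x0 f.add f.scaleR)
    moreover have "dist y0 (y0 + t *\<^sub>R y) < r" using r False t by (simp add: dist_norm t_def)
    ultimately have "y0 + t *\<^sub>R y \<in> A n" "y0 \<in> A n" using r y0 by (auto simp: Y_def)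
    moreover have e: "norm y * t / 4 > 0" using t False by simp
    ultimately obtain a b where ab: "a \<in> cball 0 (real n)" "dist (f a) (y0 + t *\<^sub>R y) < norm y * t / 4"
      "b \<in> cball 0 (real n)" "dist (f b) y0 < norm y * t / 4"
      unfolding A_def closure_approachable by blast
    \<comment> \<open>The difference cancels the centre \<open>y0\<close>. Two errors of a quarter
      make a half, which becomes \<open>norm y / 2\<close> after division by
      \<open>t\<close>.\<close>
    have ne: "norm (t *\<^sub>R y - f (a - b)) \<le> norm y * t / 2"
    proof -
      have "t *\<^sub>R y - f (a - b) = - (f a - (y0 + t *\<^sub>R y)) + (f b - y0)" by (simp add: f.diff)
      also have "norm \<dots> \<le> norm (f a - (y0 + t *\<^sub>R y)) + norm (f b - y0)"
        by (rule order_trans[OF norm_triangle_ineq]) (simp only: norm_minus_cancel)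
      finally show ?thesis using ab by (simp add: dist_norm)
    qed
    define x where "x = (1 / t) *\<^sub>R (a - b)"
    have "f x = (1 / t) *\<^sub>R f (a - b)" by (simp only: x_def f.scaleR)
    then have "y - f x = (1 / t) *\<^sub>R (t *\<^sub>R y - f (a - b))"
      using t by (simp add: scaleR_diff_right)
    then have "norm (y - f x) = (1 / t) * norm (t *\<^sub>R y - f (a - b))"
      using t by (simp only: norm_scaleR) simp
    then have "t * norm (y - f x) \<le> t * (norm y / 2)" using ne t by (simp add: mult.commute)
    then have "norm (y - f x) \<le> norm y / 2" using t by simp
    moreover have "norm x \<le> K * norm y"
    proof -
      have "norm (a - b) \<le> 2 * (real n + 1)"
        using norm_triangle_ineq4[of a b] ab by simp
      then have "(1 / t) * norm (a - b) \<le> (1 / t) * (2 * (real n + 1))"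
        using t by (intro mult_left_mono) auto
      also have "\<dots> = K * norm y" using r False by (simp add: K_def t_def field_simps)
      finally show ?thesis using t by (simp only: x_def norm_scaleR) simp
    qed
    ultimately show ?thesis by blast
  qed (auto intro!: exI[of _ 0])
  then obtain g where g: "\<And>y. y \<in> Y \<Longrightarrow> norm (g y) \<le> K * norm y \<and> norm (y - f (g y)) \<le> norm y / 2"
    by metis
  show ?thesis
  proof (rule that[of "2 * K"])
    fix y assume "y \<in> range f"
    then have y: "y \<in> Y" by (simp add: Y_def)
    define R where "R = rec_nat y (\<lambda>_ z. z - f (g z))"
    have R0: "R 0 = y" and RS: "R (Suc n) = R n - f (g (R n))" for n by (auto simp: R_def)
    have RY: "R n \<in> Y" for n
    proof (induction n)
      case (Suc n)
      then obtain z where "R n = f z" by (auto simp: Y_def)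
      then have "R (Suc n) = f (z - g (R n))" by (simp add: RS f.diff)
      then show ?case by (simp add: Y_def)
    qed (simp add: R0 y)
    have nR: "norm (R n) \<le> norm y * (1/2) ^ n" for n
    proof (induction n)
      case (Suc n)
      have "norm (R (Suc n)) \<le> norm (R n) / 2" using g[OF RY[of n]] by (simp add: RS)
      then show ?case using Suc by simp
    qed (simp add: R0)
    define h where "h n = g (R n)" for n
    have nh: "norm (h n) \<le> K * norm y * (1/2) ^ n" for n
    proof -
      have "norm (h n) \<le> K * norm (R n)" using g[OF RY[of n]] by (simp add: h_def)
      also have "\<dots> \<le> K * (norm y * (1/2) ^ n)" using K nR[of n] by (simp add: mult_left_mono)
      finally show ?thesis by simp
    qed
    have sg: "summable (\<lambda>n. K * norm y * (1/2) ^ n)" by (intro summable_mult summable_geometric) simp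
    then have sn: "summable (\<lambda>n. norm (h n))" by (rule summable_comparison_test') (simp add: nh)
    define x where "x = (\<Sum>n. h n)"
    have "norm x \<le> (\<Sum>n. norm (h n))" unfolding x_def by (rule summable_norm[OF sn])
    also have "\<dots> \<le> (\<Sum>n. K * norm y * (1/2) ^ n)" by (intro suminf_le sn sg nh)
    also have "\<dots> = 2 * K * norm y" by (simp add: suminf_mult suminf_geometric summable_geometric)
    finally have nx: "norm x \<le> 2 * K * norm y" .
    have part: "f (\<Sum>i<n. h i) = y - R n" for n
      by (induction n) (auto simp: f.zero f.add R0 RS h_def)
    have "(\<lambda>n. f (\<Sum>i<n. h i)) \<longlonglongrightarrow> f x"
      unfolding x_def by (intro f.tendsto summable_LIMSEQ summable_norm_cancel[OF sn])
    moreover have "(\<lambda>n. f (\<Sum>i<n. h i)) \<longlonglongrightarrow> y - 0"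
    proof -
      have "(\<lambda>n. norm y * (1/2) ^ n) \<longlonglongrightarrow> norm y * 0" by (intro tendsto_intros LIMSEQ_realpow_zero) auto
      then have "R \<longlonglongrightarrow> 0" by (intro Lim_null_comparison[of R]) (use nR in auto)
      then show ?thesis unfolding part by (intro tendsto_intros)
    qed
    ultimately have "f x = y" using LIMSEQ_unique by fastforce
    with nx show "\<exists>x. f x = y \<and> norm x \<le> 2 * K * norm y" by blast
  qed (use K in simp)
qed

section \<open>Orthogonal projections and complemented ranges\<close>

definition proj :: "'a::unital_cstar_algebra adj \<Rightarrow> bool" where
  "proj p \<longleftrightarrow> star p = p \<and> p * p = p"

lemma proj_app_app: "proj p \<Longrightarrow> p $$ p $$ x = p $$ x"
  by (simp add: proj_def flip: app_mult)

lemma range_proj_iff: "proj p \<Longrightarrow> x \<in> range (app p) \<longleftrightarrow> p $$ x = x"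
  by (metis proj_app_app rangeE rangeI)

lemma closed_range_proj: assumes "proj p" shows "closed (range (app p))"
proof -
  have "range (app p) = {x. p $$ x - x = 0}" using range_proj_iff[OF assms] by auto
  then show ?thesis
    by (auto intro!: closed_Collect_eq continuous_intros linear_continuous_on bounded_linear_app)
qed

lemma cinner_swap_zero: "cinner x y = 0 \<Longrightarrow> cinner y x = 0"
  by (metis star_cinner star_zero)

text \<open>The inner squares of orthogonal elements add as positive elements of the algebra, on
  which the norm is monotone. The squared norms themselves need not add.\<close>

lemma norm_le_norm_add_orthogonal:
  assumes "cinner x y = 0" shows "norm x \<le> norm (x + y)"
proof -
  have "cinner (x + y) (x + y) - cinner x x = cinner y y"
    using cinner_swap_zero[OF assms] assms by (simp add: cinner_add_left cinner_add_right)
  then have "norm (cinner x x) \<le> norm (cinner (x + y) (x + y))"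
    by (intro norm_mono_cpos) (simp_all add: cpos_cinner)
  then show ?thesis by (simp add: norm_l2_def)
qed

text \<open>Orthogonality makes the component in \<open>Y\<close> unique. Uniqueness gives
  linearity, and orthogonality again gives contractivity and self-adjointness.\<close>

lemma ex_proj_if_orthogonal_decomp:
  fixes Y Z :: "'a::unital_cstar_algebra l2 set"
  assumes Y: "\<And>x y. x \<in> Y \<Longrightarrow> y \<in> Y \<Longrightarrow> x + y \<in> Y" "\<And>r x. x \<in> Y \<Longrightarrow> r *\<^sub>R x \<in> Y"
    and Z: "\<And>x y. x \<in> Z \<Longrightarrow> y \<in> Z \<Longrightarrow> x + y \<in> Z" "\<And>r x. x \<in> Z \<Longrightarrow> r *\<^sub>R x \<in> Z"
    and orth: "\<And>y z. y \<in> Y \<Longrightarrow> z \<in> Z \<Longrightarrow> cinner y z = 0"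
    and dec: "\<And>x. \<exists>y\<in>Y. \<exists>z\<in>Z. x = y + z"
  obtains p where "proj p" "range (app p) = Y" "\<And>z. z \<in> Z \<Longrightarrow> p $$ z = 0"
proof -
  obtain P where P: "\<And>x. P x \<in> Y" "\<And>x. x - P x \<in> Z"
    using dec by (metis add_diff_cancel_left')
  have sub: "x - y \<in> W" if "\<And>x y. x \<in> W \<Longrightarrow> y \<in> W \<Longrightarrow> x + y \<in> W" "\<And>r x. x \<in> W \<Longrightarrow> r *\<^sub>R x \<in> W"
    "x \<in> W" "y \<in> W" for x y and W :: "'a l2 set"
    using that(1)[OF that(3) that(2)[OF that(4), of "-1"]] by simp
  have uniq: "P x = y" if "y \<in> Y" "x - y \<in> Z" for x y
  proof -
    have "P x - y \<in> Y" using sub[of Y] Y P that by blast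
    moreover have "(x - y) - (x - P x) \<in> Z" using sub[of Z] Z P that by blast
    then have "P x - y \<in> Z" by simp
    ultimately have "cinner (P x - y) (P x - y) = 0" by (rule orth)
    then show ?thesis by simp
  qed
  have lin: "P (x + y) = P x + P y" "P (r *\<^sub>R x) = r *\<^sub>R P x" for x y r
  proof -
    have "(x - P x) + (y - P y) \<in> Z" "r *\<^sub>R (x - P x) \<in> Z" using Z P by blast+
    then have "(x + y) - (P x + P y) \<in> Z" "r *\<^sub>R x - r *\<^sub>R P x \<in> Z"
      by (simp_all add: algebra_simps)
    then show "P (x + y) = P x + P y" "P (r *\<^sub>R x) = r *\<^sub>R P x" using uniq Y P by blast+
  qed
  have "norm (P x) \<le> norm x" for x
    using norm_le_norm_add_orthogonal[OF orth[OF P(1) P(2)], of x x] by simp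
  then have bl: "bounded_linear P" by (intro bounded_linear_intro[where K=1]) (auto simp: lin)
  have "cinner (P x) y = cinner x (P y)" for x y
  proof -
    have "cinner (P x) (y - P y) = 0" "cinner (x - P x) (P y) = 0"
      using orth P cinner_swap_zero by blast+
    then show ?thesis by (simp add: cinner.diff_left cinner.diff_right)
  qed
  then obtain p where p: "\<And>x. p $$ x = P x" using ex_adj[OF bl bl] by blast
  have Z0: "0 \<in> Z" using Z(2) P(2) by (metis scaleR_zero_left)
  have Y0: "0 \<in> Y" using Y(2) P(1) by (metis scaleR_zero_left)
  have PY: "P y = y" if "y \<in> Y" for y using uniq[OF that] Z0 by simp
  have "proj p" unfolding proj_def
  proof
    show "star p = p" by (rule star_adj_eqI) (simp add: p \<open>\<And>y x. cinner (P x) y = cinner x (P y)\<close>)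
    show "p * p = p" by (rule adj_ext) (simp add: app_mult p PY P)
  qed
  moreover have "range (app p) = Y" using p P(1) PY by (auto simp: image_iff) (metis PY)
  moreover have "p $$ z = 0" if "z \<in> Z" for z unfolding p by (rule uniq[OF Y0]) (simp add: that)
  ultimately show ?thesis using that by blast
qed

text \<open>A pointwise lower bound for \<open>T\<close> passes to left multiplication by
  \<open>T\<close> in the operator algebra, where \<open>star_mult_self_invertible\<close>
  applies.\<close>

lemma bounded_below_star_mult_invertible:
  assumes "c > 0" "\<And>x. c * norm x \<le> norm (T $$ x)"
  obtains B where "B * (star T * T) = 1" "(star T * T) * B = 1"
proof (rule star_mult_self_invertible[OF assms(1), of T])
  fix y
  have "norm y \<le> norm (T * y) / c"
  proof (rule norm_adj_bound)
    fix x
    have "c * norm (y $$ x) \<le> norm ((T * y) $$ x)" using assms(2) by (simp add: app_mult)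
    also have "\<dots> \<le> norm (T * y) * norm x" by (rule norm_app_le)
    finally show "norm (y $$ x) \<le> norm (T * y) / c * norm x" using assms(1) by (simp add: field_simps)
  qed (use assms(1) in simp)
  then show "c * norm y \<le> norm (T * y)" using assms(1) by (simp add: field_simps)
qed (use that in blast)

text \<open>Pair \<open>y\<close> with itself and move \<open>T\<close> to the other side:
  \<open>(norm y)\<^sup>2\<close> is at most \<open>norm (star T $$ y) * norm x\<close>.\<close>

lemma norm_app_bounded_below_adjoint:
  assumes "y = T $$ x" "norm x \<le> C * norm y"
  shows "norm y \<le> C * norm (star T $$ y)"
proof (cases "y = 0")
  case False
  have "norm y * norm y = norm (cinner (star T $$ y) x)"
    using norm_l2_square[of y] assms(1) by (simp add: power2_eq_square cinner_app_left star_star)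
  also have "\<dots> \<le> norm (star T $$ y) * norm x" by (rule norm_cinner_le)
  also have "\<dots> \<le> norm (star T $$ y) * (C * norm y)" by (intro mult_left_mono assms) simp
  finally show ?thesis using False by (simp add: mult.commute)
qed simp

text \<open>By the open mapping theorem \<open>star J\<close>, and hence
  \<open>G = J * star J\<close>, is bounded below on the range \<open>Y\<close> of \<open>J\<close>.
  The equation \<open>G y = G x\<close> is solved inside \<open>Y\<close> as a limit of equations
  with \<open>G + e\<close> in place of \<open>G\<close>, and \<open>x = y + (x - y)\<close> is then
  the orthogonal decomposition along \<open>Y\<close>.\<close>

lemma closed_range_proj_exists:
  fixes J :: "'a::unital_cstar_algebra adj"
  assumes clo: "closed (range (app J))"
  shows "\<exists>q. proj q \<and> range (app q) = range (app J)"
proof -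
  define Y where "Y = range (app J)"
  obtain C where C: "C > 0" "\<And>y. y \<in> range (app J) \<Longrightarrow> \<exists>x. J $$ x = y \<and> norm x \<le> C * norm y"
    using open_mapping_closed_range[OF bounded_linear_app clo] by blast
  have low: "norm y \<le> C * norm (star J $$ y)" if y: "y \<in> Y" for y
    using C(2)[of y] y norm_app_bounded_below_adjoint unfolding Y_def by metis
  define G where "G = J * star J"
  have GY: "G $$ x \<in> Y" for x by (simp add: G_def app_mult Y_def)
  have lowG: "norm y \<le> C\<^sup>2 * norm (G $$ y)" if y: "y \<in> Y" for y
  proof (cases "y = 0")
    case False
    have "(norm y)\<^sup>2 \<le> (C * norm (star J $$ y))\<^sup>2" by (rule power_mono[OF low[OF y]]) simp
    also have "\<dots> = C\<^sup>2 * norm (cinner y (G $$ y))"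
      by (simp add: power_mult_distrib norm_l2_square G_def app_mult cinner_app_left star_star)
    also have "\<dots> \<le> C\<^sup>2 * (norm y * norm (G $$ y))" by (intro mult_left_mono norm_cinner_le) simp
    finally show ?thesis using False by (simp add: power2_eq_square)
  qed simp
  have Ysub: "subspace Y"
    unfolding Y_def by (intro subspace_UNIV bounded_linear.linear[OF bounded_linear_app] linear_subspace_image)
  have pG: "cpos G" using cpos_star_mult_self[of "star J"] by (simp add: G_def star_star)
  have solve: "\<exists>y\<in>Y. G $$ y = G $$ x" for x
  proof -
    define w where "w = G $$ x"
    define e where "e n = inverse (real (Suc n))" for n
    have e: "e n > 0" for n by (simp add: e_def)
    have "\<exists>y\<in>Y. norm (G $$ y - w) \<le> e n * (C\<^sup>2 * (2 * norm w))" for n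
    proof -
      obtain b where b: "b * (G + of_real (e n)) = 1" "(G + of_real (e n)) * b = 1" "norm b \<le> 1 / e n"
        using cpos_shift_inverse[OF pG e] by metis
      \<comment> \<open>\<open>y\<close> solves \<open>(G + e n) y = w\<close>. Hence
        \<open>e n *\<^sub>R y = w - G $$ y\<close> lies in \<open>Y\<close>, where the lower bound
        for \<open>G\<close> applies and keeps \<open>norm y\<close> bounded independently of
        \<open>n\<close>.\<close>
      define y where "y = b $$ w"
      have "w = ((G + of_real (e n)) * b) $$ w" unfolding b(2) by (simp add: app_one)
      then have yw: "w = G $$ y + e n *\<^sub>R y"
        by (simp add: app_mult y_def app_add of_real_def app_scaleR app_one)
      have "y = (1 / e n) *\<^sub>R (w - G $$ y)" using yw e[of n] by simp
      then have yY: "y \<in> Y" using Ysub GY by (metis w_def subspace_diff subspace_scale)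
      have "norm (e n *\<^sub>R y) \<le> norm w"
      proof -
        have "norm y \<le> 1 / e n * norm w"
          unfolding y_def by (rule order_trans[OF norm_app_le]) (intro mult_right_mono b, simp)
        then show ?thesis using e[of n] by (simp add: field_simps)
      qed
      then have "norm (G $$ y) \<le> 2 * norm w"
        using yw norm_triangle_ineq4[of w "e n *\<^sub>R y"] by simp
      then have "norm y \<le> C\<^sup>2 * (2 * norm w)"
        using lowG[OF yY] by (elim order_trans) (intro mult_left_mono, auto)
      moreover have "norm (G $$ y - w) = e n * norm y" using e[of n] by (simp add: yw)
      ultimately show ?thesis using yY e[of n] by (intro bexI[of _ y]) (auto intro: mult_left_mono)
    qed
    then obtain y where y: "\<And>n. y n \<in> Y" "\<And>n. norm (G $$ y n - w) \<le> e n * (C\<^sup>2 * (2 * norm w))" by metis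
    have "(\<lambda>n. e n * (C\<^sup>2 * (2 * norm w))) \<longlonglongrightarrow> 0 * (C\<^sup>2 * (2 * norm w))"
      unfolding e_def by (intro tendsto_intros LIMSEQ_inverse_real_of_nat)
    then have "(\<lambda>n. G $$ y n - w) \<longlonglongrightarrow> 0"
      by (intro Lim_null_comparison[of "\<lambda>n. G $$ y n - w"]) (use y(2) in auto)
    then have lim: "(\<lambda>n. G $$ y n) \<longlonglongrightarrow> w" by (rule LIM_zero_cancel)
    have "Cauchy y"
    proof (rule CauchyI)
      fix d :: real assume d: "d > 0"
      then have "d / C\<^sup>2 > 0" using C by simp
      then obtain M where M: "\<And>m n. m \<ge> M \<Longrightarrow> n \<ge> M \<Longrightarrow> norm (G $$ y m - G $$ y n) < d / C\<^sup>2"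
        using LIMSEQ_imp_Cauchy[OF lim] unfolding Cauchy_iff by blast
      have "norm (y m - y n) < d" if "m \<ge> M" "n \<ge> M" for m n
      proof -
        have "norm (y m - y n) \<le> C\<^sup>2 * norm (G $$ (y m - y n))"
          by (intro lowG subspace_diff Ysub y)
        also have "\<dots> < d" using M[OF that] C by (simp add: app.diff_right field_simps)
        finally show ?thesis .
      qed
      then show "\<exists>M. \<forall>m\<ge>M. \<forall>n\<ge>M. norm (y m - y n) < d" by blast
    qed
    then obtain l where l: "y \<longlonglongrightarrow> l" using Cauchy_convergent convergent_def by blast
    have "l \<in> Y" using clo l y(1) unfolding Y_def closed_sequential_limits by blast
    moreover have "G $$ l = w"
      using LIMSEQ_unique[OF bounded_linear.tendsto[OF bounded_linear_app l] lim] .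
    ultimately show ?thesis by (auto simp: w_def)
  qed
  define Z where "Z = {z. \<forall>y\<in>Y. cinner y z = 0}"
  have "\<exists>y\<in>Y. \<exists>z\<in>Z. x = y + z" for x
  proof -
    obtain y where y: "y \<in> Y" "G $$ y = G $$ x" using solve by blast
    \<comment> \<open>Pairing \<open>x - y\<close> with \<open>G $$ (x - y) = 0\<close> yields
      \<open>star J $$ (x - y) = 0\<close>, so \<open>x - y\<close> is orthogonal to the range of
      \<open>J\<close>.\<close>
    have "cinner (star J $$ (x - y)) (star J $$ (x - y)) = cinner (x - y) (G $$ (x - y))"
      by (simp add: G_def app_mult cinner_app_left star_star)
    then have "star J $$ (x - y) = 0" using y(2) by (simp add: app.diff_right)
    then have "x - y \<in> Z" by (auto simp: Z_def Y_def cinner_app_left)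
    then show ?thesis using y(1) by (intro bexI[of _ y] bexI[of _ "x - y"]) auto
  qed
  note dec = this
  show ?thesis
  proof (rule ex_proj_if_orthogonal_decomp[of Y Z, OF _ _ _ _ _ dec])
    show ?thesis if "proj q" "range (app q) = Y" for q using that by (auto simp: Y_def)
  qed (use Ysub in \<open>auto simp: Z_def subspace_def cinner_add_right cinner.scaleR_right\<close>)
qed

section \<open>Rank-one operators and approximation of ranges\<close>

lemma ex_theta:
  fixes v w :: "'a::unital_cstar_algebra l2"
  shows "\<exists>T. \<forall>x. T $$ x = act v (cinner w x)"
proof -
  have bl: "bounded_linear (\<lambda>x. act v (cinner w x))" for v w :: "'a l2"
    by (rule bounded_linear_compose[OF act.bounded_linear_right cinner.bounded_linear_right])
  have "cinner (act v (cinner w x)) y = cinner x (act w (cinner v y))" for x y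
    by (simp add: cinner_act_left cinner_act_right star_cinner)
  then show ?thesis by (rule ex_adj[OF bl bl])
qed

text \<open>The rank-one operators; norm limits of their sums are the compact operators of Hilbert
  module theory.\<close>

definition theta :: "'a::unital_cstar_algebra l2 \<Rightarrow> 'a l2 \<Rightarrow> 'a adj" where
  "theta v w = (SOME T. \<forall>x. T $$ x = act v (cinner w x))"

lemma app_theta: "theta v w $$ x = act v (cinner w x)"
  using someI_ex[OF ex_theta[of v w], folded theta_def] by blast

lemma star_theta: "star (theta v w) = theta w v"
  by (rule star_adj_eqI) (simp add: app_theta cinner_act_left cinner_act_right star_cinner)

lemma norm_theta_le: "norm (theta v w) \<le> norm v * norm w"
proof (rule norm_adj_bound)
  show "norm (theta v w $$ x) \<le> norm v * norm w * norm x" for x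
    unfolding app_theta mult.assoc
    by (rule order_trans[OF norm_act_le]) (intro mult_left_mono norm_cinner_le norm_ge_zero)
qed simp

text \<open>With \<open>a = R\<^sup>* R\<close> the elements \<open>m\<^sup>* - a (a + e)\<inverse> m\<^sup>* = e (a + e)\<inverse> m\<^sup>*\<close> have norm at
  most \<open>C sqrt (2 e)\<close>.\<close>

lemma range_star_subset_closure:
  assumes dom: "\<And>z. norm (m $$ z) \<le> C * norm (R $$ z)"
  shows "range (app (star m)) \<subseteq> closure (range (app (star R * R)))"
proof
  fix v assume "v \<in> range (app (star m))"
  then obtain x where v: "v = star m $$ x" by blast
  define a where "a = star R * R"
  define C' where "C' = \<bar>C\<bar>"
  have dom': "norm (m $$ z) \<le> C' * norm (R $$ z)" for z
    using dom[of z] mult_right_mono[OF abs_ge_self[of C], of "norm (R $$ z)"] by (simp add: C'_def)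
  define e where "e n = inverse (real (Suc n))" for n
  have e: "e n > 0" for n by (simp add: e_def)
  have "\<exists>y. norm (a $$ y - v) \<le> C' * sqrt (2 * e n) * norm x" for n
  proof -
    obtain b where b: "b * (a + of_real (e n)) = 1" "(a + of_real (e n)) * b = 1" "norm b \<le> 1 / e n" "star b = b"
      using cpos_shift_inverse[OF cpos_star_mult_self e] unfolding a_def by metis
    have ab: "a * b = 1 - e n *\<^sub>R b" using b(2) by (simp add: algebra_simps of_real_def)
    have "norm (e n *\<^sub>R b) \<le> 1" using b(3) e[of n] by (simp add: field_simps)
    then have "norm (a * b) \<le> 2"
      unfolding ab using norm_triangle_ineq4[of 1 "e n *\<^sub>R b"] by simp
    have "(norm (R * b))\<^sup>2 = norm (b * (a * b))"
      by (simp add: a_def star_mult b(4) mult.assoc flip: cstar_identity)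
    also have "\<dots> \<le> (1 / e n) * 2"
      by (rule order_trans[OF norm_mult_ineq]) (intro mult_mono b(3) \<open>norm (a * b) \<le> 2\<close>, use e[of n] in auto)
    finally have nRb: "norm (R * b) \<le> sqrt (2 / e n)" by (intro real_le_rsqrt) simp
    have "norm (m * b) \<le> C' * norm (R * b)"
    proof (rule norm_adj_bound)
      fix z
      have "norm ((m * b) $$ z) \<le> C' * norm ((R * b) $$ z)" by (simp add: app_mult dom')
      also have "\<dots> \<le> C' * (norm (R * b) * norm z)" by (intro mult_left_mono norm_app_le) (simp add: C'_def)
      finally show "norm ((m * b) $$ z) \<le> C' * norm (R * b) * norm z" by (simp add: mult.assoc)
    qed (simp add: C'_def)
    also have "\<dots> \<le> C' * sqrt (2 / e n)" by (intro mult_left_mono nRb) (simp add: C'_def)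
    finally have nmb: "norm (b * star m) \<le> C' * sqrt (2 / e n)"
      by (metis b(4) norm_star star_mult star_star)
    have "a $$ (b * star m) $$ x - v = - (e n *\<^sub>R ((b * star m) $$ x))"
    proof -
      have "a $$ (b * star m) $$ x = (a * b) $$ v" by (simp add: v app_mult)
      also have "\<dots> = v - e n *\<^sub>R (b $$ v)" by (simp add: ab app.diff_left app_one app_scaleR)
      finally show ?thesis by (simp add: v app_mult)
    qed
    then have "norm (a $$ (b * star m) $$ x - v) = e n * norm ((b * star m) $$ x)"
      using e[of n] by simp
    also have "\<dots> \<le> e n * (C' * sqrt (2 / e n) * norm x)"
      using e[of n] order_trans[OF norm_app_le mult_right_mono[OF nmb norm_ge_zero]] by (intro mult_left_mono) auto
    also have "e n * (C' * sqrt (2 / e n) * norm x) = C' * sqrt (2 * e n) * norm x"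
    proof -
      have "e n * sqrt (2 / e n) = sqrt ((e n)\<^sup>2 * (2 / e n))" using e[of n] by (subst real_sqrt_mult) simp
      also have "(e n)\<^sup>2 * (2 / e n) = 2 * e n" using e[of n] by (simp add: power2_eq_square)
      finally show ?thesis by (metis mult.assoc mult.left_commute)
    qed
    finally show ?thesis by blast
  qed
  then obtain y where y: "\<And>n. norm (a $$ y n - v) \<le> C' * sqrt (2 * e n) * norm x" by metis
  have "(\<lambda>n. C' * sqrt (2 * e n) * norm x) \<longlonglongrightarrow> C' * sqrt (2 * 0) * norm x"
    unfolding e_def by (intro tendsto_intros LIMSEQ_inverse_real_of_nat)
  then have "(\<lambda>n. a $$ y n - v) \<longlonglongrightarrow> 0"
    by (intro Lim_null_comparison[of "\<lambda>n. a $$ y n - v"]) (use y in auto)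
  then have "(\<lambda>n. a $$ y n) \<longlonglongrightarrow> v" by (rule LIM_zero_cancel)
  then show "v \<in> closure (range (app (star R * R)))"
    unfolding a_def[symmetric]
    by (intro iffD2[OF closure_sequential] exI[of _ "\<lambda>n. a $$ y n"] conjI allI rangeI)
qed

section \<open>Partial isometries and polar decomposition\<close>

lemma closure_range_seq:
  fixes f :: "'a \<Rightarrow> 'b::metric_space"
  assumes "y \<in> closure (range f)"
  obtains z where "(\<lambda>n. f (z n)) \<longlonglongrightarrow> y"
proof -
  obtain g where g: "\<forall>n. g n \<in> range f" "g \<longlonglongrightarrow> y"
    using assms by (auto simp only: closure_sequential)
  then have "\<forall>n. \<exists>u. g n = f u" by auto
  then obtain u where "\<forall>n. g n = f (u n)" by (rule choice[THEN exE])
  then have "g = (\<lambda>n. f (u n))" by auto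
  with g(2) have "(\<lambda>n. f (u n)) \<longlonglongrightarrow> y" by simp
  then show ?thesis by (rule that)
qed

lemma norm_proj_app_le: assumes "proj p" shows "norm (p $$ x) \<le> norm x"
proof -
  have "cinner (p $$ x) (x - p $$ x) = 0"
    using assms by (simp add: cinner_app_left proj_def app.diff_right proj_app_app[OF assms])
  from norm_le_norm_add_orthogonal[OF this] show ?thesis by simp
qed

text \<open>The value \<open>f x\<close> is determined by its inner products, and the formula with
  \<open>g\<close> makes these linear in \<open>x\<close>. This spares a separate linearity proof
  for maps that are defined through limits.\<close>

lemma bounded_linear_if_adjoint:
  assumes "\<And>x y. cinner (f x) y = cinner x (g y)" "\<And>x. norm (f x) \<le> norm x"
  shows "bounded_linear f"
proof (rule bounded_linear_intro[where K=1])
  have "cinner z (f x) = cinner (g z) x" for x z by (metis assms(1) star_cinner)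
  then show "f (x + y) = f x + f y" "f (r *\<^sub>R x) = r *\<^sub>R f x" for x y r
    by (auto intro!: l2_ext simp: cinner_add_right cinner.scaleR_right)
qed (simp add: assms)

text \<open>The correspondence that sends \<open>G $$ z\<close> to \<open>K $$ z\<close> preserves
  inner products, so it is well defined and isometric. \<open>V\<close> is its continuous extension
  to the closure of the range of \<open>G\<close>, applied after \<open>p\<close>.\<close>

lemma ex_isometric_extension:
  fixes G K :: "'a::unital_cstar_algebra adj"
  assumes GK: "\<And>x y. cinner (G $$ x) (G $$ y) = cinner (K $$ x) (K $$ y)"
    and p: "proj p" "range (app p) = closure (range (app G))"
  obtains V where "\<And>x z. (\<lambda>n. G $$ z n) \<longlonglongrightarrow> p $$ x \<Longrightarrow> (\<lambda>n. K $$ z n) \<longlonglongrightarrow> V x"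
    "\<And>x. V x \<in> closure (range (app K))" "\<And>x. norm (V x) \<le> norm x"
proof -
  have eq: "norm (K $$ a - K $$ b) = norm (G $$ a - G $$ b)" for a b
    using GK[of "a - b" "a - b"] by (simp add: app.diff_right norm_l2_def)
  have "\<exists>y. (\<forall>z. ((\<lambda>n. G $$ z n) \<longlonglongrightarrow> p $$ x) \<longrightarrow> ((\<lambda>n. K $$ z n) \<longlonglongrightarrow> y))
      \<and> y \<in> closure (range (app K)) \<and> norm y \<le> norm x" for x
  proof -
    have "p $$ x \<in> closure (range (app G))" using p(2) by blast
    then obtain u where limu: "(\<lambda>n. G $$ u n) \<longlonglongrightarrow> p $$ x" by (rule closure_range_seq)
    have "Cauchy (\<lambda>n. K $$ u n)"
      using LIMSEQ_imp_Cauchy[OF limu] unfolding Cauchy_iff eq .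
    then obtain y where y: "(\<lambda>n. K $$ u n) \<longlonglongrightarrow> y" using Cauchy_convergent convergent_def by blast
    have 1: "(\<lambda>n. K $$ z n) \<longlonglongrightarrow> y" if z: "(\<lambda>n. G $$ z n) \<longlonglongrightarrow> p $$ x" for z
    proof -
      have "(\<lambda>n. norm (G $$ z n - G $$ u n)) \<longlonglongrightarrow> norm (p $$ x - p $$ x)"
        by (intro tendsto_intros z limu)
      then have "(\<lambda>n. norm (K $$ z n - K $$ u n)) \<longlonglongrightarrow> 0" by (simp add: eq)
      then have "(\<lambda>n. K $$ z n - K $$ u n) \<longlonglongrightarrow> 0" by (rule tendsto_norm_zero_cancel)
      from tendsto_add[OF this y] show ?thesis by simp
    qed
    have 2: "y \<in> closure (range (app K))" 
      by (intro iffD2[OF closure_sequential] exI[of _ "\<lambda>n. K $$ u n"] conjI allI rangeI y)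
    have "norm y = norm (p $$ x)"
      using LIMSEQ_unique[OF tendsto_norm[OF y]] tendsto_norm[OF limu] eq[of _ 0] by simp
    then have "norm y \<le> norm x" using norm_proj_app_le[OF p(1)] by simp
    with 1 2 show ?thesis by blast
  qed
  then obtain V where "\<And>x. (\<forall>z. ((\<lambda>n. G $$ z n) \<longlonglongrightarrow> p $$ x) \<longrightarrow> ((\<lambda>n. K $$ z n) \<longlonglongrightarrow> V x))
      \<and> V x \<in> closure (range (app K)) \<and> norm (V x) \<le> norm x"
    by metis
  then show ?thesis using that by blast
qed

text \<open>The extension of the correspondence from \<open>G $$ z\<close> to \<open>K $$ z\<close>
  and that of its inverse are adjoint to each other. With \<open>G\<close> the positive root of
  \<open>star K * K\<close> this is the polar decomposition of \<open>K\<close>; \<open>p\<close>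
  and \<open>q\<close> express that both range closures are complemented.\<close>

lemma ex_partial_isometry:
  fixes G K :: "'a::unital_cstar_algebra adj"
  assumes GK: "star G * G = star K * K"
    and p: "proj p" "range (app p) = closure (range (app G))"
    and q: "proj q" "range (app q) = closure (range (app K))"
  obtains V where "star V * V = p" "V * star V = q"
proof -
  have inGK: "cinner (G $$ x) (G $$ y) = cinner (K $$ x) (K $$ y)" for x y
  proof -
    have "cinner (G $$ x) (G $$ y) = cinner x ((star G * G) $$ y)" by (simp add: app_mult cinner_app_left)
    also have "\<dots> = cinner (K $$ x) (K $$ y)" by (simp add: app_mult cinner_app_left GK)
    finally show ?thesis .
  qed
  obtain V where V: "\<And>x z. (\<lambda>n. G $$ z n) \<longlonglongrightarrow> p $$ x \<Longrightarrow> (\<lambda>n. K $$ z n) \<longlonglongrightarrow> V x"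
    "\<And>x. V x \<in> closure (range (app K))" "\<And>x. norm (V x) \<le> norm x"
    using ex_isometric_extension[OF inGK p] by blast
  obtain W where W: "\<And>x z. (\<lambda>n. K $$ z n) \<longlonglongrightarrow> q $$ x \<Longrightarrow> (\<lambda>n. G $$ z n) \<longlonglongrightarrow> W x"
    "\<And>x. W x \<in> closure (range (app G))" "\<And>x. norm (W x) \<le> norm x"
    using ex_isometric_extension[OF inGK[symmetric] q] by blast
  have exG: "\<exists>z. (\<lambda>n. G $$ z n) \<longlonglongrightarrow> p $$ x" for x
    using closure_range_seq[of "p $$ x" "app G"] p(2) by blast
  have exK: "\<exists>z. (\<lambda>n. K $$ z n) \<longlonglongrightarrow> q $$ x" for x
    using closure_range_seq[of "q $$ x" "app K"] q(2) by blast
  have qV: "q $$ V x = V x" for x using V(2)[of x, folded q(2)] by (simp add: range_proj_iff[OF q(1)])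
  have pW: "p $$ W x = W x" for x using W(2)[of x, folded p(2)] by (simp add: range_proj_iff[OF p(1)])
  have sp: "star p = p" and sq: "star q = q" using p q by (simp_all add: proj_def)
  have adj: "cinner (V x) y = cinner x (W y)" for x y
  proof -
    obtain z where z: "(\<lambda>n. G $$ z n) \<longlonglongrightarrow> p $$ x" using exG by blast
    obtain u where u: "(\<lambda>n. K $$ u n) \<longlonglongrightarrow> q $$ y" using exK by blast
    have "(\<lambda>n. cinner (K $$ z n) (K $$ u n)) \<longlonglongrightarrow> cinner (V x) (q $$ y)"
      by (intro cinner.tendsto V(1) z u)
    moreover have "(\<lambda>n. cinner (K $$ z n) (K $$ u n)) \<longlonglongrightarrow> cinner (p $$ x) (W y)"
      unfolding inGK[symmetric] by (intro cinner.tendsto W(1) z u)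
    ultimately have "cinner (V x) (q $$ y) = cinner (p $$ x) (W y)" by (rule LIMSEQ_unique)
    moreover have "cinner (V x) (q $$ y) = cinner (V x) y" by (simp add: cinner_app_right sq qV)
    moreover have "cinner (p $$ x) (W y) = cinner x (W y)" by (simp add: cinner_app_left sp pW)
    ultimately show ?thesis by simp
  qed
  have adj': "cinner (W x) y = cinner x (V y)" for x y by (metis adj star_cinner)
  note bl = bounded_linear_if_adjoint[OF adj V(3)] bounded_linear_if_adjoint[OF adj' W(3)]
  obtain T where T: "\<And>x. T $$ x = V x" using ex_adj[OF bl adj] by blast
  obtain S where S: "\<And>x. S $$ x = W x" using ex_adj[OF bl(2,1) adj'] by blast
  have ST: "star T = S" by (rule star_adj_eqI) (simp add: T S adj)
  have "star T * T = p"
  proof (rule adj_ext)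
    fix x
    obtain z where z: "(\<lambda>n. G $$ z n) \<longlonglongrightarrow> p $$ x" using exG by blast
    then have "(\<lambda>n. G $$ z n) \<longlonglongrightarrow> W (V x)" by (intro W(1)) (simp add: qV V(1))
    from LIMSEQ_unique[OF this z] show "(star T * T) $$ x = p $$ x" by (simp add: ST app_mult S T)
  qed
  moreover have "T * star T = q"
  proof (rule adj_ext)
    fix x
    obtain z where z: "(\<lambda>n. K $$ z n) \<longlonglongrightarrow> q $$ x" using exK by blast
    then have "(\<lambda>n. K $$ z n) \<longlonglongrightarrow> V (W x)" by (intro V(1)) (simp add: pW W(1))
    from LIMSEQ_unique[OF this z] show "(T * star T) $$ x = q $$ x" by (simp add: ST app_mult S T)
  qed
  ultimately show ?thesis using that by blast
qed

text \<open>A module map without adjoint still sends a rank-one operator to a rank-one operator: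
  \<open>f\<close> after \<open>theta v w\<close> is \<open>theta (f v) w\<close>. So
  \<open>d\<close> is a weighted sum of the operators
  \<open>theta (unit_vec n) (unit_vec n)\<close>, and the weights \<open>(1/2) ^ n\<close> make both
  \<open>d\<close> and its composition with \<open>f\<close> converge in norm among adjointable
  operators. The range of \<open>d\<close> is dense because it contains all finite combinations of
  unit vectors.\<close>

lemma ex_dense_selfadjoint:
  fixes f :: "'a::unital_cstar_algebra l2 \<Rightarrow> 'a l2"
  assumes f: "bounded_linear f" "\<And>x a. f (act x a) = act (f x) a"
  obtains d g :: "'a adj" where "star d = d" "closure (range (app d)) = UNIV" "\<And>x. g $$ x = f (d $$ x)"
proof -
  obtain B where B: "\<And>x. norm (f x) \<le> norm x * B" using bounded_linear.bounded[OF f(1)] by blast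
  have B0: "B \<ge> 0" using B[of "unit_vec 0"] norm_ge_zero[of "f (unit_vec 0)"] by (simp del: norm_ge_zero)
  define D where "D n = (1/2) ^ n *\<^sub>R theta (unit_vec n) (unit_vec n :: 'a l2)" for n
  define E where "E n = (1/2) ^ n *\<^sub>R theta (f (unit_vec n)) (unit_vec n :: 'a l2)" for n
  have geo: "summable (\<lambda>n. (1/2) ^ n * r :: real)" for r by (intro summable_mult2 summable_geometric) simp
  have sD: "summable D"
  proof (rule summable_comparison_test'[OF geo[of 1]])
    show "norm (D n) \<le> (1/2) ^ n * 1" for n
      using norm_theta_le[of "unit_vec n" "unit_vec n :: 'a l2"] by (simp add: D_def mult_left_mono)
  qed
  have sE: "summable E"
  proof (rule summable_comparison_test'[OF geo[of B]])
    show "norm (E n) \<le> (1/2) ^ n * B" for n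
      using order_trans[OF norm_theta_le[of "f (unit_vec n)" "unit_vec n :: 'a l2"], of B] B[of "unit_vec n"]
      by (simp add: E_def mult_left_mono)
  qed
  define d g where "d = suminf D" and "g = suminf E"
  have "star (D n) = D n" for n by (simp add: D_def star_scaleR star_theta)
  moreover have "star d = (\<Sum>n. star (D n))"
    unfolding d_def by (rule bounded_linear.suminf[OF bounded_linear_star sD])
  ultimately have sd: "star d = d" by (simp add: d_def)
  have appd: "(\<lambda>n. D n $$ x) sums (d $$ x)" for x
    unfolding d_def by (rule bounded_linear.sums[OF app.bounded_linear_left summable_sums[OF sD]])
  have appg: "(\<lambda>n. E n $$ x) sums (g $$ x)" for x
    unfolding g_def by (rule bounded_linear.sums[OF app.bounded_linear_left summable_sums[OF sE]])
  have gf: "g $$ x = f (d $$ x)" for x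
  proof -
    have "f (D n $$ x) = E n $$ x" for n
      by (simp add: D_def E_def app_scaleR app_theta f(2) linear_scale[OF bounded_linear.linear[OF f(1)]])
    then have "(\<lambda>n. E n $$ x) sums f (d $$ x)" using bounded_linear.sums[OF f(1) appd[of x]] by simp
    with appg[of x] show ?thesis by (rule sums_unique2)
  qed
  have sub: "subspace (range (app d))"
    by (intro subspace_UNIV bounded_linear.linear[OF bounded_linear_app] linear_subspace_image)
  have "act (unit_vec n) a \<in> range (app d)" for n a
  proof -
    define v where "v = (1/2) ^ n *\<^sub>R act (unit_vec n) a"
    have "(\<lambda>m. D m $$ act (unit_vec n) a) = (\<lambda>m. if m = n then v else 0)"
      by (auto simp: v_def D_def app_scaleR app_theta cinner_act_right cinner_unit_vec unit_vec.rep_eq)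
    with appd[of "act (unit_vec n) a"]
    have "(\<lambda>m. if m = n then v else 0) sums (d $$ act (unit_vec n) a)" by (simp only:)
    then have "d $$ act (unit_vec n) a = v"
      by (rule sums_unique2) (rule sums_single[of n "\<lambda>_. v"])
    then have "d $$ (2 ^ n *\<^sub>R act (unit_vec n) a) = act (unit_vec n) a"
      by (simp add: app_scaleR_right v_def power_one_over)
    then show ?thesis by (metis rangeI)
  qed
  then have "(\<Sum>n<N. act (unit_vec n) (coord x n)) \<in> range (app d)" for N x
    by (intro subspace_sum[OF sub])
  then have "x \<in> closure (range (app d))" for x
    by (intro iffD2[OF closure_sequential] exI[of _ "\<lambda>N. \<Sum>n<N. act (unit_vec n) (coord x n)"]
        conjI allI unit_vec_expansion)
  then have "closure (range (app d)) = UNIV" by blast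
  with sd gf that show ?thesis by blast
qed

text \<open>The isomorphism \<open>f\<close> need not be adjointable, but \<open>R = f d d p\<close> is. Since \<open>p d\<close> has dense
  range in the range of \<open>p\<close> and \<open>f\<close> is bounded below, both \<open>R\<close> and \<open>R\<^sup>* R\<close> have dense range, so the
  polar decomposition of \<open>R\<close> provides a unitary between the two ranges.\<close>

theorem ex_partial_isometry_if_isomorphic:
  fixes p q :: "'a::unital_cstar_algebra adj"
  assumes p: "proj p" and q: "proj q"
    and f: "bounded_linear f" "\<And>x a. f (act x a) = act (f x) a" "\<And>x. f (p $$ x) = f x"
    and ran: "range f = range (app q)"
    and low: "\<And>x. norm (p $$ x) \<le> C * norm (f x)"
  obtains V where "star V * V = p" "V * star V = q"
proof -
  obtain d g :: "'a adj" where d: "star d = d" "closure (range (app d)) = UNIV" and g: "\<And>x. g $$ x = f (d $$ x)"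
    using ex_dense_selfadjoint[OF f(1,2)] by metis
  have sp: "star p = p" using p by (simp add: proj_def)
  define X where "X = range (app p)"
  have cX: "closed X" unfolding X_def by (rule closed_range_proj[OF p])
  define k where "k = p * d * d * p"
  define R where "R = g * d * p"
  have Rk: "R $$ z = f (k $$ z)" for z by (simp add: R_def k_def app_mult g f(3))
  have Xpd: "X \<subseteq> closure (range (app (p * d)))"
  proof -
    have "app p ` closure (range (app d)) \<subseteq> closure (app p ` range (app d))"
      by (intro continuous_image_closure_subset[of UNIV] linear_continuous_on bounded_linear_app) simp
    moreover have "app p ` range (app d) = range (app (p * d))"
      by (simp add: image_image app_mult)
    ultimately show ?thesis by (simp add: X_def d(2))
  qed
  have Xk: "X \<subseteq> closure (range (app k))"
  proof -
    \<comment> \<open>The domination hypothesis holds trivially with both operators equal to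
      \<open>d * p\<close>, whose adjoint is \<open>p * d\<close>; the product on the right is
      \<open>k\<close>.\<close>
    have "range (app (star (d * p))) \<subseteq> closure (range (app (star (d * p) * (d * p))))"
      by (rule range_star_subset_closure[where C=1]) simp
    then have "range (app (p * d)) \<subseteq> closure (range (app k))"
      by (simp add: k_def star_mult sp d(1) mult.assoc)
    then have "closure (range (app (p * d))) \<subseteq> closure (range (app k))"
      by (rule closure_minimal) simp
    with Xpd show ?thesis by blast
  qed
  have clR: "closure (range (app R)) = range (app q)"
  proof
    show "closure (range (app R)) \<subseteq> range (app q)"
      by (rule closure_minimal[OF _ closed_range_proj[OF q]]) (auto simp: Rk ran[symmetric])
    have "range (app q) = f ` X" unfolding ran[symmetric] X_def image_image by (simp add: f(3))
    also have "\<dots> \<subseteq> f ` closure (range (app k))" by (rule image_mono[OF Xk])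
    also have "\<dots> \<subseteq> closure (f ` range (app k))"
      by (intro continuous_image_closure_subset[of UNIV] linear_continuous_on f(1)) simp
    also have "f ` range (app k) = range (app R)" by (simp add: image_image Rk)
    finally show "range (app q) \<subseteq> closure (range (app R))" .
  qed
  have sk: "star k = k" by (simp add: k_def star_mult sp d(1) mult.assoc)
  have pk: "p $$ k $$ z = k $$ z" for z by (simp add: k_def app_mult proj_app_app[OF p])
  \<comment> \<open>Since \<open>p\<close> fixes the range of \<open>k\<close>, the lower bound for
    \<open>f\<close> at \<open>k $$ z\<close> reads
    \<open>norm (k $$ z) \<le> C * norm (R $$ z)\<close>, so \<open>R\<close> dominates
    \<open>k\<close>.\<close>
  have "range (app (star k)) \<subseteq> closure (range (app (star R * R)))"
    by (rule range_star_subset_closure[where C=C]) (use low[of "k $$ _"] in \<open>simp add: Rk pk\<close>)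
  then have "closure (range (app k)) \<subseteq> closure (range (app (star R * R)))"
    unfolding sk by (rule closure_minimal) simp
  with Xk have XR: "X \<subseteq> closure (range (app (star R * R)))" by blast
  obtain w where w: "cpos w" "w * w = star R * R" using cpos_sqrt[OF cpos_star_mult_self] by metis
  have sw: "star w = w" by (rule cpos_star[OF w(1)])
  \<comment> \<open>\<open>w\<close> kills whatever \<open>R\<close> kills, in particular the
    complement of \<open>X\<close>. Taking adjoints, the range of \<open>w\<close> lies in
    \<open>X\<close>.\<close>
  have "R * (1 - p) = 0" using p by (simp add: R_def proj_def algebra_simps)
  moreover have "star (w * (1 - p)) * (w * (1 - p)) = star (1 - p) * star R * (R * (1 - p))"
    unfolding star_mult sw using w(2) by (metis mult.assoc)
  ultimately have "star (w * (1 - p)) * (w * (1 - p)) = 0" by simp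
  then have "w * (1 - p) = 0" by (simp only: star_mult_self_eq_0_iff)
  then have "star (w * p) = star w" by (simp add: algebra_simps)
  then have pw: "p * w = w" by (simp add: star_mult sw sp)
  have clw: "closure (range (app w)) = X"
  proof
    show "closure (range (app w)) \<subseteq> X"
    proof (rule closure_minimal[OF _ cX])
      show "range (app w) \<subseteq> X" unfolding X_def by (metis app_mult image_subsetI pw rangeI)
    qed
    have "range (app (star R * R)) \<subseteq> range (app w)" by (auto simp: app_mult simp flip: w(2))
    then show "X \<subseteq> closure (range (app w))" using XR closure_mono by blast
  qed
  show ?thesis
    by (rule ex_partial_isometry[of w R p q]) (use w(2) sw p q clw clR that in \<open>auto simp: X_def\<close>)
qed

section \<open>Fredholm operators on the double of the standard module\<close>

declare split_paired_All [simp del] split_paired_Ex [simp del]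

section \<open>Translation between the record modules and the types\<close>

lemma hcarrier_std [simp]:
  "hcarrier (std_module :: (nat \<Rightarrow> 'a::unital_cstar_algebra, 'a) hmodule) = range coord"
proof -
  have "range (coord :: 'a l2 \<Rightarrow> _) = {x. summable (\<lambda>n. star (x n) * x n)}"
    using type_definition.Rep_range[OF type_definition_l2] .
  then show ?thesis by (simp add: std_module_def)
qed

lemma coord_add: "coord (x + y) = coord x + coord y"
  and coord_diff: "coord (x - y) = coord x - coord y"
  and coord_zero [simp]: "coord 0 = 0"
  by (auto simp: plus_l2.rep_eq minus_l2.rep_eq zero_l2.rep_eq)

lemma hact_std: "hact std_module (coord x) a = coord (act x a)"
  by (simp add: std_module_def act.rep_eq)

lemma hscale_std: "hscale std_module c (coord x) = coord (act x (c *\<^sub>C 1))"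
  by (simp add: std_module_def act.rep_eq mult_scaleC_right)

lemma hinner_std: "hinner std_module (coord x) (coord y) = cinner x y"
  by (simp add: std_module_def cinner_def)

lemma hnorm_std: "hnorm std_module (coord x) = norm x"
  by (simp add: hnorm_def hinner_std norm_l2_def)

lemma act_of_real_scaleC: "act x (complex_of_real r *\<^sub>C 1) = r *\<^sub>R x"
  by (simp add: scaleC_of_real act.scaleR_right)

lemma restr_simps [simp]:
  "hcarrier (H \<restriction>\<^sub>H M) = M" "hscale (H \<restriction>\<^sub>H M) = hscale H" "hact (H \<restriction>\<^sub>H M) = hact H"
  "hinner (H \<restriction>\<^sub>H M) = hinner H" "hnorm (H \<restriction>\<^sub>H M) = hnorm H"
  by (auto simp: restr_def hnorm_def fun_eq_iff)

lemma hspan_image: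
  assumes "x \<in> hspan H G" and f: "f 0 = 0"
      "\<And>x y. x \<in> hspan H G \<Longrightarrow> y \<in> hspan H G \<Longrightarrow> f (x + y) = f x + f y"
      "\<And>c x. x \<in> hspan H G \<Longrightarrow> f (hscale H c x) = hscale K c (f x)"
      "\<And>a x. x \<in> hspan H G \<Longrightarrow> f (hact H x a) = hact K (f x) a"
    and G': "f ` G \<subseteq> G'"
  shows "f x \<in> hspan K G'"
  using assms(1)
proof induction
  case zero then show ?case unfolding f(1) by (rule hspan.zero)
next
  case (base x) then show ?case using G' by (intro hspan.base) blast
qed (simp_all add: f hspan.add hspan.scale hspan.act)

lemma finitely_generated_image:
  assumes fg: "finitely_generated (H \<restriction>\<^sub>H N)"
    and f: "\<And>x y. x \<in> N \<Longrightarrow> y \<in> N \<Longrightarrow> f (x + y) = f x + f y" "f 0 = 0"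
      "\<And>c x. x \<in> N \<Longrightarrow> f (hscale H c x) = hscale K c (f x)"
      "\<And>a x. x \<in> N \<Longrightarrow> f (hact H x a) = hact K (f x) a"
  shows "finitely_generated (K \<restriction>\<^sub>H f ` N)"
proof -
  obtain G where G: "finite G" "G \<subseteq> N" "N = hspan (H \<restriction>\<^sub>H N) G"
    using fg unfolding finitely_generated_def by auto
  have closed: "0 \<in> N" "x \<in> N \<Longrightarrow> y \<in> N \<Longrightarrow> x + y \<in> N" "x \<in> N \<Longrightarrow> hscale H c x \<in> N"
    "x \<in> N \<Longrightarrow> hact H x a \<in> N" for x y c a
    using hspan.intros[where H="H \<restriction>\<^sub>H N" and S=G] unfolding G(3)[symmetric] by auto
  have 1: "f x \<in> hspan (K \<restriction>\<^sub>H f ` N) (f ` G)" if "x \<in> N" for x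
    by (rule hspan_image[where H="H \<restriction>\<^sub>H N" and G=G])
      (use that f in \<open>simp_all flip: G(3)\<close>)
  have 2: "y \<in> f ` N" if "y \<in> hspan (K \<restriction>\<^sub>H f ` N) (f ` G)" for y
    using that
  proof induction
    case zero then show ?case using closed(1) f(2) by (metis imageI)
  next
    case (base x) then show ?case using G(2) by blast
  next
    case (add x y) then show ?case using closed(2) f(1) by (smt (verit) imageE imageI)
  next
    case (scale x c) then show ?case using closed(3) f(3) by (smt (verit) imageE imageI restr_simps(2))
  next
    case (act x a) then show ?case using closed(4) f(4) by (smt (verit) imageE imageI restr_simps(3))
  qed
  have "f ` N \<subseteq> hspan (K \<restriction>\<^sub>H f ` N) (f ` G)" using 1 by blast
  then have "f ` N = hspan (K \<restriction>\<^sub>H f ` N) (f ` G)" using 2 by blast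
  then show ?thesis unfolding finitely_generated_def
    using G(1,2) by (intro exI[of _ "f ` G"]) auto
qed

lemma finitely_generated_zero: "finitely_generated (std_module \<restriction>\<^sub>H {0})"
proof -
  have "x = 0" if "x \<in> hspan (std_module \<restriction>\<^sub>H {0}) {}" for x :: "nat \<Rightarrow> 'a"
    using that by induction (auto simp: std_module_def fun_eq_iff linear_0[OF bounded_linear.linear[OF bounded_linear_scaleC]])
  then have "{0 :: nat \<Rightarrow> 'a} = hspan (std_module \<restriction>\<^sub>H {0}) {}" using hspan.zero by blast
  then show ?thesis unfolding finitely_generated_def by (intro exI[of _ "{}"]) simp
qed

lemma orth_sum_simps [simp]:
  "hcarrier (H \<oplus>\<^sub>H K) = hcarrier H \<times> hcarrier K"
  "hscale (H \<oplus>\<^sub>H K) c (x, y) = (hscale H c x, hscale K c y)"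
  "hact (H \<oplus>\<^sub>H K) (x, y) a = (hact H x a, hact K y a)"
  "hinner (H \<oplus>\<^sub>H K) (x, y) (x', y') = hinner H x x' + hinner K y y'"
  by (simp_all add: orth_sum_def)

lemma hscale_std_zero [simp]: "hscale std_module c 0 = 0"
  and hact_std_zero [simp]: "hact std_module 0 a = 0"
  using hscale_std[of c 0] hact_std[of 0 a] by simp_all

lemma finitely_generated_Times:
  assumes "finitely_generated (std_module \<restriction>\<^sub>H A)" "finitely_generated (std_module \<restriction>\<^sub>H B)"
  shows "finitely_generated ((std_module \<oplus>\<^sub>H std_module) \<restriction>\<^sub>H (A \<times> B))"
proof -
  obtain G where G: "finite G" "G \<subseteq> A" "A = hspan (std_module \<restriction>\<^sub>H A) G"
    using assms unfolding finitely_generated_def by auto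
  obtain G' where G': "finite G'" "G' \<subseteq> B" "B = hspan (std_module \<restriction>\<^sub>H B) G'"
    using assms unfolding finitely_generated_def by auto
  have cA: "0 \<in> A" "x \<in> A \<Longrightarrow> y \<in> A \<Longrightarrow> x + y \<in> A" "x \<in> A \<Longrightarrow> hscale std_module c x \<in> A"
    "x \<in> A \<Longrightarrow> hact std_module x a \<in> A" for x y c a
    using hspan.intros[where H="std_module \<restriction>\<^sub>H A" and S=G] unfolding G(3)[symmetric] by auto
  have cB: "0 \<in> B" "x \<in> B \<Longrightarrow> y \<in> B \<Longrightarrow> x + y \<in> B" "x \<in> B \<Longrightarrow> hscale std_module c x \<in> B"
    "x \<in> B \<Longrightarrow> hact std_module x a \<in> B" for x y c a
    using hspan.intros[where H="std_module \<restriction>\<^sub>H B" and S=G'] unfolding G'(3)[symmetric] by auto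
  let ?H = "(std_module \<oplus>\<^sub>H std_module) \<restriction>\<^sub>H (A \<times> B)"
  let ?G = "(\<lambda>x. (x, 0)) ` G \<union> (\<lambda>y. (0, y)) ` G'"
  have 1: "(x, 0) \<in> hspan ?H ?G" if "x \<in> A" for x
    by (rule hspan_image[where H="std_module \<restriction>\<^sub>H A" and G=G and f="\<lambda>x. (x, 0)"])
      (use that G(3) in \<open>auto simp: zero_prod_def\<close>)
  have 2: "(0, y) \<in> hspan ?H ?G" if "y \<in> B" for y
    by (rule hspan_image[where H="std_module \<restriction>\<^sub>H B" and G=G' and f="\<lambda>y. (0, y)"])
      (use that G'(3) in \<open>auto simp: zero_prod_def\<close>)
  have "(x, y) \<in> hspan ?H ?G" if "x \<in> A" "y \<in> B" for x y
    using hspan.add[OF 1 2, of x y] that by (simp only: add_Pair add_0_left add_0_right)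
  moreover have "z \<in> A \<times> B" if "z \<in> hspan ?H ?G" for z
    using that
  proof induction
    case zero then show ?case using cA cB by (simp add: zero_prod_def)
  next
    case (base x) then show ?case using G G' cA cB by auto
  next
    case (add x y) then show ?case using cA cB by auto
  next
    case (scale x c) then show ?case using cA cB by auto
  next
    case (act x a) then show ?case using cA cB by auto
  qed
  ultimately have "A \<times> B = hspan ?H ?G" by auto
  then show ?thesis unfolding finitely_generated_def
    using G G' cA cB by (intro exI[of _ ?G]) auto
qed

section \<open>The double of the standard module as a Banach space\<close>

definition pcoord :: "'a::unital_cstar_algebra l2 \<times> 'a l2 \<Rightarrow> (nat \<Rightarrow> 'a) \<times> (nat \<Rightarrow> 'a)" where
  "pcoord z = (coord (fst z), coord (snd z))"

definition pact :: "'a::unital_cstar_algebra l2 \<times> 'a l2 \<Rightarrow> 'a \<Rightarrow> 'a l2 \<times> 'a l2" where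
  "pact z a = (act (fst z) a, act (snd z) a)"

abbreviation std2 :: "((nat \<Rightarrow> 'a) \<times> (nat \<Rightarrow> 'a), 'a::unital_cstar_algebra) hmodule" where
  "std2 \<equiv> std_module \<oplus>\<^sub>H std_module"

lemma inj_pcoord: "inj pcoord"
  by (auto intro!: injI simp: pcoord_def coord_inject prod_eq_iff)

lemma pcoord_eq_iff [simp]: "pcoord x = pcoord y \<longleftrightarrow> x = y"
  using inj_pcoord by (auto dest: injD)

lemma hcarrier_std2:
  "hcarrier (std2 :: (_, 'a::unital_cstar_algebra) hmodule) = range pcoord"
proof -
  have "(coord x, coord y) \<in> range pcoord" for x y :: "'a l2"
    by (intro image_eqI[of _ _ "(x, y)"]) (simp_all add: pcoord_def)
  then have "range coord \<times> range coord \<subseteq> range (pcoord :: 'a l2 \<times> 'a l2 \<Rightarrow> _)" by blast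
  moreover have "range (pcoord :: 'a l2 \<times> 'a l2 \<Rightarrow> _) \<subseteq> range coord \<times> range coord"
    by (auto simp: pcoord_def)
  ultimately show ?thesis by simp
qed

lemma pcoord_add: "pcoord (x + y) = pcoord x + pcoord y"
  and pcoord_diff: "pcoord (x - y) = pcoord x - pcoord y"
  and pcoord_zero [simp]: "pcoord 0 = 0"
  by (auto simp: pcoord_def coord_add coord_diff zero_prod_def)

lemma hact_std2: "hact std2 (pcoord z) a = pcoord (pact z a)"
  by (simp add: pcoord_def pact_def hact_std)

lemma hscale_std2: "hscale std2 c (pcoord z) = pcoord (pact z (c *\<^sub>C 1))"
  by (simp add: pcoord_def pact_def hscale_std)

lemma hinner_std2: "hinner std2 (pcoord z) (pcoord w) = cinner (fst z) (fst w) + cinner (snd z) (snd w)"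
  by (simp add: pcoord_def hinner_std)

text \<open>The norm of the product type is not the module norm of the double, but the two are
  equivalent, so bounded maps and closed submodules are the same for both. The constant 2 is a crude
  common bound.\<close>

lemma hnorm_std2_bounds:
  "hnorm std2 (pcoord z) \<le> 2 * norm z" "norm z \<le> 2 * hnorm std2 (pcoord z)"
proof -
  define h where "h = hnorm std2 (pcoord z)"
  have h0: "h \<ge> 0" by (simp add: h_def hnorm_def)
  have h: "h\<^sup>2 = norm (cinner (fst z) (fst z) + cinner (snd z) (snd z))"
    by (simp add: h_def hnorm_def hinner_std2)
  have z: "(norm z)\<^sup>2 = (norm (fst z))\<^sup>2 + (norm (snd z))\<^sup>2" by (simp add: norm_prod_def)
  have "h\<^sup>2 \<le> (norm z)\<^sup>2" unfolding h z norm_l2_square by (rule norm_triangle_ineq)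
  then have "h \<le> norm z" by (rule power2_le_imp_le) simp
  then show "hnorm std2 (pcoord z) \<le> 2 * norm z" unfolding h_def[symmetric] using norm_ge_zero[of z] by linarith
  have "(norm (fst z))\<^sup>2 \<le> h\<^sup>2" "(norm (snd z))\<^sup>2 \<le> h\<^sup>2"
    unfolding h norm_l2_square by (intro norm_mono_cpos; simp add: cpos_cinner)+
  then have "(norm z)\<^sup>2 \<le> h\<^sup>2 + h\<^sup>2" unfolding z by (rule add_mono)
  also have "\<dots> \<le> (2 * h)\<^sup>2" using zero_le_square[of h] by (simp add: power2_eq_square)
  finally have "(norm z)\<^sup>2 \<le> (2 * h)\<^sup>2" .
  from power2_le_imp_le[OF this] h0 show "norm z \<le> 2 * hnorm std2 (pcoord z)"
    unfolding h_def[symmetric] by simp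
qed

text \<open>Complex linearity is contained in the second condition, because \<open>hscale\<close> is
  \<open>pact\<close> by a multiple of 1, see \<open>hscale_std2\<close>.\<close>

definition modlin :: "('a::unital_cstar_algebra l2 \<times> 'a l2 \<Rightarrow> 'a l2 \<times> 'a l2) \<Rightarrow> bool" where
  "modlin f \<longleftrightarrow> bounded_linear f \<and> (\<forall>z a. f (pact z a) = pact (f z) a)"

text \<open>Agreement of \<open>g\<close> with \<open>f\<close> is asked on \<open>M\<close> alone,
  so that \<open>inv_into\<close> of an operator can be described by a globally defined
  \<open>f\<close>.\<close>

lemma bounded_module_map_std2:
  assumes f: "modlin f" and g: "\<And>z. z \<in> M \<Longrightarrow> g (pcoord z) = pcoord (f z)" and "f ` M \<subseteq> N"
    and M: "\<And>x y. x \<in> M \<Longrightarrow> y \<in> M \<Longrightarrow> x + y \<in> M" "\<And>x a. x \<in> M \<Longrightarrow> pact x a \<in> M"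
  shows "bounded_module_map (std2 \<restriction>\<^sub>H pcoord ` M) (std2 \<restriction>\<^sub>H pcoord ` N) g"
proof -
  have bl: "bounded_linear f" using f by (simp add: modlin_def)
  obtain B where B: "\<And>x. norm (f x) \<le> norm x * B" "B > 0" using bounded_linear.pos_bounded[OF bl] by blast
  have "hnorm std2 (g (pcoord z)) \<le> (4 * B) * hnorm std2 (pcoord z)" if "z \<in> M" for z
  proof -
    have "hnorm std2 (g (pcoord z)) \<le> 2 * norm (f z)" unfolding g[OF that] by (rule hnorm_std2_bounds)
    also have "\<dots> \<le> 2 * (norm z * B)" using B(1) by simp
    also have "\<dots> \<le> 2 * ((2 * hnorm std2 (pcoord z)) * B)"
      using B(2) hnorm_std2_bounds(2)[of z] by (intro mult_left_mono mult_right_mono) auto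
    finally show ?thesis by (simp add: mult.commute mult.left_commute)
  qed
  moreover have "g (pcoord x + pcoord y) = g (pcoord x) + g (pcoord y)" if "x \<in> M" "y \<in> M" for x y
  proof -
    have "g (pcoord (x + y)) = pcoord (f x + f y)" using g[OF M(1)[OF that]] linear_add[OF bounded_linear.linear[OF bl]] by simp
    then show ?thesis using that by (simp add: pcoord_add g)
  qed
  ultimately have 1: "\<forall>w\<in>pcoord ` M. hnorm std2 (g w) \<le> (4 * B) * hnorm std2 w"
    and 2: "\<forall>w\<in>pcoord ` M. \<forall>w'\<in>pcoord ` M. g (w + w') = g w + g w'" by simp_all
  have act: "g (pcoord (pact z a)) = pcoord (pact (f z) a)" if "z \<in> M" for z a
    using g[OF M(2)[OF that]] f by (simp add: modlin_def)
  have 3: "\<forall>w\<in>pcoord ` M. g w \<in> pcoord ` N" using g assms(3) by auto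
  have 4: "\<forall>w\<in>pcoord ` M. g (hscale std2 c w) = hscale std2 c (g w)" for c
    by (simp add: hscale_std2 act g del: orth_sum_simps)
  have 5: "\<forall>w\<in>pcoord ` M. g (hact std2 w a) = hact std2 (g w) a" for a
    by (simp add: hact_std2 act g del: orth_sum_simps)
  show ?thesis
    unfolding bounded_module_map_def restr_simps
    by (intro conjI allI 2 3 4 5 exI[of _ "4 * B"] 1)
qed

lemma closed_submodule_std2:
  assumes "closed M" "0 \<in> M" "\<And>x y. x \<in> M \<Longrightarrow> y \<in> M \<Longrightarrow> x + y \<in> M" "\<And>x a. x \<in> M \<Longrightarrow> pact x a \<in> M"
  shows "closed_submodule std2 (pcoord ` M)"
proof -
  have "l \<in> pcoord ` M" if X: "\<forall>n. X n \<in> pcoord ` M" "(\<lambda>n. hnorm std2 (X n - l)) \<longlonglongrightarrow> 0"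
    and l: "l \<in> hcarrier std2" for X :: "nat \<Rightarrow> _" and l
  proof -
    obtain z where z: "l = pcoord z" using l hcarrier_std2 by blast
    have "\<forall>n. \<exists>y. y \<in> M \<and> X n = pcoord y" using X(1) by auto
    then obtain Z where Z: "\<And>n. Z n \<in> M" "\<And>n. X n = pcoord (Z n)" using choice[of "\<lambda>n y. y \<in> M \<and> X n = pcoord y"] by auto
    have lim: "(\<lambda>n. 2 * hnorm std2 (pcoord (Z n - z))) \<longlonglongrightarrow> 2 * 0"
      using X(2) by (intro tendsto_intros) (simp add: Z(2) z pcoord_diff)
    have "(\<lambda>n. Z n - z) \<longlonglongrightarrow> 0"
    proof (rule Lim_null_comparison)
      show "\<forall>\<^sub>F n in sequentially. norm (Z n - z) \<le> 2 * hnorm std2 (pcoord (Z n - z))"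
        using hnorm_std2_bounds(2) by (intro always_eventually allI)
    qed (use lim in simp)
    then have "Z \<longlonglongrightarrow> z" by (rule LIM_zero_cancel)
    then have "z \<in> M" by (rule closed_sequentially[OF assms(1) Z(1)])
    then show ?thesis by (simp add: z)
  qed
  moreover have "0 \<in> pcoord ` M" using assms(2) pcoord_zero by (metis imageI)
  moreover have "pcoord ` M \<subseteq> hcarrier std2" unfolding hcarrier_std2 by blast
  ultimately show ?thesis
    unfolding closed_submodule_def submodule_def using assms(3,4)
    by (auto simp: hact_std2 hscale_std2 simp flip: pcoord_add simp del: orth_sum_simps)
qed

lemma modlin_compose: "modlin f \<Longrightarrow> modlin g \<Longrightarrow> modlin (\<lambda>z. f (g z))"
  by (auto simp: modlin_def intro: bounded_linear_compose)

lemma pact_diff: "pact (x - y) a = pact x a - pact y a"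
  and pact_zero [simp]: "pact 0 a = 0"
  by (simp_all add: pact_def act.diff_left zero_prod_def)

lemma modlin_diff: "modlin f \<Longrightarrow> modlin g \<Longrightarrow> modlin (\<lambda>z. f z - g z)"
  by (auto simp: modlin_def pact_diff intro: bounded_linear_sub)

lemma modlin_simps:
  assumes "modlin f" shows "f (x + y) = f x + f y" "f (x - y) = f x - f y" "f 0 = 0" "f (pact x a) = pact (f x) a"
  using assms unfolding modlin_def by (auto simp: linear_simps)

lemma closed_submodule_eq_std2:
  assumes "modlin f" "modlin g"
  shows "closed_submodule std2 (pcoord ` {z. f z = g z})"
proof (rule closed_submodule_std2)
  show "closed {z. f z = g z}"
    using assms by (intro closed_Collect_eq linear_continuous_on) (auto simp: modlin_def)
qed (auto simp: modlin_simps[OF assms(1)] modlin_simps[OF assms(2)])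

text \<open>The relations say that \<open>S\<close> inverts \<open>T\<close> up to \<open>P\<close>
  and \<open>Q\<close>, and they imply \<open>S T S = S\<close>, so \<open>S T\<close> and
  \<open>T S\<close> are idempotent. \<open>S T\<close> projects onto the range of \<open>Q\<close>
  along the kernel of \<open>P T\<close>, and \<open>T S\<close> projects onto its own range along
  the kernel of \<open>P\<close>. These four submodules form the decomposition.\<close>

lemma fredholm_criterion:
  fixes T P Q S :: "'a::unital_cstar_algebra l2 \<times> 'a l2 \<Rightarrow> 'a l2 \<times> 'a l2"
  assumes lin: "modlin T" "modlin P" "modlin Q" "modlin S"
    and Tf: "\<And>z. Tf (pcoord z) = pcoord (T z)" "Tf \<in> B\<^sup>a std2 std2"
    and QQ: "\<And>z. Q (Q z) = Q z" and QS: "\<And>z. Q (S z) = S z" and SP: "\<And>z. S (P z) = S z"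
    and PTS: "\<And>z. P (T (S z)) = P z" and STQ: "\<And>z. S (T (Q z)) = Q z"
    and fg: "finitely_generated (std2 \<restriction>\<^sub>H pcoord ` {z. Q z = 0})"
      "finitely_generated (std2 \<restriction>\<^sub>H pcoord ` {z. P z = 0})"
  shows "Tf \<in> M\<Phi> std2"
proof -
  note T = modlin_simps[OF lin(1)] and P = modlin_simps[OF lin(2)]
    and Q = modlin_simps[OF lin(3)] and S = modlin_simps[OF lin(4)]
  have idl: "modlin (\<lambda>z. z)" by (simp add: modlin_def bounded_linear_ident)
  have zerol: "modlin (\<lambda>z. 0)" by (simp add: modlin_def bounded_linear_zero)
  define M1 N1 M2 N2 where "M1 = {z. Q z = z}" and "N1 = {z. P (T z) = 0}"
    and "M2 = {z. T (S z) = z}" and "N2 = {z. P z = 0}"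
  have STM: "S (T z) = z" if "z \<in> M1" for z using STQ[of z] that by (simp add: M1_def)
  have STS: "S (T (S z)) = S z" for z using STQ[of "S z"] by (simp add: QS)
  have cl: "closed_submodule std2 (pcoord ` M1)" "closed_submodule std2 (pcoord ` N1)"
    "closed_submodule std2 (pcoord ` M2)" "closed_submodule std2 (pcoord ` N2)"
    unfolding M1_def N1_def M2_def N2_def
    by (rule closed_submodule_eq_std2[OF lin(3) idl] closed_submodule_eq_std2[OF lin(2) zerol]
        closed_submodule_eq_std2[OF modlin_compose[OF lin(2) lin(1)] zerol]
        closed_submodule_eq_std2[OF modlin_compose[OF lin(1) lin(4)] idl])+
  have int1: "M1 \<inter> N1 = {0}"
  proof -
    have "z = 0" if "z \<in> M1" "z \<in> N1" for z
      using STM[OF that(1)] SP[of "T z"] that(2) by (simp add: N1_def S)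
    moreover have "0 \<in> M1" "0 \<in> N1" by (simp_all add: M1_def N1_def P Q T)
    ultimately show ?thesis by blast
  qed
  have int2: "M2 \<inter> N2 = {0}"
  proof -
    have "z = 0" if "z \<in> M2" "z \<in> N2" for z
      using SP[of z] that by (simp add: M2_def N2_def S T)
    moreover have "0 \<in> M2" "0 \<in> N2" by (simp_all add: M2_def N2_def P S T)
    ultimately show ?thesis by blast
  qed
  have dec1: "S (T z) \<in> M1" "z - S (T z) \<in> N1" for z
    by (simp_all add: M1_def N1_def QS T P PTS)
  have dec2: "T (S z) \<in> M2" "z - T (S z) \<in> N2" for z
    by (simp_all add: M2_def N2_def STS P PTS)
  have int: "pcoord ` A \<inter> pcoord ` B = {0}" if "A \<inter> B = {0}" for A B
    unfolding image_Int[OF inj_pcoord, symmetric] that by simp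
  have d1: "direct_sum_decomp std2 (pcoord ` M1) (pcoord ` N1)"
    unfolding direct_sum_decomp_def
  proof (intro conjI cl int int1 ballI)
    fix w :: "(nat \<Rightarrow> 'a) \<times> (nat \<Rightarrow> 'a)" assume "w \<in> hcarrier std2"
    then obtain z where "w = pcoord z" unfolding hcarrier_std2 by blast
    then have "w = pcoord (S (T z)) + pcoord (z - S (T z))" by (simp flip: pcoord_add)
    then show "\<exists>m\<in>pcoord ` M1. \<exists>n\<in>pcoord ` N1. w = m + n" using dec1 by blast
  qed
  have d2: "direct_sum_decomp std2 (pcoord ` M2) (pcoord ` N2)"
    unfolding direct_sum_decomp_def
  proof (intro conjI cl int int2 ballI)
    fix w :: "(nat \<Rightarrow> 'a) \<times> (nat \<Rightarrow> 'a)" assume "w \<in> hcarrier std2"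
    then obtain z where "w = pcoord z" unfolding hcarrier_std2 by blast
    then have "w = pcoord (T (S z)) + pcoord (z - T (S z))" by (simp flip: pcoord_add)
    then show "\<exists>m\<in>pcoord ` M2. \<exists>n\<in>pcoord ` N2. w = m + n" using dec2 by blast
  qed
  have TM: "T ` M1 \<subseteq> M2" and TN: "T ` N1 \<subseteq> N2"
    using STM by (auto simp: M2_def N1_def N2_def)
  have SM: "S ` M2 \<subseteq> M1" by (auto simp: M1_def QS)
  have subM: "x + y \<in> M1" "pact x a \<in> M1" if "x \<in> M1" "y \<in> M1" for x y a
    using that by (simp_all add: M1_def Q)
  have subM2: "x + y \<in> M2" "pact x a \<in> M2" if "x \<in> M2" "y \<in> M2" for x y a
    using that by (simp_all add: M2_def S T)
  have inj: "inj_on Tf (pcoord ` M1)"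
  proof (rule inj_onI)
    fix v w assume "v \<in> pcoord ` M1" "w \<in> pcoord ` M1" and eq: "Tf v = Tf w"
    then obtain x y where xy: "x \<in> M1" "y \<in> M1" "v = pcoord x" "w = pcoord y" by blast
    from eq have "T x = T y" unfolding xy(3,4) Tf(1) by simp
    then have "S (T x) = S (T y)" by (rule arg_cong)
    then show "v = w" unfolding xy(3,4) STM[OF xy(1)] STM[OF xy(2)] by (rule arg_cong)
  qed
  have im: "Tf ` pcoord ` M1 = pcoord ` M2"
  proof
    show "Tf ` pcoord ` M1 \<subseteq> pcoord ` M2" unfolding image_image Tf(1) using TM by blast
    have "pcoord z \<in> Tf ` pcoord ` M1" if "z \<in> M2" for z
    proof (rule image_eqI)
      show "pcoord z = Tf (pcoord (S z))" using that by (simp add: Tf(1) M2_def)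
      show "pcoord (S z) \<in> pcoord ` M1" using that SM by (intro imageI) blast
    qed
    then show "pcoord ` M2 \<subseteq> Tf ` pcoord ` M1" by blast
  qed
  have inv: "inv_into (pcoord ` M1) Tf (pcoord z) = pcoord (S z)" if "z \<in> M2" for z
  proof (rule inv_into_f_eq[OF inj])
    show "Tf (pcoord (S z)) = pcoord z" using that by (simp add: Tf(1) M2_def)
    show "pcoord (S z) \<in> pcoord ` M1" using that SM by (intro imageI) blast
  qed
  have iso: "module_iso (std2 \<restriction>\<^sub>H pcoord ` M1) (std2 \<restriction>\<^sub>H pcoord ` M2) Tf"
    unfolding module_iso_def restr_simps bij_betw_def
  proof (intro conjI inj im)
    show "bounded_module_map (std2 \<restriction>\<^sub>H pcoord ` M1) (std2 \<restriction>\<^sub>H pcoord ` M2) Tf"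
      by (rule bounded_module_map_std2[OF lin(1) _ TM]) (simp_all add: Tf(1) subM)
    show "bounded_module_map (std2 \<restriction>\<^sub>H pcoord ` M2) (std2 \<restriction>\<^sub>H pcoord ` M1) (inv_into (pcoord ` M1) Tf)"
      by (rule bounded_module_map_std2[OF lin(4) _ SM]) (simp_all add: inv subM2)
  qed
  have diag: "diag_decomp std2 Tf (pcoord ` M1) (pcoord ` N1) (pcoord ` M2) (pcoord ` N2)"
    unfolding diag_decomp_def 
  proof (intro conjI d1 d2 iso)
    show "Tf ` pcoord ` M1 \<subseteq> pcoord ` M2" unfolding im ..
    show "Tf ` pcoord ` N1 \<subseteq> pcoord ` N2" unfolding image_image Tf(1) using TN by blast
  qed
  \<comment> \<open>The kernel \<open>N1\<close> of \<open>P T\<close> differs from the kernel of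
    \<open>Q\<close>, but it is the image of the latter under \<open>h\<close>: on \<open>N1\<close>
    the map \<open>S T\<close> vanishes, and so \<open>h (z - Q z) = z\<close> there.\<close>
  define h where "h z = z - S (T z)" for z
  have hl: "modlin h" unfolding h_def[abs_def] by (rule modlin_diff[OF idl modlin_compose[OF lin(4) lin(1)]])
  define hf where "hf w = pcoord (h (inv pcoord w))" for w
  have hf: "hf (pcoord z) = pcoord (h z)" for z by (simp add: hf_def inv_f_f[OF inj_pcoord])
  have "h ` {z. Q z = 0} = N1"
  proof
    show "h ` {z. Q z = 0} \<subseteq> N1" using dec1 by (auto simp: h_def)
    have "z \<in> h ` {z. Q z = 0}" if "z \<in> N1" for z
    proof (rule image_eqI)
      have "S (T z) = 0" using SP[of "T z"] that by (simp add: N1_def S)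
      then show "z = h (z - Q z)" by (simp add: h_def S T STQ)
    qed (simp add: Q QQ)
    then show "N1 \<subseteq> h ` {z. Q z = 0}" by blast
  qed
  then have hN: "hf ` pcoord ` {z. Q z = 0} = pcoord ` N1"
    unfolding image_image hf by blast
  have "finitely_generated (std2 \<restriction>\<^sub>H hf ` pcoord ` {z. Q z = 0})"
  proof (rule finitely_generated_image[OF fg(1)])
    show "hf 0 = 0" using hf[of 0] by (simp add: modlin_simps[OF hl])
    show "hf (v + w) = hf v + hf w" if vw: "v \<in> pcoord ` {z. Q z = 0}" "w \<in> pcoord ` {z. Q z = 0}" for v w
    proof -
      obtain x y where "v = pcoord x" "w = pcoord y" using vw by blast
      then show ?thesis using hf[of "x + y"] by (simp add: hf pcoord_add modlin_simps[OF hl])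
    qed
    show "hf (hscale std2 c w) = hscale std2 c (hf w)" if w: "w \<in> pcoord ` {z. Q z = 0}" for c w
    proof -
      obtain x where "w = pcoord x" using w by blast
      then show ?thesis by (simp only: hf hscale_std2 modlin_simps[OF hl])
    qed
    show "hf (hact std2 w a) = hact std2 (hf w) a" if w: "w \<in> pcoord ` {z. Q z = 0}" for a w
    proof -
      obtain x where "w = pcoord x" using w by blast
      then show ?thesis by (simp only: hf hact_std2 modlin_simps[OF hl])
    qed
  qed
  then have "finitely_generated (std2 \<restriction>\<^sub>H pcoord ` N1)" unfolding hN .
  with diag fg(2) Tf(2) show ?thesis unfolding Fredholm_def N2_def by blast
qed

section \<open>One-sided inverses and partial isometries from decompositions\<close>

lemma restr_hcarrier: "H \<restriction>\<^sub>H hcarrier H = H"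
  by (simp add: restr_def)

lemma proj_one: "proj 1"
  by (simp add: proj_def)

lemma range_app_one: "range (app 1) = UNIV"
  by (simp add: app_one)

text \<open>Only the values of \<open>J\<close> on its carrier are meaningful; applying
  \<open>p\<close> first gives a map on all of \<open>'a l2\<close> that vanishes on the orthogonal
  complement of that carrier.\<close>

lemma module_map_bounded_linear:
  fixes J :: "(nat \<Rightarrow> 'a::unital_cstar_algebra) \<Rightarrow> nat \<Rightarrow> 'a"
  assumes p: "proj p" and J: "bounded_module_map (std_module \<restriction>\<^sub>H coord ` range (app p)) (std_module \<restriction>\<^sub>H K) J"
    and K: "K \<subseteq> range coord"
  obtains f where "bounded_linear f" "\<And>x. coord (f x) = J (coord (p $$ x))" "\<And>x a. f (act x a) = act (f x) a"
proof -
  define f where "f x = Abs_l2 (J (coord (p $$ x)))" for x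
  have inN: "coord (p $$ x) \<in> coord ` range (app p)" for x by blast
  note J' = J[unfolded bounded_module_map_def restr_simps]
  have c: "coord (f x) = J (coord (p $$ x))" for x
  proof -
    have "J (coord (p $$ x)) \<in> range coord" using J' inN K by blast
    then show ?thesis by (auto simp: f_def coord_inverse)
  qed
  have add: "f (x + y) = f x + f y" for x y
  proof -
    have "coord (f (x + y)) = J (coord (p $$ x) + coord (p $$ y))" by (simp only: c app_add_right coord_add)
    also have "\<dots> = J (coord (p $$ x)) + J (coord (p $$ y))" using J' inN by blast
    finally have "coord (f (x + y)) = coord (f x + f y)" by (simp only: c coord_add)
    then show ?thesis by (simp only: coord_inject)
  qed
  have act: "f (act x a) = act (f x) a" for x a
  proof -
    have "coord (f (act x a)) = J (hact std_module (coord (p $$ x)) a)" by (simp only: c app_act hact_std)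
    also have "\<dots> = hact std_module (J (coord (p $$ x))) a" using J' inN by blast
    finally have "coord (f (act x a)) = coord (act (f x) a)" by (simp only: c[symmetric] hact_std)
    then show ?thesis by (simp only: coord_inject)
  qed
  obtain B where B: "\<forall>w\<in>coord ` range (app p). hnorm std_module (J w) \<le> B * hnorm std_module w" using J' by blast
  have nf: "norm (f x) \<le> norm x * \<bar>B\<bar>" for x
  proof -
    have "norm (f x) = hnorm std_module (J (coord (p $$ x)))" by (simp only: hnorm_std flip: c)
    also have "\<dots> \<le> B * norm (p $$ x)" using B inN by (metis hnorm_std)
    also have "\<dots> \<le> \<bar>B\<bar> * norm x" by (intro mult_mono norm_proj_app_le p) auto
    finally show ?thesis by (simp add: mult.commute)
  qed
  have "bounded_linear f"
    by (rule bounded_linear_intro[OF add _ nf]) (metis act act_scaleR)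
  then show ?thesis using that c act by blast
qed

text \<open>An adjoint \<open>J'\<close> of \<open>J\<close> is defined on the range of
  \<open>q\<close> only. \<open>J'\<close> after \<open>q\<close> is an adjoint of \<open>J\<close>
  after \<open>p\<close>, because the values of the two maps stay in the ranges of \<open>q\<close>
  and \<open>p\<close>.\<close>

lemma adj_of_adjointable:
  fixes J :: "(nat \<Rightarrow> 'a::unital_cstar_algebra) \<Rightarrow> nat \<Rightarrow> 'a"
  assumes p: "proj p" and q: "proj q"
    and J: "J \<in> B\<^sup>a (std_module \<restriction>\<^sub>H coord ` range (app p)) (std_module \<restriction>\<^sub>H coord ` range (app q))"
  obtains T where "\<And>x. coord (T $$ x) = J (coord (p $$ x))"
proof -
  have bJ: "bounded_module_map (std_module \<restriction>\<^sub>H coord ` range (app p)) (std_module \<restriction>\<^sub>H coord ` range (app q)) J"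
    using J by (simp add: adjointable_maps_def)
  obtain J' where J': "bounded_module_map (std_module \<restriction>\<^sub>H coord ` range (app q)) (std_module \<restriction>\<^sub>H coord ` range (app p)) J'"
    "\<forall>x\<in>coord ` range (app p). \<forall>y\<in>coord ` range (app q). hinner std_module (J x) y = hinner std_module x (J' y)"
    using J by (auto simp: adjointable_maps_def)
  have sub: "coord ` A \<subseteq> range coord" for A :: "'a l2 set" by blast
  obtain f where f: "bounded_linear f" "\<And>x. coord (f x) = J (coord (p $$ x))"
    using module_map_bounded_linear[OF p bJ sub] by metis
  obtain g where g: "bounded_linear g" "\<And>x. coord (g x) = J' (coord (q $$ x))"
    using module_map_bounded_linear[OF q J'(1) sub] by metis
  have qf: "q $$ f x = f x" for x
  proof -
    have "coord (f x) \<in> coord ` range (app q)"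
      unfolding f(2) using bJ[unfolded bounded_module_map_def restr_simps] by blast
    then have "f x \<in> range (app q)" by (auto simp: coord_inject)
    then show ?thesis by (simp only: range_proj_iff[OF q])
  qed
  have pg: "p $$ g x = g x" for x
  proof -
    have "coord (g x) \<in> coord ` range (app p)"
      unfolding g(2) using J'(1)[unfolded bounded_module_map_def restr_simps] by blast
    then have "g x \<in> range (app p)" by (auto simp: coord_inject)
    then show ?thesis by (simp only: range_proj_iff[OF p])
  qed
  have sp: "star p = p" "star q = q" using p q by (simp_all add: proj_def)
  have adj: "cinner (f x) y = cinner x (g y)" for x y
  proof -
    have "cinner (f x) y = cinner (q $$ f x) y" by (simp only: qf)
    also have "\<dots> = cinner (f x) (q $$ y)" by (simp only: cinner_app_left sp)
    also have "\<dots> = hinner std_module (J (coord (p $$ x))) (coord (q $$ y))" by (simp only: hinner_std flip: f(2))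
    also have "\<dots> = hinner std_module (coord (p $$ x)) (J' (coord (q $$ y)))" using J'(2) by blast
    also have "\<dots> = cinner (p $$ x) (g y)" by (simp only: hinner_std flip: g(2))
    also have "\<dots> = cinner x (p $$ g y)" by (simp only: cinner_app_left sp)
    finally show ?thesis by (simp only: pg)
  qed
  obtain T where "\<And>x. T $$ x = f x" using ex_adj[OF f(1) g(1) adj] by blast
  then show ?thesis by (intro that[of T]) (simp add: f(2))
qed

lemma adj_of_adjointable_std:
  fixes F :: "(nat \<Rightarrow> 'a::unital_cstar_algebra) \<Rightarrow> nat \<Rightarrow> 'a"
  assumes "F \<in> B\<^sup>a std_module std_module"
  obtains T where "\<And>x. coord (T $$ x) = F (coord x)"
proof -
  have "std_module \<restriction>\<^sub>H coord ` range (app (1 :: 'a adj)) = std_module"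
    unfolding range_app_one hcarrier_std[symmetric] by (rule restr_hcarrier)
  then show ?thesis
    using adj_of_adjointable[OF proj_one proj_one, of F] assms that by (metis app_one)
qed

lemma adj_adjointable:
  fixes T :: "'a::unital_cstar_algebra adj"
  assumes F: "\<And>x. F (coord x) = coord (T $$ x)"
  shows "F \<in> B\<^sup>a std_module std_module"
proof -
  have bm: "bounded_module_map std_module std_module G" if G: "\<And>x. G (coord x) = coord (S $$ x)" for G and S :: "'a adj"
    unfolding bounded_module_map_def hcarrier_std ball_simps
  proof (intro conjI allI ballI exI[of _ "norm S"])
    show "G (coord x + coord y) = G (coord x) + G (coord y)" for x y
      using G[of "x + y"] by (simp only: coord_add app_add_right G)
    show "G (hscale std_module c (coord x)) = hscale std_module c (G (coord x))" for c x
      by (simp only: hscale_std G app_act)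
    show "G (hact std_module (coord x) a) = hact std_module (G (coord x)) a" for a x
      by (simp only: hact_std G app_act)
    show "hnorm std_module (G (coord x)) \<le> norm S * hnorm std_module (coord x)" for x
      by (simp only: G hnorm_std norm_app_le)
  qed (simp add: G)
  define G where "G w = coord (star T $$ Abs_l2 w)" for w
  have G: "G (coord x) = coord (star T $$ x)" for x by (simp add: G_def coord_inverse)
  show ?thesis unfolding adjointable_maps_def mem_Collect_eq
  proof (intro conjI exI[of _ G] bm[OF F] bm[OF G])
    show "\<forall>x\<in>hcarrier std_module. \<forall>y\<in>hcarrier std_module. hinner std_module (F x) y = hinner std_module x (G y)"
      unfolding hcarrier_std by (simp add: F G hinner_std cinner_app_left)
  qed
qed

lemma orthogonal_decomp_proj:
  fixes N :: "(nat \<Rightarrow> 'a::unital_cstar_algebra) set"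
  assumes "direct_sum_decomp std_module (orth_compl std_module N) N"
  obtains p where "proj p" "N = coord ` range (app p)" "\<And>x. coord x \<in> orth_compl std_module N \<longleftrightarrow> p $$ x = 0"
proof -
  define Y where "Y = {x. coord x \<in> N}"
  define Z where "Z = {x. coord x \<in> orth_compl std_module N}"
  have sub: "submodule std_module N" and dec: "\<And>x. \<exists>m\<in>orth_compl std_module N. \<exists>n\<in>N. coord x = m + n"
    using assms by (auto simp: direct_sum_decomp_def closed_submodule_def)
  have NY: "N = coord ` Y" using sub unfolding submodule_def hcarrier_std Y_def by blast
  have ZY: "x \<in> Z \<longleftrightarrow> (\<forall>y\<in>Y. cinner y x = 0)" for x
    by (simp add: Z_def orth_compl_def NY hinner_std)
  have Ya: "x + y \<in> Y" if "x \<in> Y" "y \<in> Y" for x y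
    using that sub by (simp add: Y_def coord_add submodule_def)
  have Yr: "r *\<^sub>R x \<in> Y" if "x \<in> Y" for r x
  proof -
    have "hscale std_module (complex_of_real r) (coord x) \<in> N" using that sub by (simp add: Y_def submodule_def)
    then show ?thesis by (simp add: hscale_std act_of_real_scaleC Y_def)
  qed
  have decYZ: "\<exists>y\<in>Y. \<exists>z\<in>Z. x = y + z" for x
  proof -
    obtain m n where mn: "m \<in> orth_compl std_module N" "n \<in> N" "coord x = m + n" using dec by blast
    obtain y where y: "n = coord y" "y \<in> Y" using mn(2) NY by blast
    have "m \<in> range coord" using mn(1) by (simp add: orth_compl_def)
    then obtain z where z: "m = coord z" by blast
    have "z \<in> Z" using mn(1) z by (simp add: Z_def)
    moreover have "x = y + z" using mn(3) y z coord_inject[of x "z + y"] by (simp add: coord_add add.commute)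
    ultimately show ?thesis using y by blast
  qed
  obtain p where p: "proj p" "range (app p) = Y" "\<And>z. z \<in> Z \<Longrightarrow> p $$ z = 0"
  proof (rule ex_proj_if_orthogonal_decomp[of Y Z, OF Ya Yr _ _ _ decYZ])
    show "x + y \<in> Z" if "x \<in> Z" "y \<in> Z" for x y using that by (simp add: ZY cinner_add_right)
    show "r *\<^sub>R x \<in> Z" if "x \<in> Z" for x r using that by (simp add: ZY cinner.scaleR_right)
    show "cinner y z = 0" if "y \<in> Y" "z \<in> Z" for y z using that by (simp add: ZY)
    fix p assume "proj p" "range (app p) = Y" "\<And>z. z \<in> Z \<Longrightarrow> p $$ z = 0"
    then show thesis by (rule that)
  qed
  have "coord x \<in> orth_compl std_module N \<longleftrightarrow> p $$ x = 0" for x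
  proof -
    have "x \<in> Z" if "p $$ x = 0"
      unfolding ZY
    proof
      fix y assume "y \<in> Y"
      then have "p $$ y = y" unfolding p(2)[symmetric] by (simp only: range_proj_iff[OF p(1)])
      then have "cinner y x = cinner (p $$ y) x" by simp
      also have "\<dots> = cinner y (p $$ x)" using p(1) unfolding proj_def by (simp only: cinner_app_left)
      finally show "cinner y x = 0" by (simp add: that)
    qed
    then show ?thesis using p(3) by (auto simp: Z_def)
  qed
  then show ?thesis using that p(1,2) NY by blast
qed

text \<open>\<open>g = A\<^sup>* A + (1 - q)\<close> is bounded below, hence invertible, and commutes with \<open>q\<close>.\<close>

lemma ex_left_inverse:
  fixes A :: "'a::unital_cstar_algebra adj"
  assumes q: "proj q" and Aq: "A * q = A" and C: "\<And>x. norm (q $$ x) \<le> C * norm (A $$ x)"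
  obtains L where "L * A = q" "q * L = L"
proof -
  define g where "g = star A * A + (1 - q)"
  have sq: "star q = q" and qq: "q * q = q" using q by (simp_all add: proj_def)
  have q': "star (1 - q) * (1 - q) = 1 - q" by (simp add: star_diff sq qq algebra_simps)
  have qA: "q * star A = star A" using arg_cong[OF Aq, of star] by (simp add: star_mult sq)
  have pg: "cpos g" unfolding g_def
    using cpos_add[OF cpos_star_mult_self[of A] cpos_star_mult_self[of "1 - q"]] by (simp add: q')
  have lowAA: "norm (q $$ x) \<le> C\<^sup>2 * norm (star A $$ A $$ x)" for x
  proof (cases "q $$ x = 0")
    case False
    have "(norm (q $$ x))\<^sup>2 \<le> (C * norm (A $$ x))\<^sup>2" by (intro power_mono C) simp
    also have "\<dots> = C\<^sup>2 * norm (cinner x (star A $$ A $$ x))"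
      by (simp add: power_mult_distrib norm_l2_square cinner_app_left)
    also have "cinner x (star A $$ A $$ x) = cinner (q $$ x) (star A $$ A $$ x)"
      by (metis app_mult cinner_app_left qA sq)
    also have "C\<^sup>2 * norm \<dots> \<le> C\<^sup>2 * (norm (q $$ x) * norm (star A $$ A $$ x))"
      by (intro mult_left_mono norm_cinner_le) simp
    finally show ?thesis using False by (simp add: power2_eq_square)
  qed simp
  have lowg: "norm x \<le> (C\<^sup>2 + 1) * norm (g $$ x)" for x
  proof -
    \<comment> \<open>\<open>u\<close> lies in the range of \<open>q\<close> and \<open>v\<close> in
      its kernel, so each is bounded by their sum \<open>g $$ x\<close>. By \<open>lowAA\<close> the
      norm of \<open>u\<close> controls \<open>q $$ x\<close>, and \<open>v\<close> is the rest of
      \<open>x\<close>.\<close>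
    define u v where "u = star A $$ A $$ x" and "v = x - q $$ x"
    have gx: "g $$ x = u + v" by (simp add: g_def app_add app_mult app.diff_left app_one u_def v_def)
    have "q $$ u = u" by (metis app_mult qA u_def)
    moreover have "q $$ v = 0" by (simp add: v_def app.diff_right proj_app_app[OF q])
    ultimately have uv: "cinner u v = 0" by (metis cinner_app_left cinner.zero_right sq)
    have "norm u \<le> norm (g $$ x)" unfolding gx by (rule norm_le_norm_add_orthogonal[OF uv])
    moreover have "norm v \<le> norm (g $$ x)"
      unfolding gx add.commute[of u] by (rule norm_le_norm_add_orthogonal[OF cinner_swap_zero[OF uv]])
    moreover have "norm x \<le> norm (q $$ x) + norm v" using norm_triangle_ineq[of "q $$ x" v] by (simp add: v_def)
    moreover have "norm (q $$ x) \<le> C\<^sup>2 * norm u" using lowAA by (simp add: u_def)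
    moreover have "C\<^sup>2 * norm u \<le> C\<^sup>2 * norm (g $$ x)" using calculation(1) by (intro mult_left_mono) auto
    ultimately show ?thesis by (simp add: algebra_simps)
  qed
  \<comment> \<open>Inversion is available for operators of the form \<open>star h * h\<close>, so
    it is applied to the positive root of \<open>g\<close>, which inherits the lower bound.\<close>
  obtain h where h: "cpos h" "h * h = g" using cpos_sqrt[OF pg] by metis
  have "norm x \<le> (C\<^sup>2 + 1) * (norm h * norm (h $$ x))" for x
    using lowg[of x] norm_app_le[of h "h $$ x"] mult_left_mono[of "norm (h $$ h $$ x)" "norm h * norm (h $$ x)" "C\<^sup>2 + 1"]
    by (simp add: app_mult flip: h(2))
  then have low: "norm x \<le> ((C\<^sup>2 + 1) * norm h) * norm (h $$ x)" for x by (simp add: mult.assoc)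
  have nh: "(C\<^sup>2 + 1) * norm h > 0"
  proof (rule ccontr)
    assume "\<not> ?thesis"
    then have "(C\<^sup>2 + 1) * norm h * norm (h $$ unit_vec 0) \<le> 0"
      by (rule mult_nonpos_nonneg[OF leI]) simp
    then show False using low[of "unit_vec 0"] by simp
  qed
  obtain B where B: "B * (star h * h) = 1"
    by (rule bounded_below_star_mult_invertible[of "1 / ((C\<^sup>2 + 1) * norm h)" h])
      (use nh low in \<open>simp_all add: field_simps\<close>)
  then have Bg: "B * g = 1" by (simp add: cpos_star h)
  have gq: "g * q = star A * A" by (simp add: g_def algebra_simps qq) (simp add: Aq mult.assoc)
  have "B * star A * A = q" by (metis Bg gq mult.assoc mult.left_neutral)
  \<comment> \<open>The relation \<open>g * q = star A * A\<close> has turned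
    \<open>B * g = 1\<close> into a left inverse on the range of \<open>q\<close>. The leading
    \<open>q\<close> of the witness secures \<open>q * L = L\<close>.\<close>
  then show ?thesis by (intro that[of "q * B * star A"]) (simp_all add: qq mult.assoc, simp add: qq flip: mult.assoc)
qed

lemma proj_diff_one: "proj p \<Longrightarrow> proj (1 - p)"
  by (simp add: proj_def star_diff algebra_simps)

text \<open>Every \<open>y\<close> in the range of \<open>1 - p\<close> has a preimage in
  \<open>M\<^sub>1\<close> of controlled norm, so \<open>star T\<close> is bounded below on that
  range. A left inverse of \<open>star T * (1 - p)\<close> exists by \<open>ex_left_inverse\<close>,
  and its adjoint is \<open>R\<close>. The inverse of \<open>F\<close> on \<open>M\<^sub>1\<close>
  enters only through its norm bound.\<close>

lemma ex_right_inverse_upper: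
  fixes F :: "(nat \<Rightarrow> 'a::unital_cstar_algebra) \<Rightarrow> nat \<Rightarrow> 'a"
  assumes diag: "diag_decomp std_module F M\<^sub>1 N\<^sub>1 (orth_compl std_module N\<^sub>2) N\<^sub>2"
    and T: "\<And>x. coord (T $$ x) = F (coord x)"
    and p: "proj p" "N\<^sub>2 = coord ` range (app p)" "\<And>x. coord x \<in> orth_compl std_module N\<^sub>2 \<longleftrightarrow> p $$ x = 0"
  obtains R where "(1 - p) * T * R = 1 - p" "R * (1 - p) = R" "N\<^sub>1 = coord ` {x. (1 - p) $$ T $$ x = 0}"
proof -
  define q where "q = 1 - p"
  have q: "proj q" "star q = q" using proj_diff_one[OF p(1)] by (simp_all add: q_def proj_def)
  have appq: "q $$ x = x - p $$ x" for x by (simp add: q_def app.diff_left app_one)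
  have dec: "M\<^sub>1 \<subseteq> range coord" "N\<^sub>1 \<subseteq> range coord" "0 \<in> M\<^sub>1" "\<And>x. \<exists>m\<in>M\<^sub>1. \<exists>n\<in>N\<^sub>1. coord x = m + n"
    and F: "F ` M\<^sub>1 \<subseteq> orth_compl std_module N\<^sub>2" "F ` N\<^sub>1 \<subseteq> N\<^sub>2"
    and iso: "module_iso (std_module \<restriction>\<^sub>H M\<^sub>1) (std_module \<restriction>\<^sub>H orth_compl std_module N\<^sub>2) F"
    using diag by (auto simp: diag_decomp_def direct_sum_decomp_def closed_submodule_def submodule_def)
  have bij: "bij_betw F M\<^sub>1 (orth_compl std_module N\<^sub>2)" using iso by (simp add: module_iso_def)
  obtain B where B: "\<forall>y\<in>orth_compl std_module N\<^sub>2. hnorm std_module (inv_into M\<^sub>1 F y) \<le> B * hnorm std_module y"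
    using iso by (auto simp: module_iso_def bounded_module_map_def)
  define A where "A = star T * q"
  have "norm (q $$ x) \<le> B * norm (A $$ x)" for x
  proof -
    define y where "y = q $$ x"
    have y: "coord y \<in> orth_compl std_module N\<^sub>2"
      using p(3)[of y] by (simp add: y_def appq app.diff_right proj_app_app[OF p(1)])
    define u where "u = inv_into M\<^sub>1 F (coord y)"
    have u: "u \<in> M\<^sub>1" "F u = coord y"
      using bij y unfolding u_def by (auto simp: bij_betw_def inv_into_into f_inv_into_f)
    then obtain z where z: "u = coord z" using dec(1) by blast
    have "y = T $$ z" using u(2) T[of z] z by (simp add: coord_inject)
    moreover have "norm z \<le> B * norm y" using B y z by (metis hnorm_std u_def)
    ultimately have "norm y \<le> B * norm (star T $$ y)" by (rule norm_app_bounded_below_adjoint)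
    then show ?thesis by (simp add: A_def app_mult y_def)
  qed
  moreover have "A * q = A" using q by (simp add: A_def proj_def mult.assoc)
  ultimately obtain L where L: "L * A = q" "q * L = L"
    using ex_left_inverse[OF q(1)] by metis
  have 1: "q * T * star L = q"
    using arg_cong[OF L(1), of star] by (simp add: A_def star_mult star_star q(2) mult.assoc)
  have 2: "star L * q = star L" using arg_cong[OF L(2), of star] by (simp add: star_mult q(2))
  have "x \<in> N\<^sub>1 \<longleftrightarrow> x \<in> coord ` {x. q $$ T $$ x = 0}" for x
  proof -
    have N: "q $$ T $$ z = 0" if "coord z \<in> N\<^sub>1" for z
    proof -
      have "coord (T $$ z) \<in> N\<^sub>2" using F(2) that by (auto simp: T)
      then have "T $$ z \<in> range (app p)" by (auto simp: p(2) coord_inject)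
      then show ?thesis by (simp add: appq range_proj_iff[OF p(1)])
    qed
    have "coord z \<in> N\<^sub>1" if z: "q $$ T $$ z = 0" for z
    proof -
      obtain m n where mn: "m \<in> M\<^sub>1" "n \<in> N\<^sub>1" "coord z = m + n" using dec(4) by blast
      obtain m' n' where mn': "m = coord m'" "n = coord n'" using mn dec by blast
      have zmn: "z = m' + n'" using mn(3) mn' by (simp add: coord_inject flip: coord_add)
      have "coord (T $$ m') \<in> orth_compl std_module N\<^sub>2" using F(1) mn(1) mn' by (auto simp: T)
      then have "q $$ T $$ m' = T $$ m'" using p(3) by (simp add: appq)
      moreover have "q $$ T $$ n' = 0" using N mn mn' by blast
      ultimately have "T $$ m' = 0" using z by (simp add: zmn app_add_right)
      then have "F m = F 0" using T[of m'] T[of 0] mn' by simp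
      then have "m = 0" using bij mn(1) dec(3) by (auto simp: bij_betw_def dest: inj_onD)
      then show ?thesis using mn by simp
    qed
    then show ?thesis using N dec(2) by blast
  qed
  then have "N\<^sub>1 = coord ` {x. q $$ T $$ x = 0}" by blast
  then show ?thesis using that 1 2 unfolding q_def by blast
qed

text \<open>\<open>D\<close> is an isomorphism on the kernel of \<open>p\<close>, so
  \<open>T * (1 - p)\<close> is bounded below there and \<open>ex_left_inverse\<close> applies. The
  operator \<open>1 - T * L\<close> vanishes on \<open>M\<^sub>2\<close>; its range is therefore the
  image of the finitely generated \<open>N\<^sub>2\<close>.\<close>

lemma ex_left_inverse_lower:
  fixes D :: "(nat \<Rightarrow> 'a::unital_cstar_algebra) \<Rightarrow> nat \<Rightarrow> 'a"
  assumes diag: "diag_decomp std_module D (orth_compl std_module N\<^sub>1) N\<^sub>1 M\<^sub>2 N\<^sub>2"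
    and fg: "finitely_generated (std_module \<restriction>\<^sub>H N\<^sub>2)"
    and T: "\<And>x. coord (T $$ x) = D (coord x)"
    and p: "proj p" "\<And>x. coord x \<in> orth_compl std_module N\<^sub>1 \<longleftrightarrow> p $$ x = 0"
  obtains L where "L * T * (1 - p) = 1 - p" "(1 - p) * L = L"
    "finitely_generated (std_module \<restriction>\<^sub>H coord ` range (app (1 - T * L)))"
proof -
  define q where "q = 1 - p"
  have q: "proj q" "star q = q" using proj_diff_one[OF p(1)] by (simp_all add: q_def proj_def)
  have appq: "q $$ x = x - p $$ x" for x by (simp add: q_def app.diff_left app_one)
  have dec: "N\<^sub>2 \<subseteq> range coord" "\<And>x. \<exists>m\<in>M\<^sub>2. \<exists>n\<in>N\<^sub>2. coord x = m + n"
    and iso: "module_iso (std_module \<restriction>\<^sub>H orth_compl std_module N\<^sub>1) (std_module \<restriction>\<^sub>H M\<^sub>2) D"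
    using diag by (auto simp: diag_decomp_def direct_sum_decomp_def closed_submodule_def submodule_def)
  have bij: "bij_betw D (orth_compl std_module N\<^sub>1) M\<^sub>2" using iso by (simp add: module_iso_def)
  obtain B where B: "\<forall>y\<in>M\<^sub>2. hnorm std_module (inv_into (orth_compl std_module N\<^sub>1) D y) \<le> B * hnorm std_module y"
    using iso by (auto simp: module_iso_def bounded_module_map_def)
  define A where "A = T * q"
  have "norm (q $$ x) \<le> B * norm (A $$ x)" for x
  proof -
    define w where "w = q $$ x"
    have w: "coord w \<in> orth_compl std_module N\<^sub>1"
      using p(2)[of w] by (simp add: w_def appq app.diff_right proj_app_app[OF p(1)])
    have Tw: "coord (T $$ w) \<in> M\<^sub>2" using bij w by (auto simp: T bij_betw_def)
    have "inv_into (orth_compl std_module N\<^sub>1) D (coord (T $$ w)) = coord w"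
      unfolding T using bij w by (simp add: bij_betw_def)
    then have "norm w \<le> B * norm (T $$ w)" using B Tw by (metis hnorm_std)
    then show ?thesis by (simp add: A_def app_mult w_def)
  qed
  moreover have "A * q = A" using q by (simp add: A_def proj_def mult.assoc)
  ultimately obtain L where L: "L * A = q" "q * L = L"
    using ex_left_inverse[OF q(1)] by metis
  define e where "e = 1 - T * L"
  have e0: "e $$ T $$ w = 0" if "q $$ w = w" for w
  proof -
    have "L $$ T $$ q $$ w = q $$ w" using L(1) unfolding A_def by (metis app_mult)
    then show ?thesis by (simp add: that e_def app.diff_left app_one app_mult)
  qed
  define f where "f v = coord (e $$ Abs_l2 v)" for v
  have f: "f (coord x) = coord (e $$ x)" for x by (simp add: f_def coord_inverse)
  have "coord ` range (app e) \<subseteq> f ` N\<^sub>2"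
  proof
    fix v assume "v \<in> coord ` range (app e)"
    then obtain x where x: "v = coord (e $$ x)" by blast
    obtain m n where mn: "m \<in> M\<^sub>2" "n \<in> N\<^sub>2" "coord x = m + n" using dec(2) by blast
    have "m \<in> D ` orth_compl std_module N\<^sub>1" using bij mn(1) by (simp add: bij_betw_def)
    then obtain w' where w': "w' \<in> orth_compl std_module N\<^sub>1" "m = D w'" by blast
    then obtain w where w: "w' = coord w" by (auto simp: orth_compl_def)
    have "p $$ w = 0" using w' w p(2) by simp
    then have eT: "e $$ T $$ w = 0" by (intro e0) (simp add: appq)
    obtain n' where n': "n = coord n'" using mn dec(1) by blast
    have "coord x = coord (T $$ w + n')" using mn(3) w' w n' by (simp only: coord_add T)
    then have "x = T $$ w + n'" by (simp only: coord_inject)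
    then have "v = f n" by (simp add: x n' f app_add_right eT)
    then show "v \<in> f ` N\<^sub>2" using mn by blast
  qed
  moreover have "f ` N\<^sub>2 \<subseteq> coord ` range (app e)" using dec(1) by (auto simp: f_def)
  ultimately have rf: "coord ` range (app e) = f ` N\<^sub>2" by (rule subset_antisym)
  have "finitely_generated (std_module \<restriction>\<^sub>H f ` N\<^sub>2)"
  proof (rule finitely_generated_image[OF fg])
    show "f 0 = 0" using f[of 0] by simp
    fix v assume v: "v \<in> N\<^sub>2"
    obtain x where x: "v = coord x" using v dec(1) by blast
    show "f (hscale std_module c v) = hscale std_module c (f v)" for c
      unfolding x by (simp only: hscale_std f app_act)
    show "f (hact std_module v a) = hact std_module (f v) a" for a
      unfolding x by (simp only: hact_std f app_act)
    fix w assume w: "w \<in> N\<^sub>2"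
    obtain y where y: "w = coord y" using w dec(1) by blast
    show "f (v + w) = f v + f w"
      unfolding x y using f[of "x + y"] by (simp only: coord_add f app_add_right)
  qed
  then show ?thesis using that L unfolding rf[symmetric] e_def q_def A_def by (simp add: mult.assoc)
qed

lemma closed_range_if_bounded_below:
  assumes p: "proj p" and f: "bounded_linear f" "\<And>x. f (p $$ x) = f x"
    and low: "\<And>x. norm (p $$ x) \<le> C * norm (f x)"
  shows "closed (range f)"
  unfolding closed_sequential_limits
proof (intro allI impI, elim conjE)
  fix y l assume y: "\<forall>n. y n \<in> range f" "y \<longlonglongrightarrow> l"
  then have "\<forall>n. \<exists>x. y n = f x" by blast
  then obtain x where x: "\<forall>n. y n = f (x n)" by (rule choice[THEN exE])
  define z where "z n = p $$ x n" for n
  have fz: "f (z n) = y n" for n by (simp add: z_def f x)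
  define C' where "C' = \<bar>C\<bar> + 1"
  have C': "C' > 0" "C \<le> C'" by (auto simp: C'_def)
  have low': "norm (z m - z n) \<le> C' * norm (y m - y n)" for m n
  proof -
    have "norm (z m - z n) \<le> C * norm (f (x m - x n))" using low[of "x m - x n"] by (simp add: z_def app.diff_right)
    also have "\<dots> \<le> C' * norm (f (x m - x n))" by (intro mult_right_mono C') simp
    finally show ?thesis using x linear_diff[OF bounded_linear.linear[OF f(1)]] by simp
  qed
  have "Cauchy z"
  proof (rule CauchyI)
    fix d :: real assume d: "d > 0"
    then have "d / C' > 0" using C' by simp
    then obtain M where M: "\<And>m n. m \<ge> M \<Longrightarrow> n \<ge> M \<Longrightarrow> norm (y m - y n) < d / C'"
      using LIMSEQ_imp_Cauchy[OF y(2)] unfolding Cauchy_iff by blast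
    have "norm (z m - z n) < d" if "m \<ge> M" "n \<ge> M" for m n
    proof -
      have "C' * norm (y m - y n) < d" using M[OF that] C' by (simp add: field_simps)
      then show ?thesis using low'[of m n] by linarith
    qed
    then show "\<exists>M. \<forall>m\<ge>M. \<forall>n\<ge>M. norm (z m - z n) < d" by blast
  qed
  then obtain u where u: "z \<longlonglongrightarrow> u" using Cauchy_convergent convergent_def by blast
  from bounded_linear.tendsto[OF f(1) u] have "y \<longlonglongrightarrow> f u" by (simp add: fz)
  then have "l = f u" by (rule LIMSEQ_unique[OF y(2)])
  then show "l \<in> range f" by simp
qed

text \<open>The isomorphism and \<open>J\<close> are different maps with the same image and play
  different roles. The isomorphism is bounded below, so the image is closed; \<open>J\<close> is
  adjointable, so a closed image is the range of a projection \<open>q\<close>. The unitary onto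
  this range comes again from the isomorphism.\<close>

lemma ex_partial_isometry_onto_image:
  fixes J :: "(nat \<Rightarrow> 'a::unital_cstar_algebra) \<Rightarrow> nat \<Rightarrow> 'a"
  assumes p: "proj p" "N = coord ` range (app p)" and r: "proj r" "K = coord ` range (app r)"
    and J: "J \<in> B\<^sup>a (std_module \<restriction>\<^sub>H N) (std_module \<restriction>\<^sub>H K)"
    and iso: "std_module \<restriction>\<^sub>H N \<cong>\<^sub>H std_module \<restriction>\<^sub>H (J ` N)"
  obtains V q where "proj q" "star V * V = p" "V * star V = q" "r * q = q"
    "orth_compl (std_module \<restriction>\<^sub>H K) (J ` N) = coord ` range (app (r - q))"
proof -
  obtain T where T: "\<And>x. coord (T $$ x) = J (coord (p $$ x))"
    using adj_of_adjointable[OF p(1) r(1)] J unfolding p(2) r(2) by metis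
  have rT: "coord ` range (app T) = J ` N" unfolding p(2) image_image T ..
  have JK: "J ` N \<subseteq> K" using J by (auto simp: adjointable_maps_def bounded_module_map_def)
  obtain \<Phi> where \<Phi>: "module_iso (std_module \<restriction>\<^sub>H N) (std_module \<restriction>\<^sub>H (J ` N)) \<Phi>"
    using iso by (auto simp: isomorphic_def)
  have b\<Phi>: "bounded_module_map (std_module \<restriction>\<^sub>H N) (std_module \<restriction>\<^sub>H (J ` N)) \<Phi>"
    and bij: "bij_betw \<Phi> N (J ` N)" using \<Phi> by (simp_all add: module_iso_def)
  obtain B where B: "\<forall>y\<in>J ` N. hnorm std_module (inv_into N \<Phi> y) \<le> B * hnorm std_module y"
    using \<Phi> by (auto simp: module_iso_def bounded_module_map_def)
  have "J ` N \<subseteq> range coord" unfolding rT[symmetric] by blast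
  then obtain f where f: "bounded_linear f" "\<And>x. coord (f x) = \<Phi> (coord (p $$ x))" "\<And>x a. f (act x a) = act (f x) a"
    using module_map_bounded_linear[OF p(1) b\<Phi>[unfolded p(2)]] unfolding p(2) by metis
  have fp: "f (p $$ x) = f x" for x
    using f(2)[of "p $$ x"] f(2)[of x] by (simp add: proj_app_app[OF p(1)] coord_inject[symmetric])
  have inN: "coord (p $$ x) \<in> N" for x unfolding p(2) by blast
  have low: "norm (p $$ x) \<le> B * norm (f x)" for x
  proof -
    have "inv_into N \<Phi> (coord (f x)) = coord (p $$ x)"
      unfolding f(2) using bij inN by (simp add: bij_betw_def)
    moreover have "coord (f x) \<in> J ` N" unfolding f(2) using bij inN by (auto simp: bij_betw_def)
    ultimately show ?thesis using B by (metis hnorm_std)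
  qed
  have "coord ` range f = \<Phi> ` N" unfolding p(2) image_image f(2) ..
  also have "\<dots> = coord ` range (app T)" using bij rT by (simp add: bij_betw_def)
  finally have rf: "range f = range (app T)" by (auto simp: inj_image_eq_iff coord_inject inj_def)
  have "closed (range (app T))" unfolding rf[symmetric] by (rule closed_range_if_bounded_below[OF p(1) f(1) fp low])
  then obtain q where q: "proj q" "range (app q) = range (app T)" using closed_range_proj_exists by blast
  obtain V where V: "star V * V = p" "V * star V = q"
    using ex_partial_isometry_if_isomorphic[OF p(1) q(1) f(1,3) fp _ low] rf q(2) by metis
  have sq: "star q = q" and sr: "star r = r" using q r by (simp_all add: proj_def)
  have rT': "r $$ T $$ x = T $$ x" for x
  proof -
    have "coord (T $$ x) \<in> coord ` range (app r)" using rT JK unfolding r(2) by blast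
    then have "T $$ x \<in> range (app r)" by (auto simp: coord_inject)
    then show ?thesis by (simp only: range_proj_iff[OF r(1)])
  qed
  have rq: "r * q = q"
  proof (rule adj_ext)
    fix x
    obtain y where "q $$ x = T $$ y" using q(2) by blast
    then show "(r * q) $$ x = q $$ x" by (simp add: app_mult rT')
  qed
  have qr: "q * r = q" using arg_cong[OF rq, of star] by (simp add: star_mult sq sr)
  have qT: "q $$ T $$ x = T $$ x" for x using range_proj_iff[OF q(1)] q(2) by blast
  have oc: "coord z \<in> orth_compl (std_module \<restriction>\<^sub>H K) (J ` N) \<longleftrightarrow> r $$ z = z \<and> q $$ z = 0" for z
  proof -
    have "coord z \<in> K \<longleftrightarrow> r $$ z = z"
      unfolding r(2) by (simp add: inj_image_mem_iff inj_def coord_inject range_proj_iff[OF r(1)])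
    moreover have "(\<forall>x\<in>J ` N. hinner std_module x (coord z) = 0) \<longleftrightarrow> (\<forall>x. cinner (T $$ x) z = 0)"
      unfolding rT[symmetric] by (simp add: hinner_std)
    moreover have "(\<forall>x. cinner (T $$ x) z = 0) \<longleftrightarrow> q $$ z = 0"
    proof
      assume a: "\<forall>x. cinner (T $$ x) z = 0"
      show "q $$ z = 0"
      proof (rule l2_ext)
        fix w
        obtain y where y: "q $$ w = T $$ y" using q(2) by blast
        have "cinner w (q $$ z) = cinner (T $$ y) z" by (simp add: cinner_app_right sq y)
        then show "cinner w (q $$ z) = cinner w 0" using a by simp
      qed
    next
      assume a: "q $$ z = 0"
      show "\<forall>x. cinner (T $$ x) z = 0"
      proof
        fix x
        have "cinner (T $$ x) z = cinner (q $$ T $$ x) z" by (simp only: qT)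
        then show "cinner (T $$ x) z = 0" by (simp add: cinner_app_left[of q] sq a)
      qed
    qed
    ultimately show ?thesis by (simp add: orth_compl_def)
  qed
  have "orth_compl (std_module \<restriction>\<^sub>H K) (J ` N) = coord ` range (app (r - q))"
  proof
    show "orth_compl (std_module \<restriction>\<^sub>H K) (J ` N) \<subseteq> coord ` range (app (r - q))"
    proof
      fix w assume w: "w \<in> orth_compl (std_module \<restriction>\<^sub>H K) (J ` N)"
      then have "w \<in> K" by (simp add: orth_compl_def)
      then obtain z where z: "w = coord z" unfolding r(2) by blast
      have "z = (r - q) $$ z" using w oc[of z] by (simp add: z app.diff_left)
      then show "w \<in> coord ` range (app (r - q))" unfolding z by (intro imageI) (rule range_eqI)
    qed
    have "coord ((r - q) $$ x) \<in> orth_compl (std_module \<restriction>\<^sub>H K) (J ` N)" for x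
    proof -
      have "r * (r - q) = r - q" "q * (r - q) = 0"
        using rq qr q(1) r(1) by (simp_all add: proj_def algebra_simps)
      then show ?thesis unfolding oc by (metis app_mult app_zero)
    qed
    then show "coord ` range (app (r - q)) \<subseteq> orth_compl (std_module \<restriction>\<^sub>H K) (J ` N)" by blast
  qed
  then show ?thesis using that q(1) V rq by blast
qed

section \<open>Operator matrices on the double\<close>

definition block :: "'a::unital_cstar_algebra adj \<Rightarrow> 'a adj \<Rightarrow> 'a adj \<Rightarrow> 'a adj \<Rightarrow> 'a l2 \<times> 'a l2 \<Rightarrow> 'a l2 \<times> 'a l2" where
  "block a b c d z = (a $$ fst z + b $$ snd z, c $$ fst z + d $$ snd z)"

lemma block_block:
  "block a b c d (block a' b' c' d' z)
    = block (a * a' + b * c') (a * b' + b * d') (c * a' + d * c') (c * b' + d * d') z"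
  by (simp add: block_def app_add app_add_right app_mult add_ac)

lemma modlin_block: "modlin (block a b c d)"
proof -
  have "bounded_linear (\<lambda>z. a $$ fst z + b $$ snd z)" for a b :: "'a adj"
    by (intro bounded_linear_add bounded_linear_compose[OF bounded_linear_app[of a] bounded_linear_fst]
        bounded_linear_compose[OF bounded_linear_app[of b] bounded_linear_snd])
  then have "bounded_linear (block a b c d)"
    unfolding block_def[abs_def] by (intro bounded_linear_Pair)
  moreover have "block a b c d (pact z x) = pact (block a b c d z) x" for z x
    by (simp add: block_def pact_def app_act act.add_left)
  ultimately show ?thesis by (simp add: modlin_def)
qed

lemma block_adjointable:
  fixes a b c d :: "'a::unital_cstar_algebra adj"
  assumes "\<And>z. G (pcoord z) = pcoord (block a b c d z)"
  shows "G \<in> B\<^sup>a std2 std2"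
proof -
  have im: "std2 \<restriction>\<^sub>H pcoord ` UNIV = (std2 :: (_, 'a) hmodule)"
    unfolding hcarrier_std2[symmetric] by (rule restr_hcarrier)
  have bm: "bounded_module_map std2 std2 g" if g: "\<And>z. g (pcoord z) = pcoord (block a b c d z)"
    for g and a b c d :: "'a adj"
    using bounded_module_map_std2[OF modlin_block[of a b c d], of UNIV g UNIV] g by (simp add: im)
  define G' where "G' w = pcoord (block (star a) (star c) (star b) (star d) (inv pcoord w))" for w
  have G': "G' (pcoord z) = pcoord (block (star a) (star c) (star b) (star d) z)" for z
    by (simp add: G'_def inv_f_f[OF inj_pcoord])
  have "hinner std2 (G (pcoord z)) (pcoord w) = hinner std2 (pcoord z) (G' (pcoord w))" for z w
    by (simp only: assms G' hinner_std2) (simp add: block_def cinner_add_left cinner_add_right cinner_app_left)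
  then have "\<forall>x\<in>hcarrier std2. \<forall>y\<in>hcarrier std2. hinner std2 (G x) y = hinner std2 x (G' y)"
    unfolding hcarrier_std2 by blast
  with bm[OF assms] bm[OF G'] show ?thesis unfolding adjointable_maps_def by blast
qed

lemma kernel_idempotent: "a * a = a \<Longrightarrow> {x. a $$ x = 0} = range (app (1 - a))"
proof
  assume a: "a * a = a"
  show "{x. a $$ x = 0} \<subseteq> range (app (1 - a))"
  proof
    fix x assume "x \<in> {x. a $$ x = 0}"
    then have "x = (1 - a) $$ x" by (simp add: app.diff_left app_one)
    then show "x \<in> range (app (1 - a))" by (rule range_eqI)
  qed
  have "a $$ (1 - a) $$ x = 0" for x
    by (simp add: app.diff_left app_one app.diff_right a flip: app_mult)
  then show "range (app (1 - a)) \<subseteq> {x. a $$ x = 0}" by blast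
qed

lemma kernel_block_diag:
  fixes a d :: "'a::unital_cstar_algebra adj"
  shows "pcoord ` {z. block a 0 0 d z = 0} = coord ` {x. a $$ x = 0} \<times> coord ` {x. d $$ x = 0}"
proof -
  have "{z. block a 0 0 d z = 0} = {x. a $$ x = 0} \<times> {x. d $$ x = 0}"
    by (auto simp: block_def zero_prod_def)
  moreover have "pcoord ` (A \<times> B) = coord ` A \<times> coord ` B" for A B :: "'a l2 set"
  proof -
    have "pcoord = map_prod coord (coord :: 'a l2 \<Rightarrow> _)" by (auto simp: pcoord_def)
    then have "pcoord ` (A \<times> B) = map_prod coord coord ` (A \<times> B)" by (rule arg_cong)
    also have "\<dots> = coord ` A \<times> coord ` B" by (intro map_prod_surj_on refl)
    finally show ?thesis .
  qed
  ultimately show ?thesis by simp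
qed

text \<open>The defect \<open>X = C - C * s\<close> satisfies \<open>star X * X = 0\<close>, so it
  vanishes by the C*-identity; the other rules follow by taking adjoints and products.\<close>

lemma partial_isometry_simps:
  fixes C :: "'a::unital_cstar_algebra adj"
  assumes "proj s" "proj t" "star C * C = s" "C * star C = t"
  shows "C * s = C" "t * C = C" "s * star C = star C" "star C * t = star C"
proof -
  have ss: "star s = s" "s * s = s" and tt: "star t = t" "t * t = t" using assms by (simp_all add: proj_def)
  have "star (C - C * s) * (C - C * s) = 0"
    by (simp add: star_diff star_mult ss algebra_simps assms(3) mult.assoc[symmetric])
  then show 1: "C * s = C" by (simp only: star_mult_self_eq_0_iff) simp
  show 2: "t * C = C" by (metis 1 assms(3,4) mult.assoc)
  show "s * star C = star C" using arg_cong[OF 1, of star] by (simp add: star_mult ss)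
  show "star C * t = star C" using arg_cong[OF 2, of star] by (simp add: star_mult tt)
qed

text \<open>The finite generation hypotheses are the four defects of the matrix: the kernel of
  \<open>(1 - p) * F\<close> and the range of \<open>r - s\<close> in the domain, the ranges of
  \<open>p - t\<close> and \<open>1 - D * L\<close> in the codomain. On the remaining part of the
  second summand, \<open>C\<close> carries the range of \<open>s\<close> onto the range of
  \<open>t\<close>.\<close>

theorem block_fredholm:
  fixes F D C R L p r s t :: "'a::unital_cstar_algebra adj"
  assumes R: "(1 - p) * F * R = 1 - p" "R * (1 - p) = R"
    and L: "L * D * (1 - r) = 1 - r" "(1 - r) * L = L"
    and p: "proj p" "proj r" "proj s" "proj t" "r * s = s" "p * t = t"
    and C: "star C * C = s" "C * star C = t"
    and fg: "finitely_generated (std_module \<restriction>\<^sub>H coord ` {x. (1 - p) $$ F $$ x = 0})"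
      "finitely_generated (std_module \<restriction>\<^sub>H coord ` range (app (1 - D * L)))"
      "finitely_generated (std_module \<restriction>\<^sub>H coord ` range (app (r - s)))"
      "finitely_generated (std_module \<restriction>\<^sub>H coord ` range (app (p - t)))"
    and G: "\<And>z. G (pcoord z) = pcoord (block F C 0 D z)"
  shows "G \<in> M\<Phi> std2"
proof -
  define \<pi> \<sigma> where "\<pi> = 1 - p" and "\<sigma> = 1 - r"
  have "star (r * s) = star s" "star (p * t) = star t" by (simp_all only: p)
  then have sr: "s * r = s" and tp: "t * p = t"
    using p(1-4) by (simp_all only: star_mult proj_def)
  have pp: "\<pi> * \<pi> = \<pi>" "\<sigma> * \<sigma> = \<sigma>" "s * s = s" "t * t = t" "\<sigma> * s = 0" "s * \<sigma> = 0" "\<pi> * t = 0" "t * \<pi> = 0"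
    using p(1,2,3,4) p(5,6) sr tp by (simp_all add: proj_def \<pi>_def \<sigma>_def algebra_simps)
  note Cs = partial_isometry_simps[OF p(3,4) C]
  have R': "\<pi> * (F * R) = \<pi>" "R * \<pi> = R" using R by (simp_all add: \<pi>_def mult.assoc)
  have L': "L * (D * \<sigma>) = \<sigma>" "\<sigma> * L = L" using L by (simp_all add: \<sigma>_def mult.assoc)
  have z: "\<pi> * C = 0" "C * \<sigma> = 0" "\<sigma> * star C = 0" "star C * \<pi> = 0" "s * L = 0" "C * L = 0" "R * t = 0" "R * C = 0"
  proof -
    show 1: "\<pi> * C = 0" by (metis Cs(2) pp(7) mult.assoc mult_zero_left)
    show 2: "C * \<sigma> = 0" by (metis Cs(1) pp(6) mult.assoc mult_zero_right)
    show "\<sigma> * star C = 0" by (metis Cs(3) pp(5) mult.assoc mult_zero_left)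
    show "star C * \<pi> = 0" by (metis Cs(4) pp(8) mult.assoc mult_zero_right)
    show "s * L = 0" by (metis L'(2) pp(6) mult.assoc mult_zero_left)
    show "C * L = 0" by (metis L'(2) 2 mult.assoc mult_zero_left)
    show "R * t = 0" by (metis R'(2) pp(7) mult.assoc mult_zero_right)
    show "R * C = 0" by (metis R'(2) 1 mult.assoc mult_zero_right)
  qed
  have LDL: "L * (D * L) = L" by (metis L' mult.assoc)
  have RFR: "R * (F * R) = R" by (metis R' mult.assoc)
  note rel = pp Cs C R' L' z LDL RFR
  \<comment> \<open>Products are normalised to the right, which hides a relation whenever another
    factor follows; so each relation is also provided with a trailing factor.\<close>
  have assoc: "a * (b * x) = c * x" if "a * b = c" for a b c x :: "'a adj" using that by (simp add: mult.assoc[symmetric])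
  have assoc3: "a * (b * (d * x)) = c * x" if "a * (b * d) = c" for a b c d x :: "'a adj"
    using that by (simp add: mult.assoc[symmetric])
  note rel' = rel pp[THEN assoc] Cs[THEN assoc] C[THEN assoc] R'(2)[THEN assoc] L'(2)[THEN assoc] z[THEN assoc]
    R'(1)[THEN assoc3] L'(1)[THEN assoc3] LDL[THEN assoc3] RFR[THEN assoc3]
  \<comment> \<open>The factors are forced by the products with the other entries:
    \<open>1 - L * D\<close> gives \<open>L * D * B = 0\<close>, and \<open>1 - F * R\<close> gives
    \<open>B * F * R = 0\<close>. Moreover \<open>C * B = t * (1 - F * R)\<close> and
    \<open>B * C = (1 - L * D) * s\<close>, which complete \<open>F * R\<close> and
    \<open>L * D\<close> to the identity on the ranges of \<open>t\<close> and
    \<open>s\<close>.\<close>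
  define B where "B = (1 - L * D) * (star C * (1 - F * R))"
  \<comment> \<open>The diagonal entries of \<open>?Q\<close> and \<open>?P\<close> are idempotents
    whose kernels are exactly the four defects.\<close>
  let ?T = "block F C 0 D" and ?Q = "block (R * (\<pi> * F)) 0 0 (\<sigma> + s)"
    and ?P = "block (\<pi> + t) 0 0 (D * L)" and ?S = "block R 0 B L"
  note ring = algebra_simps rel'
  show ?thesis
  proof (rule fredholm_criterion[where T="?T" and P="?P" and Q="?Q" and S="?S"])
    show "modlin ?T" "modlin ?P" "modlin ?Q" "modlin ?S" by (rule modlin_block)+
    show "G (pcoord z) = pcoord (?T z)" for z by (rule G)
    show "G \<in> B\<^sup>a std2 std2" by (rule block_adjointable[OF G])
    show "?Q (?Q z) = ?Q z" for z unfolding block_block by (simp add: ring)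
    show "?Q (?S z) = ?S z" for z unfolding block_block B_def by (simp add: ring)
    show "?S (?P z) = ?S z" for z unfolding block_block B_def by (simp add: ring)
    show "?P (?T (?S z)) = ?P z" for z unfolding block_block B_def by (simp add: ring)
    show "?S (?T (?Q z)) = ?Q z" for z unfolding block_block B_def by (simp add: ring)
    have "{x. (R * (\<pi> * F)) $$ x = 0} = {x. (1 - p) $$ F $$ x = 0}"
    proof -
      have "\<pi> $$ F $$ x = 0" if "R $$ \<pi> $$ F $$ x = 0" for x
      proof -
        have "\<pi> $$ F $$ x = (\<pi> * (F * R) * (\<pi> * F)) $$ x" using R' pp by (simp add: app_mult[symmetric] mult.assoc[symmetric])
        also have "\<dots> = (\<pi> * F) $$ (R $$ \<pi> $$ F $$ x)" by (simp only: app_mult)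
        finally show ?thesis using that by simp
      qed
      then show ?thesis by (auto simp: app_mult \<pi>_def)
    qed
    moreover have "{x. (\<sigma> + s) $$ x = 0} = range (app (r - s))"
    proof -
      have "(\<sigma> + s) * (\<sigma> + s) = \<sigma> + s" by (simp add: ring)
      moreover have "1 - (\<sigma> + s) = r - s" by (simp add: \<sigma>_def)
      ultimately show ?thesis using kernel_idempotent[of "\<sigma> + s"] by (simp only:)
    qed
    ultimately show "finitely_generated (std2 \<restriction>\<^sub>H pcoord ` {z. ?Q z = 0})"
      unfolding kernel_block_diag using fg(1,3) by (simp add: finitely_generated_Times)
    have "{x. (\<pi> + t) $$ x = 0} = range (app (p - t))"
    proof -
      have "(\<pi> + t) * (\<pi> + t) = \<pi> + t" by (simp add: ring)
      moreover have "1 - (\<pi> + t) = p - t" by (simp add: \<pi>_def)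
      ultimately show ?thesis using kernel_idempotent[of "\<pi> + t"] by (simp only:)
    qed
    moreover have "{x. (D * L) $$ x = 0} = range (app (1 - D * L))"
      by (rule kernel_idempotent) (simp add: ring)
    ultimately show "finitely_generated (std2 \<restriction>\<^sub>H pcoord ` {z. ?P z = 0})"
      unfolding kernel_block_diag using fg(2,4) by (simp add: finitely_generated_Times)
  qed
qed

theorem theorem3p6:
  fixes F D :: "(nat \<Rightarrow> 'a::unital_cstar_algebra) \<Rightarrow> nat \<Rightarrow> 'a"
    and M\<^sub>1 N\<^sub>1 N\<^sub>2 N\<^sub>1' M\<^sub>2' N\<^sub>2' :: "(nat \<Rightarrow> 'a) set"
  assumes "F \<in> M\<Phi>\<^sub>+ std_module"
    and "D \<in> M\<Phi>\<^sub>- std_module"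
    and "diag_decomp std_module F M\<^sub>1 N\<^sub>1 (orth_compl std_module N\<^sub>2) N\<^sub>2"
    and "finitely_generated (std_module \<restriction>\<^sub>H N\<^sub>1)"
    and "diag_decomp std_module D (orth_compl std_module N\<^sub>1') N\<^sub>1' M\<^sub>2' N\<^sub>2'"
    and "finitely_generated (std_module \<restriction>\<^sub>H N\<^sub>2')"
    and "(\<exists>J \<in> B\<^sup>a (std_module \<restriction>\<^sub>H N\<^sub>2) (std_module \<restriction>\<^sub>H N\<^sub>1').
            std_module \<restriction>\<^sub>H N\<^sub>2 \<cong>\<^sub>H std_module \<restriction>\<^sub>H (J ` N\<^sub>2) \<and>
            finitely_generated (std_module \<restriction>\<^sub>H orth_compl (std_module \<restriction>\<^sub>H N\<^sub>1') (J ` N\<^sub>2))) \<or>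
         (\<exists>J' \<in> B\<^sup>a (std_module \<restriction>\<^sub>H N\<^sub>1') (std_module \<restriction>\<^sub>H N\<^sub>2).
            std_module \<restriction>\<^sub>H N\<^sub>1' \<cong>\<^sub>H std_module \<restriction>\<^sub>H (J' ` N\<^sub>1') \<and>
            finitely_generated (std_module \<restriction>\<^sub>H orth_compl (std_module \<restriction>\<^sub>H N\<^sub>2) (J' ` N\<^sub>1')))"
  shows "\<exists>C \<in> B\<^sup>a std_module std_module.
           upper_triangular F C D \<in> M\<Phi> (std_module \<oplus>\<^sub>H std_module)"
proof -
  obtain F' where F': "\<And>x. coord (F' $$ x) = F (coord x)"
    using assms(1) adj_of_adjointable_std by (auto simp: upper_semi_Fredholm_def)
  obtain D' where D': "\<And>x. coord (D' $$ x) = D (coord x)"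
    using assms(2) adj_of_adjointable_std by (auto simp: lower_semi_Fredholm_def)
  obtain p where p: "proj p" "N\<^sub>2 = coord ` range (app p)"
    "\<And>x. coord x \<in> orth_compl std_module N\<^sub>2 \<longleftrightarrow> p $$ x = 0"
    using orthogonal_decomp_proj[of N\<^sub>2] assms(3) unfolding diag_decomp_def by metis
  obtain r where r: "proj r" "N\<^sub>1' = coord ` range (app r)"
    "\<And>x. coord x \<in> orth_compl std_module N\<^sub>1' \<longleftrightarrow> r $$ x = 0"
    using orthogonal_decomp_proj[of N\<^sub>1'] assms(5) unfolding diag_decomp_def by metis
  obtain R where R: "(1 - p) * F' * R = 1 - p" "R * (1 - p) = R"
    "N\<^sub>1 = coord ` {x. (1 - p) $$ F' $$ x = 0}"
    using ex_right_inverse_upper[OF assms(3) F' p] by metis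
  obtain L where L: "L * D' * (1 - r) = 1 - r" "(1 - r) * L = L"
    "finitely_generated (std_module \<restriction>\<^sub>H coord ` range (app (1 - D' * L)))"
    using ex_left_inverse_lower[OF assms(5,6) D' r(1,3)] by metis
  \<comment> \<open>One of the two defects is zero: \<open>t = p\<close> in case a) and
    \<open>s = r\<close> in case b).\<close>
  have fg0: "finitely_generated (std_module \<restriction>\<^sub>H coord ` range (app (u - u)))" for u :: "'a adj"
    using finitely_generated_zero by (simp add: image_constant_conv)
  obtain C s t where C: "proj s" "proj t" "r * s = s" "p * t = t" "star C * C = s" "C * star C = t"
    "finitely_generated (std_module \<restriction>\<^sub>H coord ` range (app (r - s)))"
    "finitely_generated (std_module \<restriction>\<^sub>H coord ` range (app (p - t)))"
    using assms(7)
  proof (elim disjE bexE conjE)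
    fix J
    assume J: "J \<in> B\<^sup>a (std_module \<restriction>\<^sub>H N\<^sub>2) (std_module \<restriction>\<^sub>H N\<^sub>1')"
      "std_module \<restriction>\<^sub>H N\<^sub>2 \<cong>\<^sub>H std_module \<restriction>\<^sub>H (J ` N\<^sub>2)"
      and fg: "finitely_generated (std_module \<restriction>\<^sub>H orth_compl (std_module \<restriction>\<^sub>H N\<^sub>1') (J ` N\<^sub>2))"
    obtain V q where V: "proj q" "star V * V = p" "V * star V = q" "r * q = q"
      "orth_compl (std_module \<restriction>\<^sub>H N\<^sub>1') (J ` N\<^sub>2) = coord ` range (app (r - q))"
      using ex_partial_isometry_onto_image[OF p(1,2) r(1,2) J] by metis
    \<comment> \<open>Here \<open>V\<close> leads from \<open>N\<^sub>2\<close> into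
      \<open>N\<^sub>1'\<close>, whereas the corner of the matrix leads from
      \<open>N\<^sub>1'\<close> to \<open>N\<^sub>2\<close>; hence the adjoint is taken.\<close>
    show thesis
      by (rule that[of q p "star V"]) (use V p(1) fg fg0 in \<open>simp_all add: star_star proj_def\<close>)
  next
    fix J
    assume J: "J \<in> B\<^sup>a (std_module \<restriction>\<^sub>H N\<^sub>1') (std_module \<restriction>\<^sub>H N\<^sub>2)"
      "std_module \<restriction>\<^sub>H N\<^sub>1' \<cong>\<^sub>H std_module \<restriction>\<^sub>H (J ` N\<^sub>1')"
      and fg: "finitely_generated (std_module \<restriction>\<^sub>H orth_compl (std_module \<restriction>\<^sub>H N\<^sub>2) (J ` N\<^sub>1'))"
    obtain V q where V: "proj q" "star V * V = r" "V * star V = q" "p * q = q"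
      "orth_compl (std_module \<restriction>\<^sub>H N\<^sub>2) (J ` N\<^sub>1') = coord ` range (app (p - q))"
      using ex_partial_isometry_onto_image[OF r(1,2) p(1,2) J] by metis
    show thesis
      by (rule that[of r q V]) (use V r(1) fg fg0 in \<open>simp_all add: star_star proj_def\<close>)
  qed
  define C' where "C' w = coord (C $$ Abs_l2 w)" for w
  have C': "C' (coord x) = coord (C $$ x)" for x by (simp add: C'_def coord_inverse)
  have "upper_triangular F C' D (pcoord z) = pcoord (block F' C 0 D' z)" for z
    by (simp add: upper_triangular_def pcoord_def block_def C' coord_add F' D')
  then have "upper_triangular F C' D \<in> M\<Phi> (std_module \<oplus>\<^sub>H std_module)"
    using assms(4) unfolding R(3)
    by (intro block_fredholm[OF R(1,2) L(1,2) p(1) r(1) C(1-6) _ L(3) C(7,8)])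
  moreover have "C' \<in> B\<^sup>a std_module std_module" by (rule adj_adjointable[OF C'])
  ultimately show ?thesis by blast
qed

end
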